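(* Let $\mathcal V$ be a $\mathsf{VS}$ $2$-groupoid. Then its $2$-dual $\mathcal V^{2*}$ is (canonically identified with) the $\mathsf{VS}$ $2$-groupoid $$\mathcal V_2^*\times_{O_{01}}(O_0\times_{O_{01}}O_1)\times_{O_{01}}O_0\;\rightrightarrows\; O_0\times_{O_{01}}O_1\;\rightrightarrows\; O_{01}$$ (levels $2$, $1$, $0$), where $$\mathcal V^{2*}_1=\{(\eta^{001},\eta^{011})\in O_0\oplus O_1\mid \eta^{001}(\gamma_1X)=\eta^{011}(\gamma_1X)\ \ \forall X\in\mathcal V_2\},$$ $$\mathcal V^{2*}_2=\{(\phi^{012},\phi^{112},\phi^{122},\phi^{001})\in\mathcal V_2^*\oplus(O_0\oplus O_1)\oplus O_0\mid \phi^{012}(\gamma_0X)=\phi^{112}(\gamma_1X)=\phi^{122}(\gamma_1X)\text{ and }\phi^{012}(\gamma_2X)=\phi^{001}(\gamma_1X)\ \ \forall X\in\mathcal V_2\},$$ equipped with the following face and degeneracy maps. For $(\eta^{001},\eta^{011})\in\mathcal V^{2*}_1$, $\epsilon\in O_{01}$, $X\in\mathcal V_2$: $$\check d^1_0(\eta^{001},\eta^{011})(X)=\eta^{011}(\gamma_0X)=\eta^{011}(X-s_0d_1X+s_0d_2X),$$ $$\check d^1_1(\eta^{001},\eta^{011})(X)=\eta^{001}(\gamma_2X)=\eta^{001}(X-s_1d_1X+s_1d_0X),\qquad \check s^0_0(\epsilon)=(\epsilon,\epsilon);$$ and for $\phi=(\phi^{012},\phi^{112},\phi^{122},\phi^{001})\in\mathcal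 V^{2*}_2$ and $(\eta^{001},\eta^{011})\in\mathcal V^{2*}_1$: $$\check d^2_0\phi=(\phi^{112},\phi^{122}),$$ $$\check d^2_1\phi=(\phi^{012}-\phi^{012}s_0d_0+\phi^{001}s_1d_2,\ \phi^{012}-\phi^{012}s_1d_2+\phi^{122}s_0d_0),$$ $$\check d^2_2\phi=(\phi^{001},\ \phi^{012}-\phi^{012}s_1d_1+\phi^{112}s_1d_0),$$ $$\check s^1_0(\eta^{001},\eta^{011})=(\eta^{001},(\eta^{001},\eta^{011}),\check d_1(\eta^{001},\eta^{011})),\qquad \check s^1_1(\eta^{001},\eta^{011})=(\eta^{011},\check s_0\check d_0(\eta^{001},\eta^{011}),\eta^{001}).$$ The multiplication $\check m_1:\Lambda^3_1(\mathcal V^{2*})\to\mathcal V^{2*}_2$ is determined by the property that $$\langle\check m_1(\phi,\phi',\phi''),m_1(W,Y,Z)\rangle=\langle\phi,W\rangle+\langle\phi',Y\rangle-\langle\phi'',Z\rangle$$ for all $(\phi,\phi',\phi'')\in\Lambda^3_1(\mathcal V^{2*})$ and all $(W,Y,Z)\in\Lambda^3_1(\mathcal V)$ (this relates the $012$-components; the remaining components of $\check m_1(\phi,\phi',\phi'')$ are determined by the simplicial identities).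
   Context: Vector spaces are finite-dimensional over $\mathbb R$; simplicial vector spaces have faces $d_i$ and degeneracies $s_j$; $\mathsf{SVec}$ is their category; $V^*$ is the dual vector space, and juxtaposition such as $\phi s_0d_0$ denotes composition $\phi\circ s_0\circ d_0$. For $m\ge1$, $0\le k\le m$, $\Lambda^m_k(\mathcal V)$ is the space of tuples $(x_0,\dots,\widehat{x_k},\dots,x_m)$ in $\mathcal V_{m-1}$ with $d_ix_j=d_{j-1}x_i$ for $i<j$, $i,j\ne k$; $p^m_k:\mathcal V_m\to\Lambda^m_k(\mathcal V)$ is $x\mapsto(d_ix)_{i\ne k}$. A $\mathsf{VS}$ $n$-groupoid is a simplicial vector space with all $p^m_k$ surjective ($m\ge1$) and bijective for $m\ge n+1$. It is determined by its levels $\le n$ and its multiplications $m_k=d_k\circ(p^{n+1}_k)^{-1}:\Lambda^{n+1}_k(\mathcal V)\to\mathcal V_n$. For $n=2$, an element of $\Lambda^3_1(\mathcal V)$ is written $(W,Y,Z)=(x_0,x_2,x_3)$. $B^n\mathbb R$ is the simplicial vector space whose $m$-simplices are functions $c:\Delta[m]_n\to\mathbb R$ vanishing on degenerate simplices with $\sum_{i=0}^{n+1}(-1)^ic(d_i\sigma)=0$ for all $\sigma\in\Delta[m]_{n+1}$; in particular $(B^n\mathbb R)_n=\mathbb R$ and $(B^n\mathbb R)_m=0$ for $m<n$. $n$-dual: $\Delta[m]_l$ is the set of order-preserving maps $[l]\to[m]$, written as strings of values (e.g. $001\in\Delta[1]_2$); $(\mathcal V\otimes\Delta[m])_l=\bigoplus_{u\in\Delta[m]_l}\mathcal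 V_l^u$ with $d_i(v^u)=(d_iv)^{d_iu}$, $s_i(v^u)=(s_iv)^{s_iu}$. $\mathcal V^{n*}_m=\mathsf{SVec}(\mathcal V\otimes\Delta[m],B^n\mathbb R)$, with structure maps $\check d_i,\check s_i$ by precomposition with those between the $\Delta[m]$'s; it is always a $\mathsf{VS}$ $n$-groupoid. For $f\in\mathcal V^{2*}_m$ and $q\in\Delta[m]_2$, the component $f^q\in\mathcal V_2^*$ is $f^q(v)=f_2(v^q)\in(B^2\mathbb R)_2=\mathbb R$; under the identification in the theorem an element of $\mathcal V^{2*}_0$ is given by its component $000$, an element of $\mathcal V^{2*}_1$ by its components $001,011$, and an element of $\mathcal V^{2*}_2$ by its components $012,112,122,001$. The $2$-dual pairing at level $2$ is $\langle\phi,X\rangle=\phi^{012}(X)$. Annihilators: $O_0=\mathrm{Ann}(s_0\mathcal V_1)$, $O_1=\mathrm{Ann}(s_1\mathcal V_1)$, $O_{01}=O_0\cap O_1=\mathrm{Ann}(s_0\mathcal V_1+s_1\mathcal V_1)$, all subspaces of $\mathcal V_2^*$. Core projections $\mathcal V_2\to\mathcal V_2$ (with $1=s_0s_0:\mathcal V_0\to\mathcal V_2$ the total degeneracy): $\gamma_0X=X-s_0d_1X-s_1d_2X+s_0d_2X$ (onto $\ker d_1\cap\ker d_2$), $\gamma_1X=X-s_0d_0X-s_1d_2X+1d_1d_0X$ (onto $\ker d_0\cap\ker d_2$), $\gamma_2X=X-s_0d_0X-s_1d_1X+s_1d_0X$ (onto $\ker d_0\cap\ker d_1$). *)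

theory Defs
  imports "HOL-Analysis.Analysis" "HOL-Library.Function_Algebras"
begin

instantiation "fun" :: (type, real_vector) real_vector
begin

definition scaleR_fun :: "real \<Rightarrow> ('a \<Rightarrow> 'b) \<Rightarrow> 'a \<Rightarrow> 'b" where
  "scaleR_fun r f = (\<lambda>x. r *\<^sub>R f x)"

instance
  by standard (auto simp: scaleR_fun_def fun_eq_iff scaleR_add_right scaleR_add_left)

end

section \<open>Linear maps between subspaces\<close>

text \<open>A vector space is a subspace of an ambient real vector space. A linear map is only
  constrained on its domain; \<open>lin_hom\<close> consists of the linear maps extended by 0 off the
  domain, so that each of them is represented once and \<open>lin_hom S T\<close> is again a subspace.\<close>

definition lin_on :: "'a::real_vector set \<Rightarrow> 'b::real_vector set \<Rightarrow> ('a \<Rightarrow> 'b) \<Rightarrow> bool" where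
  "lin_on S T f \<longleftrightarrow> (\<forall>x\<in>S. f x \<in> T) \<and> (\<forall>x\<in>S. \<forall>y\<in>S. f (x + y) = f x + f y)
     \<and> (\<forall>r. \<forall>x\<in>S. f (r *\<^sub>R x) = r *\<^sub>R f x)"

definition ext0 :: "'a set \<Rightarrow> ('a \<Rightarrow> 'b::zero) \<Rightarrow> 'a \<Rightarrow> 'b" where
  "ext0 S f = (\<lambda>x. if x \<in> S then f x else 0)"

definition lin_hom :: "'a::real_vector set \<Rightarrow> 'b::real_vector set \<Rightarrow> ('a \<Rightarrow> 'b) set" where
  "lin_hom S T = {f. lin_on S T f \<and> (\<forall>x. x \<notin> S \<longrightarrow> f x = 0)}"

definition dual_space :: "'a::real_vector set \<Rightarrow> ('a \<Rightarrow> real) set" where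
  "dual_space S = lin_hom S UNIV"

definition lin_iso :: "'a::real_vector set \<Rightarrow> 'b::real_vector set \<Rightarrow> ('a \<Rightarrow> 'b) \<Rightarrow> bool" where
  "lin_iso S T f \<longleftrightarrow> lin_on S T f \<and> bij_betw f S T"

section \<open>Simplicial vector spaces\<close>

text \<open>\<open>face V m i\<close> is \<open>d\<^sub>i\<close> from level \<open>m\<close> to level \<open>m - 1\<close>
  (relevant for \<open>m \<ge> 1\<close>, \<open>i \<le> m\<close>) and \<open>degen V m j\<close> is \<open>s\<^sub>j\<close> from level \<open>m\<close> to level \<open>m + 1\<close>
  (relevant for \<open>j \<le> m\<close>).  All levels live in one ambient space; they need not be
  independent or disjoint, so this loses no generality.\<close>

record 'a simp_vs =
  lev :: "nat \<Rightarrow> 'a set"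
  face :: "nat \<Rightarrow> nat \<Rightarrow> 'a \<Rightarrow> 'a"
  degen :: "nat \<Rightarrow> nat \<Rightarrow> 'a \<Rightarrow> 'a"

definition simplicial_vs :: "'a::real_vector simp_vs \<Rightarrow> bool" where
  "simplicial_vs V \<longleftrightarrow>
     (\<forall>m. \<exists>B. finite B \<and> span B = lev V m) \<and>
     (\<forall>m i. i \<le> Suc m \<longrightarrow> lin_on (lev V (Suc m)) (lev V m) (face V (Suc m) i)) \<and>
     (\<forall>m j. j \<le> m \<longrightarrow> lin_on (lev V m) (lev V (Suc m)) (degen V m j)) \<and>
     (\<forall>m i j. i < j \<longrightarrow> j \<le> Suc (Suc m) \<longrightarrow> (\<forall>x\<in>lev V (Suc (Suc m)).
        face V (Suc m) i (face V (Suc (Suc m)) j x)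
          = face V (Suc m) (j - 1) (face V (Suc (Suc m)) i x))) \<and>
     (\<forall>m i j. i \<le> j \<longrightarrow> j \<le> m \<longrightarrow> (\<forall>x\<in>lev V m.
        degen V (Suc m) i (degen V m j x) = degen V (Suc m) (Suc j) (degen V m i x))) \<and>
     (\<forall>m i j. i < j \<longrightarrow> j \<le> Suc m \<longrightarrow> (\<forall>x\<in>lev V (Suc m).
        face V (Suc (Suc m)) i (degen V (Suc m) j x)
          = degen V m (j - 1) (face V (Suc m) i x))) \<and>
     (\<forall>m j. j \<le> m \<longrightarrow> (\<forall>x\<in>lev V m.
        face V (Suc m) j (degen V m j x) = x \<and> face V (Suc m) (Suc j) (degen V m j x) = x)) \<and>
     (\<forall>m i j. Suc j < i \<longrightarrow> i \<le> Suc (Suc m) \<longrightarrow> (\<forall>x\<in>lev V (Suc m).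
        face V (Suc (Suc m)) i (degen V (Suc m) j x)
          = degen V m j (face V (Suc m) (i - 1) x)))"

text \<open>Morphisms, as families of linear maps extended by 0.\<close>

definition svec_hom ::
  "'a::real_vector simp_vs \<Rightarrow> 'b::real_vector simp_vs \<Rightarrow> (nat \<Rightarrow> 'a \<Rightarrow> 'b) set" where
  "svec_hom V W = {f.
     (\<forall>l. f l \<in> lin_hom (lev V l) (lev W l)) \<and>
     (\<forall>l i. i \<le> Suc l \<longrightarrow> (\<forall>x\<in>lev V (Suc l).
        f l (face V (Suc l) i x) = face W (Suc l) i (f (Suc l) x))) \<and>
     (\<forall>l j. j \<le> l \<longrightarrow> (\<forall>x\<in>lev V l.
        f (Suc l) (degen V l j x) = degen W l j (f l x)))}"

section \<open>Horns, VS n-groupoids and multiplications\<close>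

definition horn :: "'a simp_vs \<Rightarrow> nat \<Rightarrow> nat \<Rightarrow> (nat \<Rightarrow> 'a) set" where
  "horn V m k = {x \<in> {..m} - {k} \<rightarrow>\<^sub>E lev V (m - 1).
     \<forall>i j. i < j \<longrightarrow> j \<le> m \<longrightarrow> i \<noteq> k \<longrightarrow> j \<noteq> k \<longrightarrow>
       face V (m - 1) i (x j) = face V (m - 1) (j - 1) (x i)}"

definition horn_proj :: "'a simp_vs \<Rightarrow> nat \<Rightarrow> nat \<Rightarrow> 'a \<Rightarrow> nat \<Rightarrow> 'a" where
  "horn_proj V m k x = (\<lambda>i\<in>{..m} - {k}. face V m i x)"

definition vs_groupoid :: "nat \<Rightarrow> 'a::real_vector simp_vs \<Rightarrow> bool" where
  "vs_groupoid n V \<longleftrightarrow> simplicial_vs V \<and>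
     (\<forall>m\<ge>1. \<forall>k\<le>m. horn_proj V m k ` lev V m = horn V m k) \<and>
     (\<forall>m\<ge>n + 1. \<forall>k\<le>m. bij_betw (horn_proj V m k) (lev V m) (horn V m k))"

definition gmult :: "'a simp_vs \<Rightarrow> nat \<Rightarrow> nat \<Rightarrow> (nat \<Rightarrow> 'a) \<Rightarrow> 'a" where
  "gmult V n k x = face V (n + 1) k (inv_into (lev V (n + 1)) (horn_proj V (n + 1) k) x)"

section \<open>Standard simplices\<close>

text \<open>An order-preserving map from \<open>[l]\<close> to \<open>[m]\<close> is the list of its \<open>l + 1\<close> values.\<close>

definition simplices :: "nat \<Rightarrow> nat \<Rightarrow> nat list set" where
  "simplices m l = {u. length u = Suc l \<and> sorted u \<and> set u \<subseteq> {..m}}"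

definition sface :: "nat \<Rightarrow> nat list \<Rightarrow> nat list" where
  "sface i u = take i u @ drop (Suc i) u"

definition sdegen :: "nat \<Rightarrow> nat list \<Rightarrow> nat list" where
  "sdegen i u = take (Suc i) u @ drop i u"

definition degenerate :: "nat \<Rightarrow> nat \<Rightarrow> nat list \<Rightarrow> bool" where
  "degenerate m l u \<longleftrightarrow> (\<exists>k j v. l = Suc k \<and> j \<le> k \<and> v \<in> simplices m k \<and> u = sdegen j v)"

text \<open>Coface and codegeneracy maps of the cosimplicial object \<open>\<Delta>[-]\<close>; they act on simplices
  by postcomposition, i.e. by \<^term>\<open>map\<close>.\<close>

definition coface :: "nat \<Rightarrow> nat \<Rightarrow> nat" where
  "coface i v = (if v < i then v else Suc v)"

definition codegen :: "nat \<Rightarrow> nat \<Rightarrow> nat" where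
  "codegen j v = (if v \<le> j then v else v - 1)"

section \<open>The n-dual\<close>

definition BnR :: "nat \<Rightarrow> (nat list \<Rightarrow> real) simp_vs" where
  "BnR n = \<lparr>
     lev = (\<lambda>m. {c. (\<forall>\<sigma>. \<sigma> \<notin> simplices m n \<longrightarrow> c \<sigma> = 0) \<and>
                    (\<forall>\<sigma>\<in>simplices m n. degenerate m n \<sigma> \<longrightarrow> c \<sigma> = 0) \<and>
                    (\<forall>\<sigma>\<in>simplices m (n + 1). (\<Sum>i\<le>n + 1. (-1) ^ i * c (sface i \<sigma>)) = 0)}),
     face = (\<lambda>m i c. ext0 (simplices (m - 1) n) (\<lambda>\<sigma>. c (map (coface i) \<sigma>))),
     degen = (\<lambda>m j c. ext0 (simplices (m + 1) n) (\<lambda>\<sigma>. c (map (codegen j) \<sigma>)))\<rparr>"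

text \<open>An element of the direct sum of the copies \<open>V\<^sub>l\<^sup>u\<close> is a function of \<open>u\<close>;
  \<open>copy u v\<close> is \<open>v\<^sup>u\<close>.\<close>

definition copy :: "'u \<Rightarrow> 'a::zero \<Rightarrow> 'u \<Rightarrow> 'a" where
  "copy u v = (\<lambda>w. if w = u then v else 0)"

definition tensor :: "'a::real_vector simp_vs \<Rightarrow> nat \<Rightarrow> (nat list \<Rightarrow> 'a) simp_vs" where
  "tensor V m = \<lparr>
     lev = (\<lambda>l. {x. (\<forall>u\<in>simplices m l. x u \<in> lev V l) \<and> (\<forall>u. u \<notin> simplices m l \<longrightarrow> x u = 0)}),
     face = (\<lambda>l i x. \<Sum>u\<in>simplices m l. copy (sface i u) (face V l i (x u))),
     degen = (\<lambda>l i x. \<Sum>u\<in>simplices m l. copy (sdegen i u) (degen V l i (x u)))\<rparr>"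

text \<open>The level-\<open>l\<close> map out of \<open>V \<otimes> \<Delta>[m]\<close> induced by \<open>\<theta>\<close>, sending \<open>v\<^sup>u\<close>
  to the copy of \<open>v\<close> at \<open>\<theta> \<circ> u\<close>.\<close>

definition tensor_map ::
  "(nat \<Rightarrow> nat) \<Rightarrow> nat \<Rightarrow> nat \<Rightarrow> (nat list \<Rightarrow> 'a::real_vector) \<Rightarrow> nat list \<Rightarrow> 'a" where
  "tensor_map \<theta> m l x = (\<Sum>u\<in>simplices m l. copy (map \<theta> u) (x u))"

definition ndual ::
  "nat \<Rightarrow> 'a::real_vector simp_vs \<Rightarrow> (nat \<Rightarrow> (nat list \<Rightarrow> 'a) \<Rightarrow> nat list \<Rightarrow> real) simp_vs" where
  "ndual n V = \<lparr>
     lev = (\<lambda>m. svec_hom (tensor V m) (BnR n)),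
     face = (\<lambda>m i f l. ext0 (lev (tensor V (m - 1)) l)
               (\<lambda>x. f l (tensor_map (coface i) (m - 1) l x))),
     degen = (\<lambda>m j f l. ext0 (lev (tensor V (m + 1)) l)
               (\<lambda>x. f l (tensor_map (codegen j) (m + 1) l x)))\<rparr>"

text \<open>The component \<open>f\<^sup>q\<close>.  Level \<open>n\<close> of \<^term>\<open>BnR n\<close> is identified with the reals by evaluation
  at \<open>01\<dots>n\<close>, the only nondegenerate element of \<^term>\<open>simplices n n\<close>.\<close>

definition component ::
  "nat \<Rightarrow> 'a::real_vector simp_vs \<Rightarrow> (nat \<Rightarrow> (nat list \<Rightarrow> 'a) \<Rightarrow> nat list \<Rightarrow> real)
    \<Rightarrow> nat list \<Rightarrow> 'a \<Rightarrow> real" where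
  "component n V f q = ext0 (lev V n) (\<lambda>v. f n (copy q v) [0..<n + 1])"

definition pairing2 ::
  "'a::real_vector simp_vs \<Rightarrow> (nat \<Rightarrow> (nat list \<Rightarrow> 'a) \<Rightarrow> nat list \<Rightarrow> real) \<Rightarrow> 'a \<Rightarrow> real" where
  "pairing2 V f X = component 2 V f [0,1,2] X"

section \<open>The explicit model of the 2-dual\<close>

definition Ann2 :: "'a::real_vector simp_vs \<Rightarrow> 'a set \<Rightarrow> ('a \<Rightarrow> real) set" where
  "Ann2 V S = {\<phi> \<in> dual_space (lev V 2). \<forall>x\<in>S. \<phi> x = 0}"

definition O0 :: "'a::real_vector simp_vs \<Rightarrow> ('a \<Rightarrow> real) set" where
  "O0 V = Ann2 V (degen V 1 0 ` lev V 1)"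

definition O1 :: "'a::real_vector simp_vs \<Rightarrow> ('a \<Rightarrow> real) set" where
  "O1 V = Ann2 V (degen V 1 1 ` lev V 1)"

definition O01 :: "'a::real_vector simp_vs \<Rightarrow> ('a \<Rightarrow> real) set" where
  "O01 V = O0 V \<inter> O1 V"

definition gamma0 :: "'a::real_vector simp_vs \<Rightarrow> 'a \<Rightarrow> 'a" where
  "gamma0 V X = X - degen V 1 0 (face V 2 1 X) - degen V 1 1 (face V 2 2 X)
                  + degen V 1 0 (face V 2 2 X)"

definition gamma1 :: "'a::real_vector simp_vs \<Rightarrow> 'a \<Rightarrow> 'a" where
  "gamma1 V X = X - degen V 1 0 (face V 2 0 X) - degen V 1 1 (face V 2 2 X)
                  + degen V 1 0 (degen V 0 0 (face V 1 1 (face V 2 0 X)))"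

definition gamma2 :: "'a::real_vector simp_vs \<Rightarrow> 'a \<Rightarrow> 'a" where
  "gamma2 V X = X - degen V 1 0 (face V 2 0 X) - degen V 1 1 (face V 2 1 X)
                  + degen V 1 1 (face V 2 0 X)"

type_synonym 'a functional = "'a \<Rightarrow> real"
type_synonym 'a dual1 = "'a functional \<times> 'a functional"
type_synonym 'a dual2 = "'a functional \<times> 'a dual1 \<times> 'a functional"

definition dual1_lev :: "'a::real_vector simp_vs \<Rightarrow> 'a dual1 set" where
  "dual1_lev V = {(\<eta>001, \<eta>011). \<eta>001 \<in> O0 V \<and> \<eta>011 \<in> O1 V \<and>
     (\<forall>X\<in>lev V 2. \<eta>001 (gamma1 V X) = \<eta>011 (gamma1 V X))}"

definition dual2_lev :: "'a::real_vector simp_vs \<Rightarrow> 'a dual2 set" where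
  "dual2_lev V = {(\<phi>012, (\<phi>112, \<phi>122), \<phi>001).
     \<phi>012 \<in> dual_space (lev V 2) \<and> \<phi>112 \<in> O0 V \<and> \<phi>122 \<in> O1 V \<and> \<phi>001 \<in> O0 V \<and>
     (\<forall>X\<in>lev V 2. \<phi>012 (gamma0 V X) = \<phi>112 (gamma1 V X) \<and>
                  \<phi>112 (gamma1 V X) = \<phi>122 (gamma1 V X) \<and>
                  \<phi>012 (gamma2 V X) = \<phi>001 (gamma1 V X))}"

definition dual1_face0 :: "'a::real_vector simp_vs \<Rightarrow> 'a dual1 \<Rightarrow> 'a functional" where
  "dual1_face0 V = (\<lambda>(\<eta>001, \<eta>011). ext0 (lev V 2) (\<lambda>X. \<eta>011 (gamma0 V X)))"

definition dual1_face1 :: "'a::real_vector simp_vs \<Rightarrow> 'a dual1 \<Rightarrow> 'a functional" where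
  "dual1_face1 V = (\<lambda>(\<eta>001, \<eta>011). ext0 (lev V 2) (\<lambda>X. \<eta>001 (gamma2 V X)))"

definition dual0_degen0 :: "'a functional \<Rightarrow> 'a dual1" where
  "dual0_degen0 \<epsilon> = (\<epsilon>, \<epsilon>)"

definition dual2_face0 :: "'a dual2 \<Rightarrow> 'a dual1" where
  "dual2_face0 = (\<lambda>(\<phi>012, (\<phi>112, \<phi>122), \<phi>001). (\<phi>112, \<phi>122))"

definition dual2_face1 :: "'a::real_vector simp_vs \<Rightarrow> 'a dual2 \<Rightarrow> 'a dual1" where
  "dual2_face1 V = (\<lambda>(\<phi>012, (\<phi>112, \<phi>122), \<phi>001).
     (ext0 (lev V 2) (\<lambda>X. \<phi>012 X - \<phi>012 (degen V 1 0 (face V 2 0 X))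
                              + \<phi>001 (degen V 1 1 (face V 2 2 X))),
      ext0 (lev V 2) (\<lambda>X. \<phi>012 X - \<phi>012 (degen V 1 1 (face V 2 2 X))
                              + \<phi>122 (degen V 1 0 (face V 2 0 X)))))"

definition dual2_face2 :: "'a::real_vector simp_vs \<Rightarrow> 'a dual2 \<Rightarrow> 'a dual1" where
  "dual2_face2 V = (\<lambda>(\<phi>012, (\<phi>112, \<phi>122), \<phi>001).
     (\<phi>001,
      ext0 (lev V 2) (\<lambda>X. \<phi>012 X - \<phi>012 (degen V 1 1 (face V 2 1 X))
                              + \<phi>112 (degen V 1 1 (face V 2 0 X)))))"

definition dual1_degen0 :: "'a::real_vector simp_vs \<Rightarrow> 'a dual1 \<Rightarrow> 'a dual2" where
  "dual1_degen0 V = (\<lambda>(\<eta>001, \<eta>011). (\<eta>001, (\<eta>001, \<eta>011), dual1_face1 V (\<eta>001, \<eta>011)))"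

definition dual1_degen1 :: "'a::real_vector simp_vs \<Rightarrow> 'a dual1 \<Rightarrow> 'a dual2" where
  "dual1_degen1 V = (\<lambda>(\<eta>001, \<eta>011). (\<eta>011, dual0_degen0 (dual1_face0 V (\<eta>001, \<eta>011)), \<eta>001))"

text \<open>The identification of levels 0, 1 and 2 of the 2-dual with the model.\<close>

definition ident0 ::
  "'a::real_vector simp_vs \<Rightarrow> (nat \<Rightarrow> (nat list \<Rightarrow> 'a) \<Rightarrow> nat list \<Rightarrow> real) \<Rightarrow> 'a functional" where
  "ident0 V f = component 2 V f [0,0,0]"

definition ident1 ::
  "'a::real_vector simp_vs \<Rightarrow> (nat \<Rightarrow> (nat list \<Rightarrow> 'a) \<Rightarrow> nat list \<Rightarrow> real) \<Rightarrow> 'a dual1" where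
  "ident1 V f = (component 2 V f [0,0,1], component 2 V f [0,1,1])"

definition ident2 ::
  "'a::real_vector simp_vs \<Rightarrow> (nat \<Rightarrow> (nat list \<Rightarrow> 'a) \<Rightarrow> nat list \<Rightarrow> real) \<Rightarrow> 'a dual2" where
  "ident2 V f = (component 2 V f [0,1,2], (component 2 V f [1,1,2], component 2 V f [1,2,2]), component 2 V f [0,0,1])"

end

theory Submission
  imports Defs
begin

text \<open>A map of simplicial vector spaces from \<open>W\<close> to \<open>B\<^sup>n\<real>\<close> carries no more information than one
  functional on \<open>W\<^sub>n\<close>: it has to vanish on degenerate elements, because \<open>B\<^sup>n\<real>\<close> is zero below level
  \<open>n\<close>, and its alternating sum over the faces of an element of \<open>W\<^sub>n\<^sub>+\<^sub>1\<close> has to vanish, because that is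
  the defining condition of \<open>B\<^sup>n\<real>\<close>. Conversely such a cocycle extends to all levels by restricting to
  faces (\<open>cocycle_of_hom\<close>, \<open>cocycle_hom_svec_hom\<close>, \<open>hom_BnR_eqI\<close>). For \<open>W = V \<otimes> \<Delta>[m]\<close> the cocycle
  splits into its components, one functional on \<open>V\<^sub>n\<close> for each \<open>n\<close>-simplex of \<open>\<Delta>[m]\<close>. So an
  \<open>m\<close>-simplex of the \<open>n\<close>-dual is a finite family of functionals subject to linear relations
  (\<open>component_family_component\<close>, \<open>ndual_exists\<close>, \<open>ndual_eqI\<close>), and the structure maps of the \<open>n\<close>-dual
  only select and repeat components.

  That the \<open>n\<close>-dual is a groupoid has two sources. Horns can be filled in every simplicial vector
  space, by Moore's argument that corrects one face after the other with a degenerate element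
  (\<open>horn_filler\<close>). Uniqueness above level \<open>n\<close> is read off the components: a component at a simplex
  that misses a vertex other than \<open>k\<close> is a component of a face other than the \<open>k\<close>-th, and the only
  remaining one, at the \<open>k\<close>-th face of \<open>\<Delta>[n+1]\<close>, is determined by the cocycle identity at the top
  simplex because \<open>d\<^sub>k\<close> is onto (\<open>vs_groupoid_ndual\<close>).

  Now let \<open>n = 2\<close> and let \<open>V\<close> be a 2-groupoid. An element of \<open>V\<^sub>3\<close> with three vanishing faces is zero,
  hence \<open>V\<^sub>3\<close> is spanned by degenerate elements (\<open>level3_degenerate\<close>) and each cocycle identity becomes
  three identities between functionals on \<open>V\<^sub>2\<close> (\<open>face_relation_iff\<close>). On an edge these identities express
  the two vertex components through \<open>001\<close> and \<open>011\<close> and leave one constraint on that pair; on a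
  triangle they express \<open>002\<close>, \<open>022\<close>, \<open>011\<close> through \<open>012\<close>, \<open>112\<close>, \<open>122\<close>, \<open>001\<close> and leave the
  constraints that define the model (\<open>edge_iff\<close>, \<open>triangle_iff\<close>). For a point of the model, the
  components computed along different edges agree at the vertices (\<open>triangle_faces\<close>), so every point
  of the model comes from a simplex of the 2-dual.

  The formula for the multiplication is the cocycle identity at \<open>0123\<close>, evaluated at the filler of a
  horn of \<open>V\<close>, for the component family of the filler of a horn of the 2-dual.\<close>

section \<open>Linear maps on subspaces\<close>

lemma lin_onD:
  assumes "lin_on S T f" "x \<in> S"
  shows lin_on_mem: "f x \<in> T"
    and lin_on_add: "y \<in> S \<Longrightarrow> f (x + y) = f x + f y"
    and lin_on_scaleR: "f (r *\<^sub>R x) = r *\<^sub>R f x"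
  using assms by (auto simp: lin_on_def)

lemma lin_on_zero: "lin_on S T f \<Longrightarrow> subspace S \<Longrightarrow> f 0 = 0"
  using lin_on_scaleR[of S T f 0 0] by (simp add: subspace_0)

lemma lin_on_neg: "lin_on S T f \<Longrightarrow> x \<in> S \<Longrightarrow> f (- x) = - f x"
  using lin_on_scaleR[of S T f x "-1"] by simp

lemma lin_on_diff:
  "lin_on S T f \<Longrightarrow> subspace S \<Longrightarrow> x \<in> S \<Longrightarrow> y \<in> S \<Longrightarrow> f (x - y) = f x - f y"
  using lin_on_add[of S T f x "- y"] lin_on_neg[of S T f y] by (simp add: subspace_neg)

lemma lin_on_sum:
  assumes f: "lin_on S T f" and S: "subspace S" and x: "\<And>i. i \<in> I \<Longrightarrow> x i \<in> S"
  shows "f (\<Sum>i\<in>I. x i) = (\<Sum>i\<in>I. f (x i))"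
  using x
proof (induction I rule: infinite_finite_induct)
  case (insert i I)
  then have "(\<Sum>i\<in>I. x i) \<in> S" using S by (simp add: subspace_sum)
  then show ?case using insert lin_on_add[OF f] by simp
qed (simp_all add: lin_on_zero[OF f S])

lemma lin_on_id: "lin_on S S (\<lambda>x. x)"
  by (simp add: lin_on_def)

lemma lin_on_comp: "lin_on S T f \<Longrightarrow> lin_on T U g \<Longrightarrow> lin_on S U (\<lambda>x. g (f x))"
  by (simp add: lin_on_def)

lemma lin_on_UNIV: "lin_on S T f \<Longrightarrow> lin_on S UNIV f"
  by (simp add: lin_on_def)

lemma lin_on_ext0: "subspace S \<Longrightarrow> lin_on S T (ext0 S f) \<longleftrightarrow> lin_on S T f"
  unfolding lin_on_def ext0_def by (simp add: subspace_add subspace_scale cong: ball_cong)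

lemma ext0_lin_hom: "subspace S \<Longrightarrow> lin_on S T f \<Longrightarrow> ext0 S f \<in> lin_hom S T"
  by (simp add: lin_hom_def lin_on_ext0) (simp add: ext0_def)

lemma lin_hom_eqI:
  "f \<in> lin_hom S T \<Longrightarrow> g \<in> lin_hom S U \<Longrightarrow> (\<And>x. x \<in> S \<Longrightarrow> f x = g x) \<Longrightarrow> f = g"
  by (fastforce simp: lin_hom_def)

text \<open>The \<open>n\<close>-dual lives in an infinite-dimensional function space. Its levels are finite-dimensional
  because finitely many functionals separate their elements: evaluation at these functionals is
  injective, so it maps a basis to an independent set in a space with a finite spanning set.\<close>

lemma finite_span_if_separated:
  fixes S :: "'b::real_vector set" and F :: "'i \<Rightarrow> 'b \<Rightarrow> real"
  assumes S: "subspace S" and I: "finite I"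
    and F: "\<And>i. i \<in> I \<Longrightarrow> linear (F i)"
    and sep: "\<And>x. x \<in> S \<Longrightarrow> (\<And>i. i \<in> I \<Longrightarrow> F i x = 0) \<Longrightarrow> x = 0"
  shows "\<exists>B. finite B \<and> span B = S"
proof -
  obtain B where B: "B \<subseteq> S" "independent B" "S \<subseteq> span B"
    using maximal_independent_subset by blast
  have sB: "span B = S" using B S by (simp add: span_minimal subset_antisym)
  define T where "T x = (\<lambda>i. if i \<in> I then F i x else 0)" for x
  have T: "linear T"
    by (rule linearI) (auto simp: T_def fun_eq_iff scaleR_fun_def linear_add[OF F] linear_scale[OF F])
  have inj: "inj_on T (span B)"
    unfolding sB linear_injective_on_subspace_0[OF T S]
    by (auto simp: T_def fun_eq_iff intro!: sep)
  have ind: "independent (T ` B)"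
    using linear_independent_injective_image[OF T B(2) inj] .
  define E where "E = (\<lambda>i j. if j = i then 1 else 0 :: real) ` I"
  have "y \<in> span E" if "\<And>i. i \<notin> I \<Longrightarrow> y i = 0" for y :: "'i \<Rightarrow> real"
  proof -
    have sm: "(\<Sum>i\<in>A. g i) j = (\<Sum>i\<in>A. g i j)" for A and g :: "'i \<Rightarrow> 'i \<Rightarrow> real" and j
      by (induction A rule: infinite_finite_induct) auto
    have "y = (\<Sum>i\<in>I. y i *\<^sub>R (\<lambda>j. if j = i then 1 else 0))"
      using that I by (auto simp: fun_eq_iff sm scaleR_fun_def if_distrib cong: if_cong)
    also have "\<dots> \<in> span E"
      by (intro span_sum span_scale span_base) (auto simp: E_def)
    finally show ?thesis .
  qed
  then have "T ` B \<subseteq> span E" by (auto simp: T_def)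
  then have "finite (T ` B)"
    using independent_span_bound[OF _ ind, of E] I by (simp add: E_def)
  moreover have "inj_on T B" using inj by (rule inj_on_subset) (rule span_superset)
  ultimately have "finite B" by (simp add: finite_image_iff)
  with sB show ?thesis by blast
qed

section \<open>Faces and degeneracies of simplices\<close>

lemma length_sface: "i < length u \<Longrightarrow> length (sface i u) = length u - 1"
  by (simp add: sface_def)

text \<open>Faces and degeneracies of a simplex are precompositions with cofaces and codegeneracies of
  indices; this reduces the simplicial identities for simplices to the cosimplicial identities.\<close>

lemma nth_sface: "i < length u \<Longrightarrow> k < length u - 1 \<Longrightarrow> sface i u ! k = u ! coface i k"
  by (auto simp: sface_def coface_def nth_append min_def)

lemma length_sdegen: "j < length u \<Longrightarrow> length (sdegen j u) = Suc (length u)"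
  by (simp add: sdegen_def)

lemma nth_sdegen: "j < length u \<Longrightarrow> k < Suc (length u) \<Longrightarrow> sdegen j u ! k = u ! codegen j k"
proof -
  assume j: "j < length u" and k: "k < Suc (length u)"
  show ?thesis
  proof (cases "k \<le> j")
    case True
    with j show ?thesis by (simp add: sdegen_def codegen_def nth_append)
  next
    case False
    moreover from j have "min (length u) (Suc j) = Suc j" by simp
    moreover from False have "j + (k - Suc j) = k - 1" by simp
    ultimately show ?thesis using j k
      by (simp add: sdegen_def codegen_def nth_append del: add_diff_assoc add_diff_assoc2)
  qed
qed

lemma simplices_iff_nth:
  "u \<in> simplices m l \<longleftrightarrow>
     length u = Suc l \<and> (\<forall>i j. i \<le> j \<longrightarrow> j \<le> l \<longrightarrow> u ! i \<le> u ! j) \<and> (\<forall>i\<le>l. u ! i \<le> m)"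
proof -
  have "set u \<subseteq> {..m} \<longleftrightarrow> (\<forall>i<length u. u ! i \<le> m)"
    by (metis atMost_iff in_set_conv_nth subset_iff)
  moreover have "sorted u \<longleftrightarrow> (\<forall>i j. i \<le> j \<longrightarrow> j < length u \<longrightarrow> u ! i \<le> u ! j)"
    by (simp add: sorted_iff_nth_mono)
  ultimately show ?thesis
    by (auto simp: simplices_def less_Suc_eq_le)
qed

lemma finite_simplices: "finite (simplices m l)"
proof (rule finite_subset)
  show "simplices m l \<subseteq> {u. set u \<subseteq> {..m} \<and> length u = Suc l}" by (auto simp: simplices_def)
qed (simp add: finite_lists_length_eq)

lemma sface_simplices: "u \<in> simplices m (Suc l) \<Longrightarrow> i \<le> Suc l \<Longrightarrow> sface i u \<in> simplices m l"
  by (auto simp: simplices_iff_nth length_sface nth_sface) (auto simp: coface_def)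

lemma sdegen_simplices: "u \<in> simplices m l \<Longrightarrow> j \<le> l \<Longrightarrow> sdegen j u \<in> simplices m (Suc l)"
  by (auto simp: simplices_iff_nth length_sdegen nth_sdegen) (auto simp: codegen_def)

lemma sface_sface: "u \<in> simplices m (Suc (Suc l)) \<Longrightarrow> i < j \<Longrightarrow> j \<le> Suc (Suc l) \<Longrightarrow>
    sface i (sface j u) = sface (j - 1) (sface i u)"
  by (rule nth_equalityI) (auto simp: simplices_iff_nth length_sface nth_sface coface_def)

lemma sdegen_sdegen: "u \<in> simplices m l \<Longrightarrow> i \<le> j \<Longrightarrow> j \<le> l \<Longrightarrow>
    sdegen i (sdegen j u) = sdegen (Suc j) (sdegen i u)"
  by (rule nth_equalityI) (auto simp: simplices_iff_nth length_sdegen nth_sdegen codegen_def)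

lemma sface_sdegen_less: "u \<in> simplices m (Suc l) \<Longrightarrow> i < j \<Longrightarrow> j \<le> Suc l \<Longrightarrow>
    sface i (sdegen j u) = sdegen (j - 1) (sface i u)"
  by (rule nth_equalityI)
    (auto simp: simplices_iff_nth length_sface nth_sface length_sdegen nth_sdegen codegen_def coface_def)

lemma sface_sdegen_same: "u \<in> simplices m l \<Longrightarrow> j \<le> l \<Longrightarrow> i = j \<or> i = Suc j \<Longrightarrow>
    sface i (sdegen j u) = u"
  by (rule nth_equalityI)
    (auto simp: simplices_iff_nth length_sface nth_sface length_sdegen nth_sdegen codegen_def coface_def)

lemma sface_sdegen_greater: "u \<in> simplices m (Suc l) \<Longrightarrow> Suc j < i \<Longrightarrow> i \<le> Suc (Suc l) \<Longrightarrow>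
    sface i (sdegen j u) = sdegen j (sface (i - 1) u)"
  by (rule nth_equalityI)
    (auto simp: simplices_iff_nth length_sface nth_sface length_sdegen nth_sdegen codegen_def coface_def)

lemma map_sface: "map \<theta> (sface i u) = sface i (map \<theta> u)"
  by (simp add: sface_def take_map drop_map)

lemma map_sdegen: "map \<theta> (sdegen i u) = sdegen i (map \<theta> u)"
  by (simp add: sdegen_def take_map drop_map)

definition monotone_upto :: "nat \<Rightarrow> nat \<Rightarrow> (nat \<Rightarrow> nat) \<Rightarrow> bool" where
  "monotone_upto m m' \<theta> \<longleftrightarrow> (\<forall>a b. a \<le> b \<longrightarrow> b \<le> m \<longrightarrow> \<theta> a \<le> \<theta> b \<and> \<theta> b \<le> m')"

lemma map_simplices: "monotone_upto m m' \<theta> \<Longrightarrow> u \<in> simplices m l \<Longrightarrow> map \<theta> u \<in> simplices m' l"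
  unfolding simplices_iff_nth monotone_upto_def by (simp, metis order_refl)

lemma monotone_coface: "monotone_upto m (Suc m) (coface i)"
  by (auto simp: monotone_upto_def coface_def)

lemma monotone_codegen: "j \<le> m \<Longrightarrow> monotone_upto (Suc m) m (codegen j)"
  by (auto simp: monotone_upto_def codegen_def)

lemma degenerate_iff_not_distinct: "u \<in> simplices m l \<Longrightarrow> degenerate m l u \<longleftrightarrow> \<not> distinct u"
proof
  assume "degenerate m l u"
  then obtain k j v where kj: "l = Suc k" "j \<le> k" "v \<in> simplices m k" "u = sdegen j v"
    by (auto simp: degenerate_def)
  then have "u ! j = u ! Suc j" "Suc j < length u"
    by (auto simp: nth_sdegen length_sdegen simplices_iff_nth codegen_def)
  then show "\<not> distinct u" by (metis Suc_lessD n_not_Suc_n nth_eq_iff_index_eq)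
next
  assume u: "u \<in> simplices m l" and "\<not> distinct u"
  then have "\<exists>a b. a < b \<and> b \<le> l \<and> u ! a = u ! b"
    by (simp add: distinct_conv_nth simplices_iff_nth less_Suc_eq_le) (metis linorder_neqE_nat)
  then obtain a b where ab: "a < b" "b \<le> l" "u ! a = u ! b" by blast
  then obtain k where k: "l = Suc k" by (cases l) auto
  have "u ! a \<le> u ! Suc a" "u ! Suc a \<le> u ! b" using u ab(1,2) by (simp_all add: simplices_iff_nth)
  with ab have eq: "u ! Suc a = u ! a" by simp
  have len: "length u = Suc (Suc k)" using u k by (simp add: simplices_iff_nth)
  have "u = sdegen a (sface a u)"
  proof (rule nth_equalityI)
    fix i assume "i < length u"
    then have "sdegen a (sface a u) ! i = u ! coface a (codegen a i)"
      using ab k len by (simp add: length_sface nth_sface nth_sdegen codegen_def)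
    also have "\<dots> = u ! i"
      using eq by (cases "i = a") (auto simp: coface_def codegen_def)
    finally show "u ! i = sdegen a (sface a u) ! i" by simp
  qed (use ab k len in \<open>simp add: length_sface length_sdegen\<close>)
  moreover have "sface a u \<in> simplices m k" using u ab k by (simp add: sface_simplices)
  moreover have "a \<le> k" using ab k by simp
  ultimately show "degenerate m l u" unfolding degenerate_def using k by blast
qed

lemma map_codegen_coface: "map (codegen i) (map (coface i) u) = u"
  by (rule nth_equalityI) (auto simp: coface_def codegen_def)

text \<open>On a simplex that misses the vertex \<open>i\<close>, collapsing \<open>i\<close> with its successor amounts to deleting
  \<open>i\<close>. So \<^term>\<open>codegen i\<close> exhibits the simplex as a simplex of the \<open>i\<close>-th face, and deletion of
  vertices inherits its identities from the cosimplicial ones.\<close>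

lemma map_coface_codegen: "i \<notin> set u \<Longrightarrow> map (coface i) (map (codegen i) u) = u"
proof (rule nth_equalityI)
  fix k assume k: "k < length (map (coface i) (map (codegen i) u))" and "i \<notin> set u"
  then have "u ! k \<noteq> i" by (metis length_map nth_mem)
  with k show "map (coface i) (map (codegen i) u) ! k = u ! k"
    by (auto simp: coface_def codegen_def)
qed simp

lemma distinct_map_coface: "distinct (map (coface i) u) \<longleftrightarrow> distinct u"
  by (simp add: distinct_map) (auto simp: inj_on_def coface_def split: if_splits)

section \<open>Tensor products with standard simplices\<close>

definition copies :: "'u set \<Rightarrow> 'a::real_vector set \<Rightarrow> ('u \<Rightarrow> 'a) set" where
  "copies S L = {x. (\<forall>u\<in>S. x u \<in> L) \<and> (\<forall>u. u \<notin> S \<longrightarrow> x u = 0)}"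

text \<open>Faces and degeneracies of \<^term>\<open>tensor V m\<close> and the maps induced by maps of standard simplices all
  act by moving the copy at \<open>u\<close> to the copy at \<open>g u\<close> while applying \<open>h\<close>. Such maps compose by composing
  the \<open>g\<close> and the \<open>h\<close>, so each simplicial identity for the tensor product follows from the
  corresponding identity for simplices and the one in \<open>V\<close>.\<close>

definition push :: "'u set \<Rightarrow> ('u \<Rightarrow> 'w) \<Rightarrow> ('a \<Rightarrow> 'b) \<Rightarrow> ('u \<Rightarrow> 'a) \<Rightarrow> 'w \<Rightarrow> 'b::real_vector" where
  "push S g h x = (\<Sum>u\<in>S. copy (g u) (h (x u)))"

lemma sum_fun_apply: "(\<Sum>i\<in>A. f i) j = (\<Sum>i\<in>A. f i j)"
  by (induction A rule: infinite_finite_induct) auto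

lemma push_apply: "push S g h x w = (\<Sum>u\<in>S. if w = g u then h (x u) else 0)"
  by (simp add: push_def sum_fun_apply copy_def)

lemma subspace_copies: "subspace L \<Longrightarrow> subspace (copies S L)"
  by (auto simp: subspace_def copies_def scaleR_fun_def)

lemma copy_in_copies: "subspace L \<Longrightarrow> u \<in> S \<Longrightarrow> v \<in> L \<Longrightarrow> copy u v \<in> copies S L"
  by (auto simp: copies_def copy_def subspace_0)

lemma copies_expand: "finite S \<Longrightarrow> x \<in> copies S L \<Longrightarrow> x = (\<Sum>u\<in>S. copy u (x u))"
  by (rule ext) (auto simp: sum_fun_apply copy_def copies_def)

lemma push_copies:
  assumes "finite S" "\<And>u. u \<in> S \<Longrightarrow> g u \<in> S'" "\<And>v. v \<in> L \<Longrightarrow> h v \<in> L'" "subspace L'"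
    and "x \<in> copies S L"
  shows "push S g h x \<in> copies S' L'"
  using assms by (auto simp: copies_def push_apply intro!: subspace_sum sum.neutral subspace_0)

lemma push_lin_on:
  assumes "finite S" "\<And>u. u \<in> S \<Longrightarrow> g u \<in> S'" "lin_on L L' h" "subspace L'"
  shows "lin_on (copies S L) (copies S' L') (push S g h)"
proof -
  have "push S g h x \<in> copies S' L'" if "x \<in> copies S L" for x
    by (rule push_copies[OF assms(1,2) lin_on_mem[OF assms(3)] assms(4) that])
  moreover have "push S g h (x + y) = push S g h x + push S g h y"
    if "x \<in> copies S L" "y \<in> copies S L" for x y
    using that lin_on_add[OF assms(3)]
    by (auto simp: push_apply fun_eq_iff copies_def sum.distrib[symmetric] intro!: sum.cong)
  moreover have "push S g h (r *\<^sub>R x) = r *\<^sub>R push S g h x" if "x \<in> copies S L" for x r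
    using that lin_on_scaleR[OF assms(3)]
    by (auto simp: push_apply fun_eq_iff copies_def scaleR_fun_def scaleR_sum_right intro!: sum.cong)
  ultimately show ?thesis by (simp add: lin_on_def)
qed

lemma push_copy:
  "finite S \<Longrightarrow> u \<in> S \<Longrightarrow> h 0 = 0 \<Longrightarrow> push S g h (copy u v) = copy (g u) (h v)"
proof (rule ext)
  fix w assume "finite S" "u \<in> S" "h 0 = 0"
  then have "(\<Sum>u'\<in>S. if w = g u' then h (copy u v u') else 0)
      = (\<Sum>u'\<in>S. if u' = u then if w = g u then h v else 0 else 0)"
    by (intro sum.cong) (auto simp: copy_def)
  with \<open>finite S\<close> \<open>u \<in> S\<close> show "push S g h (copy u v) w = copy (g u) (h v) w"
    unfolding push_apply by (simp add: copy_def[of "g u"])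
qed

text \<open>Several copies may be moved to the same place, so additivity of \<open>F w\<close> is what allows the sum over
  the target to be taken apart.\<close>

lemma sum_push:
  assumes fin: "finite S" "finite S'" and g: "\<And>u. u \<in> S \<Longrightarrow> g u \<in> S'"
    and h: "\<And>u. u \<in> S \<Longrightarrow> h (x u) \<in> L'" and L': "subspace L'"
    and F: "\<And>w. w \<in> S' \<Longrightarrow> lin_on L' T (F w)"
  shows "(\<Sum>w\<in>S'. F w (push S g h x w)) = (\<Sum>u\<in>S. F (g u) (h (x u)))"
proof -
  have "(\<Sum>w\<in>S'. F w (push S g h x w)) = (\<Sum>w\<in>S'. \<Sum>u\<in>S. if w = g u then F w (h (x u)) else 0)"
  proof (rule sum.cong[OF refl])
    fix w assume w: "w \<in> S'"
    have "F w (push S g h x w) = (\<Sum>u\<in>S. F w (if w = g u then h (x u) else 0))"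
      unfolding push_apply
      by (rule lin_on_sum[OF F[OF w] L']) (use h L' in \<open>auto simp: subspace_0\<close>)
    also have "\<dots> = (\<Sum>u\<in>S. if w = g u then F w (h (x u)) else 0)"
      by (rule sum.cong) (auto simp: lin_on_zero[OF F[OF w] L'])
    finally show "F w (push S g h x w) = \<dots>" .
  qed
  also have "\<dots> = (\<Sum>u\<in>S. \<Sum>w\<in>S'. if w = g u then F w (h (x u)) else 0)"
    by (rule sum.swap)
  also have "\<dots> = (\<Sum>u\<in>S. F (g u) (h (x u)))"
    using fin g by (intro sum.cong) auto
  finally show ?thesis .
qed

lemma lin_on_copy: "lin_on UNIV UNIV (copy u)"
  by (auto simp: lin_on_def copy_def fun_eq_iff scaleR_fun_def)

lemma push_push:
  assumes "finite S" "finite S'" "\<And>u. u \<in> S \<Longrightarrow> g u \<in> S'" "\<And>v. v \<in> L \<Longrightarrow> h v \<in> L'"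
    and "subspace L'" "lin_on L' L'' h'" "x \<in> copies S L"
  shows "push S' g' h' (push S g h x) = push S (\<lambda>u. g' (g u)) (\<lambda>v. h' (h v)) x"
  unfolding push_def[of S' g'] push_def[of S "\<lambda>u. g' (g u)"]
proof (rule sum_push)
  show "lin_on L' UNIV (\<lambda>v. copy (g' w) (h' v))" for w
    using lin_on_comp[OF lin_on_UNIV[OF assms(6)] lin_on_copy] .
qed (use assms in \<open>auto simp: copies_def\<close>)

lemma push_cong:
  assumes "\<And>u. u \<in> S \<Longrightarrow> g u = g' u" "\<And>v. v \<in> L \<Longrightarrow> h v = h' v" "x \<in> copies S L"
  shows "push S g h x = push S g' h' x"
  using assms by (auto simp: push_def copies_def intro!: sum.cong)

lemma push_id:
  assumes "finite S" "x \<in> copies S L" "\<And>u. u \<in> S \<Longrightarrow> g u = u" "\<And>v. v \<in> L \<Longrightarrow> h v = v"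
  shows "push S g h x = x"
proof -
  have "push S g h x = (\<Sum>u\<in>S. copy u (x u))"
    using assms by (auto simp: push_def copies_def intro!: sum.cong)
  with copies_expand[OF assms(1,2)] show ?thesis by simp
qed

lemma finite_span_copies:
  assumes S: "finite S" and B: "finite B" "span B = L"
  shows "\<exists>C. finite C \<and> span C = copies S L"
proof -
  have L: "subspace L" using B by auto
  define C where "C = (\<lambda>(u, b). copy u b) ` (S \<times> B)"
  have "C \<subseteq> copies S L"
  proof
    fix c assume "c \<in> C"
    then obtain u b where "u \<in> S" "b \<in> B" "c = copy u b" by (auto simp: C_def)
    moreover from this have "b \<in> L" using B(2) span_base by blast
    ultimately show "c \<in> copies S L" by (simp add: copy_in_copies[OF L])
  qed
  then have "span C \<subseteq> copies S L" by (rule span_minimal) (rule subspace_copies[OF L])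
  moreover have "x \<in> span C" if x: "x \<in> copies S L" for x
  proof -
    have "copy u (x u) \<in> span C" if u: "u \<in> S" for u
    proof -
      have lin: "linear (copy u :: 'b \<Rightarrow> 'a \<Rightarrow> 'b)"
        by (rule linearI) (auto simp: copy_def fun_eq_iff scaleR_fun_def)
      have "copy u (x u) \<in> copy u ` span B" using x u B by (auto simp: copies_def)
      also have "\<dots> = span (copy u ` B)" by (rule linear_span_image[OF lin, symmetric])
      also have "\<dots> \<subseteq> span C" by (rule span_mono) (use u in \<open>auto simp: C_def\<close>)
      finally show ?thesis .
    qed
    then show ?thesis by (subst copies_expand[OF S x]) (rule span_sum)
  qed
  moreover have "finite C" using S B by (simp add: C_def)
  ultimately show ?thesis by blast
qed

lemma simplicial_vsD:
  assumes "simplicial_vs V"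
  shows lev_finite: "\<exists>B. finite B \<and> span B = lev V m"
    and face_lin: "i \<le> Suc m \<Longrightarrow> lin_on (lev V (Suc m)) (lev V m) (face V (Suc m) i)"
    and degen_lin: "j \<le> m \<Longrightarrow> lin_on (lev V m) (lev V (Suc m)) (degen V m j)"
    and face_face: "i < j \<Longrightarrow> j \<le> Suc (Suc m) \<Longrightarrow> x \<in> lev V (Suc (Suc m)) \<Longrightarrow>
        face V (Suc m) i (face V (Suc (Suc m)) j x)
          = face V (Suc m) (j - 1) (face V (Suc (Suc m)) i x)"
    and degen_degen: "i \<le> j \<Longrightarrow> j \<le> m \<Longrightarrow> x \<in> lev V m \<Longrightarrow>
        degen V (Suc m) i (degen V m j x) = degen V (Suc m) (Suc j) (degen V m i x)"
    and face_degen_less: "i < j \<Longrightarrow> j \<le> Suc m \<Longrightarrow> x \<in> lev V (Suc m) \<Longrightarrow>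
        face V (Suc (Suc m)) i (degen V (Suc m) j x)
          = degen V m (j - 1) (face V (Suc m) i x)"
    and face_degen_same: "j \<le> m \<Longrightarrow> x \<in> lev V m \<Longrightarrow> i = j \<or> i = Suc j \<Longrightarrow>
        face V (Suc m) i (degen V m j x) = x"
    and face_degen_greater: "Suc j < i \<Longrightarrow> i \<le> Suc (Suc m) \<Longrightarrow> x \<in> lev V (Suc m) \<Longrightarrow>
        face V (Suc (Suc m)) i (degen V (Suc m) j x)
          = degen V m j (face V (Suc m) (i - 1) x)"
proof -
  note A = assms[unfolded simplicial_vs_def]
  note B = A[THEN conjunct2, THEN conjunct2, THEN conjunct2]
  note C = B[THEN conjunct2, THEN conjunct2, THEN conjunct2]
  show "\<exists>B. finite B \<and> span B = lev V m" using A[THEN conjunct1] by blast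
  show "i \<le> Suc m \<Longrightarrow> lin_on (lev V (Suc m)) (lev V m) (face V (Suc m) i)"
    using A[THEN conjunct2, THEN conjunct1] by blast
  show "j \<le> m \<Longrightarrow> lin_on (lev V m) (lev V (Suc m)) (degen V m j)"
    using A[THEN conjunct2, THEN conjunct2, THEN conjunct1] by blast
  show "i < j \<Longrightarrow> j \<le> Suc (Suc m) \<Longrightarrow> x \<in> lev V (Suc (Suc m)) \<Longrightarrow>
      face V (Suc m) i (face V (Suc (Suc m)) j x)
        = face V (Suc m) (j - 1) (face V (Suc (Suc m)) i x)"
    using B[THEN conjunct1] by blast
  show "i \<le> j \<Longrightarrow> j \<le> m \<Longrightarrow> x \<in> lev V m \<Longrightarrow>
      degen V (Suc m) i (degen V m j x) = degen V (Suc m) (Suc j) (degen V m i x)"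
    using B[THEN conjunct2, THEN conjunct1] by blast
  show "i < j \<Longrightarrow> j \<le> Suc m \<Longrightarrow> x \<in> lev V (Suc m) \<Longrightarrow>
      face V (Suc (Suc m)) i (degen V (Suc m) j x) = degen V m (j - 1) (face V (Suc m) i x)"
    using B[THEN conjunct2, THEN conjunct2, THEN conjunct1] by blast
  show "j \<le> m \<Longrightarrow> x \<in> lev V m \<Longrightarrow> i = j \<or> i = Suc j \<Longrightarrow> face V (Suc m) i (degen V m j x) = x"
    using C[THEN conjunct1] by blast
  show "Suc j < i \<Longrightarrow> i \<le> Suc (Suc m) \<Longrightarrow> x \<in> lev V (Suc m) \<Longrightarrow>
      face V (Suc (Suc m)) i (degen V (Suc m) j x) = degen V m j (face V (Suc m) (i - 1) x)"
    using C[THEN conjunct2] by blast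
qed

lemma lev_subspace: "simplicial_vs V \<Longrightarrow> subspace (lev V m)"
  by (metis lev_finite subspace_span)

lemma face_lev: "simplicial_vs V \<Longrightarrow> i \<le> Suc m \<Longrightarrow> x \<in> lev V (Suc m) \<Longrightarrow> face V (Suc m) i x \<in> lev V m"
  using lin_on_mem[OF face_lin] .

lemma degen_lev: "simplicial_vs V \<Longrightarrow> j \<le> m \<Longrightarrow> x \<in> lev V m \<Longrightarrow> degen V m j x \<in> lev V (Suc m)"
  using lin_on_mem[OF degen_lin] .

lemma tensor_lev: "lev (tensor V m) l = copies (simplices m l) (lev V l)"
  by (simp add: tensor_def copies_def)

lemma tensor_face: "face (tensor V m) l i = push (simplices m l) (sface i) (face V l i)"
  by (simp add: tensor_def push_def fun_eq_iff)

lemma tensor_degen: "degen (tensor V m) l i = push (simplices m l) (sdegen i) (degen V l i)"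
  by (simp add: tensor_def push_def fun_eq_iff)

lemma tensor_map_push: "tensor_map \<theta> m l = push (simplices m l) (map \<theta>) (\<lambda>v. v)"
  by (simp add: tensor_map_def push_def fun_eq_iff)

lemma push_push_eq:
  assumes x: "x \<in> copies S L" and fin: "finite S" "finite S1" "finite S2"
    and g: "\<And>u. u \<in> S \<Longrightarrow> g1 u \<in> S1" "\<And>u. u \<in> S \<Longrightarrow> g2 u \<in> S2"
    and h: "lin_on L L1 h1" "lin_on L L2 h2" and L: "subspace L1" "subspace L2"
    and h': "lin_on L1 M h1'" "lin_on L2 M h2'"
    and gg: "\<And>u. u \<in> S \<Longrightarrow> g1' (g1 u) = g2' (g2 u)"
    and hh: "\<And>v. v \<in> L \<Longrightarrow> h1' (h1 v) = h2' (h2 v)"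
  shows "push S1 g1' h1' (push S g1 h1 x) = push S2 g2' h2' (push S g2 h2 x)"
proof -
  have "push S1 g1' h1' (push S g1 h1 x) = push S (\<lambda>u. g1' (g1 u)) (\<lambda>v. h1' (h1 v)) x"
    by (rule push_push[OF fin(1,2) g(1) lin_on_mem[OF h(1)] L(1) h'(1) x])
  also have "\<dots> = push S (\<lambda>u. g2' (g2 u)) (\<lambda>v. h2' (h2 v)) x"
    by (rule push_cong[OF gg hh x])
  also have "\<dots> = push S2 g2' h2' (push S g2 h2 x)"
    by (rule push_push[OF fin(1,3) g(2) lin_on_mem[OF h(2)] L(2) h'(2) x, symmetric])
  finally show ?thesis .
qed

lemma simplicial_vs_tensor:
  assumes V: "simplicial_vs V"
  shows "simplicial_vs (tensor V m)"
  unfolding simplicial_vs_def tensor_lev tensor_face tensor_degen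
proof (intro conjI allI impI ballI)
  note [simp] = finite_simplices sface_simplices sdegen_simplices lev_subspace[OF V]
    face_lin[OF V] degen_lin[OF V]
  fix l i j x
  show "\<exists>B. finite B \<and> span B = copies (simplices m l) (lev V l)"
    using lev_finite[OF V, of l] by (auto intro!: finite_span_copies finite_simplices)
  show "lin_on (copies (simplices m (Suc l)) (lev V (Suc l))) (copies (simplices m l) (lev V l))
          (push (simplices m (Suc l)) (sface i) (face V (Suc l) i))" if "i \<le> Suc l"
    by (rule push_lin_on) (use that in auto)
  show "lin_on (copies (simplices m l) (lev V l)) (copies (simplices m (Suc l)) (lev V (Suc l)))
          (push (simplices m l) (sdegen j) (degen V l j))" if "j \<le> l"
    by (rule push_lin_on) (use that in auto)
  show "push (simplices m (Suc l)) (sface i) (face V (Suc l) i)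
          (push (simplices m (Suc (Suc l))) (sface j) (face V (Suc (Suc l)) j) x)
        = push (simplices m (Suc l)) (sface (j - 1)) (face V (Suc l) (j - 1))
          (push (simplices m (Suc (Suc l))) (sface i) (face V (Suc (Suc l)) i) x)"
    if "i < j" "j \<le> Suc (Suc l)" "x \<in> copies (simplices m (Suc (Suc l))) (lev V (Suc (Suc l)))"
    by (rule push_push_eq[OF that(3)])
      (use that in \<open>auto simp del: One_nat_def intro: face_lin[OF V] face_face[OF V] sface_sface\<close>)
  show "push (simplices m (Suc l)) (sdegen i) (degen V (Suc l) i)
          (push (simplices m l) (sdegen j) (degen V l j) x)
        = push (simplices m (Suc l)) (sdegen (Suc j)) (degen V (Suc l) (Suc j))
          (push (simplices m l) (sdegen i) (degen V l i) x)"
    if "i \<le> j" "j \<le> l" "x \<in> copies (simplices m l) (lev V l)"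
    by (rule push_push_eq[OF that(3)])
      (use that in \<open>auto simp del: One_nat_def intro: degen_lin[OF V] degen_degen[OF V] sdegen_sdegen\<close>)
  show "push (simplices m (Suc (Suc l))) (sface i) (face V (Suc (Suc l)) i)
          (push (simplices m (Suc l)) (sdegen j) (degen V (Suc l) j) x)
        = push (simplices m l) (sdegen (j - 1)) (degen V l (j - 1))
          (push (simplices m (Suc l)) (sface i) (face V (Suc l) i) x)"
    if "i < j" "j \<le> Suc l" "x \<in> copies (simplices m (Suc l)) (lev V (Suc l))"
    by (rule push_push_eq[OF that(3)])
      (use that in \<open>auto simp del: One_nat_def intro: degen_lin[OF V] face_lin[OF V] face_degen_less[OF V] sface_sdegen_less\<close>)
  show "push (simplices m (Suc (Suc l))) (sface i) (face V (Suc (Suc l)) i)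
          (push (simplices m (Suc l)) (sdegen j) (degen V (Suc l) j) x)
        = push (simplices m l) (sdegen j) (degen V l j)
          (push (simplices m (Suc l)) (sface (i - 1)) (face V (Suc l) (i - 1)) x)"
    if "Suc j < i" "i \<le> Suc (Suc l)" "x \<in> copies (simplices m (Suc l)) (lev V (Suc l))"
    by (rule push_push_eq[OF that(3)])
      (use that in \<open>auto simp del: One_nat_def intro: degen_lin[OF V] face_lin[OF V] face_degen_greater[OF V] sface_sdegen_greater\<close>)
  have same: "push (simplices m (Suc l)) (sface i) (face V (Suc l) i)
          (push (simplices m l) (sdegen j) (degen V l j) x) = x"
    if "j \<le> l" "x \<in> copies (simplices m l) (lev V l)" "i = j \<or> i = Suc j" for i
  proof -
    have i: "i \<le> Suc l" using that by auto
    have "push (simplices m (Suc l)) (sface i) (face V (Suc l) i)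
          (push (simplices m l) (sdegen j) (degen V l j) x)
        = push (simplices m l) (\<lambda>u. sface i (sdegen j u)) (\<lambda>v. face V (Suc l) i (degen V l j v)) x"
      by (rule push_push[where L' = "lev V (Suc l)" and L'' = "lev V l"])
        (use that i in \<open>auto simp del: One_nat_def intro: degen_lev[OF V]\<close>)
    also have "\<dots> = x"
      by (rule push_id[OF _ that(2)])
        (use that in \<open>simp_all add: sface_sdegen_same face_degen_same[OF V]\<close>)
    finally show ?thesis .
  qed
  show "push (simplices m (Suc l)) (sface j) (face V (Suc l) j)
          (push (simplices m l) (sdegen j) (degen V l j) x) = x"
    "push (simplices m (Suc l)) (sface (Suc j)) (face V (Suc l) (Suc j))
          (push (simplices m l) (sdegen j) (degen V l j) x) = x"
    if "j \<le> l" "x \<in> copies (simplices m l) (lev V l)"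
    using same[OF that] by simp_all
qed

section \<open>Simplicial maps into \<open>B\<^sup>n\<real>\<close> as cocycles\<close>

definition vertex_list :: "nat \<Rightarrow> nat list" where
  "vertex_list n = [0..<n + 1]"

text \<open>Degenerate elements of \<open>W\<^sub>n\<close> come from level \<open>n - 1\<close>, written \<open>k\<close>; for \<open>n = 0\<close> the second condition is
  empty.\<close>

definition cocycle :: "nat \<Rightarrow> 'b::real_vector simp_vs \<Rightarrow> ('b \<Rightarrow> real) \<Rightarrow> bool" where
  "cocycle n W \<alpha> \<longleftrightarrow> lin_on (lev W n) UNIV \<alpha> \<and>
     (\<forall>k j. n = Suc k \<longrightarrow> j \<le> k \<longrightarrow> (\<forall>x\<in>lev W k. \<alpha> (degen W k j x) = 0)) \<and>
     (\<forall>x\<in>lev W (Suc n). (\<Sum>i\<le>Suc n. (-1) ^ i * \<alpha> (face W (Suc n) i x)) = 0)"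

lemma BnR_lev: "c \<in> lev (BnR n) m \<longleftrightarrow>
    (\<forall>\<sigma>. \<sigma> \<notin> simplices m n \<longrightarrow> c \<sigma> = 0) \<and>
    (\<forall>\<sigma>\<in>simplices m n. \<not> distinct \<sigma> \<longrightarrow> c \<sigma> = 0) \<and>
    (\<forall>\<sigma>\<in>simplices m (Suc n). (\<Sum>i\<le>Suc n. (-1) ^ i * c (sface i \<sigma>)) = 0)"
  by (auto simp: BnR_def degenerate_iff_not_distinct)

lemma BnR_face: "face (BnR n) m i c = ext0 (simplices (m - 1) n) (\<lambda>\<sigma>. c (map (coface i) \<sigma>))"
  by (simp add: BnR_def)

lemma BnR_degen: "degen (BnR n) m j c = ext0 (simplices (m + 1) n) (\<lambda>\<sigma>. c (map (codegen j) \<sigma>))"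
  by (simp add: BnR_def)

lemma subspace_BnR: "subspace (lev (BnR n) m)"
  unfolding subspace_def
  by (auto simp: BnR_lev scaleR_fun_def distrib_left sum.distrib mult.left_commute
      simp del: sum.atMost_Suc simp flip: sum_distrib_left)

lemma svec_homD:
  assumes "f \<in> svec_hom V W"
  shows svec_hom_lin_hom: "f l \<in> lin_hom (lev V l) (lev W l)"
    and svec_hom_lin: "lin_on (lev V l) (lev W l) (f l)"
    and svec_hom_outside: "x \<notin> lev V l \<Longrightarrow> f l x = 0"
    and svec_hom_face: "i \<le> Suc l \<Longrightarrow> x \<in> lev V (Suc l) \<Longrightarrow>
      f l (face V (Suc l) i x) = face W (Suc l) i (f (Suc l) x)"
    and svec_hom_degen: "j \<le> l \<Longrightarrow> x \<in> lev V l \<Longrightarrow>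
      f (Suc l) (degen V l j x) = degen W l j (f l x)"
  using assms by (auto simp: svec_hom_def lin_hom_def)

lemma vertex_list_simplices: "n \<le> m \<Longrightarrow> vertex_list n \<in> simplices m n"
  by (auto simp: simplices_def vertex_list_def simp del: upt_Suc)

lemma distinct_vertex_list: "distinct (vertex_list n)"
  by (simp add: vertex_list_def)

lemma vertex_list_unique: "u \<in> simplices n n \<Longrightarrow> distinct u \<Longrightarrow> u = vertex_list n"
proof -
  assume u: "u \<in> simplices n n" and d: "distinct u"
  then have "set u \<subseteq> {..n}" "card (set u) = Suc n" "sorted u"
    by (auto simp: simplices_def distinct_card)
  then have "set u = {..n}" by (simp add: card_subset_eq)
  then have "set u = set (vertex_list n)" by (auto simp: vertex_list_def)
  with d \<open>sorted u\<close> show ?thesis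
    using sorted_distinct_set_unique[of u "vertex_list n"] by (simp add: vertex_list_def del: upt_Suc)
qed

lemma sface_vertex_list: "i \<le> Suc n \<Longrightarrow> sface i (vertex_list (Suc n)) = map (coface i) (vertex_list n)"
  by (rule nth_equalityI)
    (auto simp: length_sface nth_sface vertex_list_def coface_def simp del: upt_Suc)

lemma distinct_simplices_le: "u \<in> simplices m n \<Longrightarrow> distinct u \<Longrightarrow> n \<le> m"
  using distinct_card[of u] card_mono[of "{..m}" "set u"] by (simp add: simplices_def)

text \<open>The three conditions are the linearity of \<open>f\<close> at level \<open>n\<close>, its compatibility with degeneracies
  (a simplex of dimension \<open>n\<close> in \<open>\<Delta>[n-1]\<close> repeats a vertex, so elements of \<open>B\<^sup>n\<real>\<close> vanish on it), and its
  compatibility with faces together with the sum condition in \<open>B\<^sup>n\<real>\<close> at level \<open>n + 1\<close>.\<close>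

lemma cocycle_of_hom:
  assumes f: "f \<in> svec_hom W (BnR n)" and W: "simplicial_vs W"
  shows "cocycle n W (\<lambda>w. f n w (vertex_list n))"
  unfolding cocycle_def
proof (intro conjI allI impI ballI)
  show "lin_on (lev W n) UNIV (\<lambda>w. f n w (vertex_list n))"
    using svec_hom_lin[OF f, of n] by (simp add: lin_on_def scaleR_fun_def)
  fix k j x assume k: "n = Suc k" "j \<le> k" "x \<in> lev W k"
  have "map (codegen j) (vertex_list n) \<in> simplices k n"
    using map_simplices[OF monotone_codegen[OF k(2)] vertex_list_simplices[of n "Suc k"]] k(1) by simp
  moreover from this have "\<not> distinct (map (codegen j) (vertex_list n))"
    using distinct_simplices_le k(1) by fastforce
  ultimately have "f k x (map (codegen j) (vertex_list n)) = 0"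
    using lin_on_mem[OF svec_hom_lin[OF f] k(3)] by (simp add: BnR_lev)
  then show "f n (degen W k j x) (vertex_list n) = 0"
    using k svec_hom_degen[OF f k(2,3)] vertex_list_simplices[of n n]
    by (simp add: BnR_degen ext0_def)
next
  fix x assume x: "x \<in> lev W (Suc n)"
  have "f n (face W (Suc n) i x) (vertex_list n) = f (Suc n) x (sface i (vertex_list (Suc n)))"
    if "i \<le> Suc n" for i
    using svec_hom_face[OF f that x] vertex_list_simplices[of n n] that
    by (simp add: BnR_face ext0_def sface_vertex_list)
  then have "(\<Sum>i\<le>Suc n. (-1) ^ i * f n (face W (Suc n) i x) (vertex_list n))
      = (\<Sum>i\<le>Suc n. (-1) ^ i * f (Suc n) x (sface i (vertex_list (Suc n))))"
    by (intro sum.cong) auto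
  also have "\<dots> = 0"
    using lin_on_mem[OF svec_hom_lin[OF f] x] vertex_list_simplices[of "Suc n" "Suc n"]
    by (simp add: BnR_lev del: sum.atMost_Suc)
  finally show "(\<Sum>i\<le>Suc n. (-1) ^ i * f n (face W (Suc n) i x) (vertex_list n)) = 0" .
qed

text \<open>The restriction of an element of level \<open>n + r\<close> to the face with vertices \<open>\<sigma>\<close>, obtained by deleting
  the missing vertices. Only injective simplices are needed, since elements of \<open>B\<^sup>n\<real>\<close> vanish on the
  others; this avoids the action of arbitrary monotone maps on a simplicial object. Deleting the least
  missing vertex first is a mere convention, which \<open>restrict_to_Suc\<close> removes.\<close>

primrec restrict_to :: "'b simp_vs \<Rightarrow> nat \<Rightarrow> nat \<Rightarrow> nat list \<Rightarrow> 'b \<Rightarrow> 'b" where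
  "restrict_to W n 0 \<sigma> w = w"
| "restrict_to W n (Suc r) \<sigma> w =
     (let i = LEAST i. i \<notin> set \<sigma> in restrict_to W n r (map (codegen i) \<sigma>) (face W (n + Suc r) i w))"

lemma map_codegen_simplices:
  assumes u: "u \<in> simplices (Suc m) n" and i: "i \<notin> set u" "i \<le> Suc m"
  shows "map (codegen i) u \<in> simplices m n"
proof -
  have "length u = Suc n" "sorted u" using u by (auto simp: simplices_def)
  have "codegen i a \<le> m" if "a \<in> set u" for a
  proof -
    have "a \<noteq> i" "a \<le> Suc m" using that u i by (auto simp: simplices_def)
    with i show ?thesis by (auto simp: codegen_def)
  qed
  moreover have "sorted (map (codegen i) u)"
    using \<open>sorted u\<close> by (auto simp: sorted_map codegen_def elim!: sorted_wrt_mono_rel[rotated])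
  ultimately show ?thesis
    using \<open>length u = Suc n\<close> by (auto simp: simplices_def)
qed

lemma codegen_missing:
  assumes u: "u \<in> simplices (Suc m) n" "distinct u" and i: "i \<notin> set u" "i \<le> Suc m"
  shows "map (codegen i) u \<in> simplices m n" "distinct (map (codegen i) u)"
proof -
  show "distinct (map (codegen i) u)"
    using u(2) i(1) by (metis distinct_map_coface map_coface_codegen)
qed (rule map_codegen_simplices[OF u(1) i])

lemma exists_missing:
  assumes "u \<in> simplices (n + Suc r) n"
  obtains i where "i \<notin> set u" "i \<le> n + Suc r"
proof -
  have "card (set u) \<le> Suc n" using assms card_length[of u] by (simp add: simplices_def)
  then have "\<not> {..n + Suc r} \<subseteq> set u"
    using card_mono[of "set u" "{..n + Suc r}"] by auto
  with that show ?thesis by auto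
qed

lemma LEAST_missing:
  assumes "u \<in> simplices (n + Suc r) n"
  shows "(LEAST i. i \<notin> set u) \<notin> set u" "(LEAST i. i \<notin> set u) \<le> n + Suc r"
    "i \<notin> set u \<Longrightarrow> (LEAST i. i \<notin> set u) \<le> i"
proof -
  obtain i where i: "i \<notin> set u" "i \<le> n + Suc r" using exists_missing[OF assms] .
  show "(LEAST i. i \<notin> set u) \<notin> set u" using i(1) by (rule LeastI)
  show "(LEAST i. i \<notin> set u) \<le> n + Suc r" using i Least_le[of "\<lambda>i. i \<notin> set u" i] by simp
  show "i \<notin> set u \<Longrightarrow> (LEAST i. i \<notin> set u) \<le> i" for i by (rule Least_le)
qed

text \<open>Any missing vertex may be deleted first. By induction the remaining vertices may be deleted in
  any order, and two deletions commute by the face identities.\<close>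

lemma restrict_to_Suc:
  assumes W: "simplicial_vs W"
  shows "\<sigma> \<in> simplices (n + Suc r) n \<Longrightarrow> distinct \<sigma> \<Longrightarrow> i \<notin> set \<sigma> \<Longrightarrow> i \<le> n + Suc r \<Longrightarrow>
    w \<in> lev W (n + Suc r) \<Longrightarrow>
    restrict_to W n (Suc r) \<sigma> w = restrict_to W n r (map (codegen i) \<sigma>) (face W (n + Suc r) i w)"
proof (induction r arbitrary: \<sigma> i w)
  case 0
  let ?i0 = "LEAST i. i \<notin> set \<sigma>"
  note l = LEAST_missing[OF 0(1)]
  have "i = ?i0"
  proof (rule ccontr)
    assume ne: "i \<noteq> ?i0"
    have "set \<sigma> \<subseteq> {..Suc n} - {i, ?i0}" using 0(1,3) l(1) by (auto simp: simplices_def)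
    then have "card (set \<sigma>) \<le> card ({..Suc n} - {i, ?i0})" by (rule card_mono[rotated]) simp
    also have "\<dots> = n" using ne 0(4) l(2) by (subst card_Diff_subset) auto
    finally show False using distinct_card[OF 0(2)] 0(1) by (simp add: simplices_def)
  qed
  then show ?case by simp
next
  case (Suc r)
  let ?i0 = "LEAST i. i \<notin> set \<sigma>"
  note l = LEAST_missing[OF Suc.prems(1)]
  have i0: "restrict_to W n (Suc (Suc r)) \<sigma> w
      = restrict_to W n (Suc r) (map (codegen ?i0) \<sigma>) (face W (n + Suc (Suc r)) ?i0 w)"
    by (simp add: Let_def)
  show ?case
  proof (cases "i = ?i0")
    case True
    with i0 show ?thesis by simp
  next
    case False
    then have less: "?i0 < i" using l(3)[OF Suc.prems(3)] by simp
    obtain i' where i': "i = Suc i'" "?i0 \<le> i'" using less by (cases i) auto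
    define \<tau> \<tau>' where "\<tau> = map (codegen ?i0) \<sigma>" and "\<tau>' = map (codegen i) \<sigma>"
    have sig: "\<sigma> \<in> simplices (Suc (n + Suc r)) n" using Suc.prems(1) by simp
    have w: "w \<in> lev W (Suc (Suc (n + r)))" using Suc.prems(5) by simp
    have \<tau>: "\<tau> \<in> simplices (n + Suc r) n" "distinct \<tau>"
      unfolding \<tau>_def by (rule codegen_missing[OF sig Suc.prems(2) l(1)], use l(2) in simp)+
    have \<tau>': "\<tau>' \<in> simplices (n + Suc r) n" "distinct \<tau>'"
      unfolding \<tau>'_def by (rule codegen_missing[OF sig Suc.prems(2,3)], use Suc.prems(4) in simp)+
    have m: "i' \<notin> set \<tau>" "?i0 \<notin> set \<tau>'"
      using l(1) Suc.prems(3) less i' unfolding \<tau>_def \<tau>'_def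
      by (auto simp: codegen_def split: if_splits)
    have "restrict_to W n (Suc (Suc r)) \<sigma> w
        = restrict_to W n (Suc r) \<tau> (face W (n + Suc (Suc r)) ?i0 w)"
      using i0 by (simp only: \<tau>_def)
    also have "\<dots> = restrict_to W n r (map (codegen i') \<tau>)
        (face W (n + Suc r) i' (face W (n + Suc (Suc r)) ?i0 w))"
      by (rule Suc.IH[OF \<tau> m(1)]) (use Suc.prems(4,5) i' l(2) in \<open>auto intro!: face_lev[OF W]\<close>)
    also have "map (codegen i') \<tau> = map (codegen ?i0) \<tau>'"
      using i' by (auto simp: \<tau>_def \<tau>'_def codegen_def)
    also have "face W (n + Suc r) i' (face W (n + Suc (Suc r)) ?i0 w)
        = face W (n + Suc r) ?i0 (face W (n + Suc (Suc r)) i w)"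
      using face_face[OF W less _ w] Suc.prems(4) i' by simp
    also have "restrict_to W n r (map (codegen ?i0) \<tau>')
          (face W (n + Suc r) ?i0 (face W (n + Suc (Suc r)) i w))
        = restrict_to W n (Suc r) \<tau>' (face W (n + Suc (Suc r)) i w)"
      by (rule Suc.IH[OF \<tau>' m(2), symmetric])
        (use Suc.prems(4,5) less in \<open>auto intro!: face_lev[OF W]\<close>)
    finally show ?thesis by (simp only: \<tau>'_def)
  qed
qed

lemma restrict_to_lin:
  assumes W: "simplicial_vs W"
  shows "\<sigma> \<in> simplices (n + r) n \<Longrightarrow> distinct \<sigma> \<Longrightarrow> lin_on (lev W (n + r)) (lev W n) (restrict_to W n r \<sigma>)"
proof (induction r arbitrary: \<sigma>)
  case 0
  have "restrict_to W n 0 \<sigma> = (\<lambda>x. x)" by (simp add: fun_eq_iff)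
  then show ?case by (simp add: lin_on_id)
next
  case (Suc r)
  let ?i = "LEAST i. i \<notin> set \<sigma>"
  note l = LEAST_missing[OF Suc.prems(1)]
  have "lin_on (lev W (n + r)) (lev W n) (restrict_to W n r (map (codegen ?i) \<sigma>))"
    using codegen_missing[of \<sigma> "n + r" n ?i] Suc.prems l by (intro Suc.IH) auto
  moreover have "lin_on (lev W (n + Suc r)) (lev W (n + r)) (face W (n + Suc r) ?i)"
    using face_lin[OF W, of ?i "n + r"] l(2) by simp
  ultimately have "lin_on (lev W (n + Suc r)) (lev W n)
      (\<lambda>w. restrict_to W n r (map (codegen ?i) \<sigma>) (face W (n + Suc r) ?i w))"
    by (rule lin_on_comp[rotated])
  moreover have "restrict_to W n (Suc r) \<sigma>
      = (\<lambda>w. restrict_to W n r (map (codegen ?i) \<sigma>) (face W (n + Suc r) ?i w))"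
    by (simp add: fun_eq_iff Let_def)
  ultimately show ?case by simp
qed

lemma restrict_to_sface:
  assumes W: "simplicial_vs W"
  shows "\<sigma> \<in> simplices (Suc n + r) (Suc n) \<Longrightarrow> distinct \<sigma> \<Longrightarrow> i \<le> Suc n \<Longrightarrow>
    w \<in> lev W (Suc n + r) \<Longrightarrow>
    restrict_to W n (Suc r) (sface i \<sigma>) w = face W (Suc n) i (restrict_to W (Suc n) r \<sigma> w)"
proof (induction r arbitrary: \<sigma> w)
  case 0
  then have \<sigma>: "\<sigma> = vertex_list (Suc n)" using vertex_list_unique[of \<sigma> "Suc n"] by simp
  have s: "sface i \<sigma> = map (coface i) (vertex_list n)" using 0 by (simp add: \<sigma> sface_vertex_list)
  have "sface i \<sigma> \<in> simplices (n + Suc 0) n" using 0 by (simp add: sface_simplices)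
  moreover have "distinct (sface i \<sigma>)" by (simp only: s distinct_map_coface distinct_vertex_list)
  moreover have "i \<notin> set (sface i \<sigma>)" by (auto simp: s coface_def)
  ultimately have "restrict_to W n (Suc 0) (sface i \<sigma>) w
      = restrict_to W n 0 (map (codegen i) (sface i \<sigma>)) (face W (n + Suc 0) i w)"
    by (rule restrict_to_Suc[OF W]) (use 0 in auto)
  then show ?case by simp
next
  case (Suc r)
  obtain p where p: "p \<notin> set \<sigma>" "p \<le> Suc n + Suc r" using exists_missing[OF Suc.prems(1)] .
  have sub: "set (sface i \<sigma>) \<subseteq> set \<sigma>"
    by (auto simp: sface_def dest: in_set_takeD in_set_dropD)
  have ds: "distinct (sface i \<sigma>)"
    using Suc.prems(2) by (simp add: sface_def set_take_disj_set_drop_if_distinct)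
  have sig: "\<sigma> \<in> simplices (Suc (Suc n + r)) (Suc n)" using Suc.prems(1) by simp
  have c: "map (codegen p) \<sigma> \<in> simplices (Suc n + r) (Suc n)" "distinct (map (codegen p) \<sigma>)"
    by (rule codegen_missing[OF sig Suc.prems(2) p(1)], use p in simp)+
  have fw: "face W (Suc n + Suc r) p w \<in> lev W (Suc n + r)"
    using Suc.prems(4) p by (auto intro!: face_lev[OF W])
  have "restrict_to W n (Suc (Suc r)) (sface i \<sigma>) w
      = restrict_to W n (Suc r) (map (codegen p) (sface i \<sigma>)) (face W (n + Suc (Suc r)) p w)"
    by (rule restrict_to_Suc[OF W]) (use Suc.prems p sub ds in \<open>auto intro!: sface_simplices\<close>)
  also have "\<dots> = restrict_to W n (Suc r) (sface i (map (codegen p) \<sigma>)) (face W (Suc n + Suc r) p w)"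
    by (simp add: map_sface)
  also have "\<dots> = face W (Suc n) i
      (restrict_to W (Suc n) r (map (codegen p) \<sigma>) (face W (Suc n + Suc r) p w))"
    by (rule Suc.IH[OF c Suc.prems(3) fw])
  also have "restrict_to W (Suc n) r (map (codegen p) \<sigma>) (face W (Suc n + Suc r) p w)
      = restrict_to W (Suc n) (Suc r) \<sigma> w"
    by (rule restrict_to_Suc[OF W Suc.prems(1,2) p Suc.prems(4), symmetric])
  finally show ?case .
qed

text \<open>If \<open>\<sigma>\<close> contains both vertices identified by the \<open>j\<close>-th degeneracy, deleting the other vertices
  commutes with the degeneracy and leaves a degenerate element of level \<open>n\<close>.\<close>

lemma restrict_to_degen:
  assumes W: "simplicial_vs W" and \<alpha>: "cocycle n W \<alpha>"
  shows "\<sigma> \<in> simplices (n + r) n \<Longrightarrow> distinct \<sigma> \<Longrightarrow> j \<in> set \<sigma> \<Longrightarrow> Suc j \<in> set \<sigma> \<Longrightarrow>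
    n + r = Suc l \<Longrightarrow> x \<in> lev W l \<Longrightarrow> \<alpha> (restrict_to W n r \<sigma> (degen W l j x)) = 0"
proof (induction r arbitrary: \<sigma> j l x)
  case 0
  then have "j \<le> l" by (auto simp: simplices_def)
  with 0 \<alpha> show ?case by (auto simp: cocycle_def)
next
  case (Suc r)
  obtain i where i: "i \<notin> set \<sigma>" "i \<le> n + Suc r" using exists_missing[OF Suc.prems(1)] .
  have ij: "i \<noteq> j" "i \<noteq> Suc j" "Suc j \<le> n + Suc r" using Suc.prems i by (auto simp: simplices_def)
  obtain l' where l': "l = Suc l'" using ij i Suc.prems(5) by (cases l) auto
  have l2: "n + Suc r = Suc (Suc l')" "n + r = Suc l'" using Suc.prems(5) l' by auto
  have x: "x \<in> lev W (Suc l')" using Suc.prems(6) l' by simp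
  have sig: "\<sigma> \<in> simplices (Suc (n + r)) n" using Suc.prems(1) by simp
  have c: "map (codegen i) \<sigma> \<in> simplices (n + r) n" "distinct (map (codegen i) \<sigma>)"
    by (rule codegen_missing[OF sig Suc.prems(2) i(1)], use i in simp)+
  have step: "restrict_to W n (Suc r) \<sigma> (degen W l j x)
      = restrict_to W n r (map (codegen i) \<sigma>) (face W (Suc (Suc l')) i (degen W (Suc l') j x))"
    using restrict_to_Suc[OF W Suc.prems(1,2) i, of "degen W l j x"]
      degen_lev[OF W, of j l x] Suc.prems(6) ij l' l2 by (simp del: restrict_to.simps)
  show ?case
  proof (cases "i < j")
    case True
    have "face W (Suc (Suc l')) i (degen W (Suc l') j x) = degen W l' (j - 1) (face W (Suc l') i x)"
      using face_degen_less[OF W True _ x] ij l2 by simp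
    moreover have "j - 1 \<in> set (map (codegen i) \<sigma>)" "Suc (j - 1) \<in> set (map (codegen i) \<sigma>)"
      using Suc.prems(3,4) True by (force simp: codegen_def)+
    ultimately show ?thesis using step Suc.IH[OF c _ _ l2(2)] face_lev[OF W _ x, of i] True ij l2 by simp
  next
    case False
    with ij have less: "Suc j < i" by simp
    have "face W (Suc (Suc l')) i (degen W (Suc l') j x) = degen W l' j (face W (Suc l') (i - 1) x)"
      using face_degen_greater[OF W less _ x] i l2 by simp
    moreover have "j \<in> set (map (codegen i) \<sigma>)" "Suc j \<in> set (map (codegen i) \<sigma>)"
      using Suc.prems(3,4) less by (force simp: codegen_def)+
    ultimately show ?thesis using step Suc.IH[OF c _ _ l2(2)] face_lev[OF W _ x, of "i - 1"] i l2 by simp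
  qed
qed

text \<open>Compatibility with faces moves the evaluation at \<open>\<sigma>\<close> down to the only nondegenerate simplex
  of level \<open>n\<close>.\<close>

lemma hom_determined:
  assumes W: "simplicial_vs W" and f: "f \<in> svec_hom W (BnR n)"
  shows "w \<in> lev W (n + r) \<Longrightarrow> \<sigma> \<in> simplices (n + r) n \<Longrightarrow> distinct \<sigma> \<Longrightarrow>
    f (n + r) w \<sigma> = f n (restrict_to W n r \<sigma> w) (vertex_list n)"
proof (induction r arbitrary: w \<sigma>)
  case 0
  then show ?case using vertex_list_unique[of \<sigma> n] by simp
next
  case (Suc r)
  obtain i where i: "i \<notin> set \<sigma>" "i \<le> n + Suc r" using exists_missing[OF Suc.prems(2)] .
  have sig: "\<sigma> \<in> simplices (Suc (n + r)) n" using Suc.prems(2) by simp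
  have c: "map (codegen i) \<sigma> \<in> simplices (n + r) n" "distinct (map (codegen i) \<sigma>)"
    by (rule codegen_missing[OF sig Suc.prems(3) i(1)], use i in simp)+
  have w: "w \<in> lev W (Suc (n + r))" "i \<le> Suc (n + r)" using Suc.prems(1) i by auto
  have "f (n + Suc r) w \<sigma> = f (Suc (n + r)) w (map (coface i) (map (codegen i) \<sigma>))"
    using i by (subst map_coface_codegen) simp_all
  also have "\<dots> = f (n + r) (face W (Suc (n + r)) i w) (map (codegen i) \<sigma>)"
    using svec_hom_face[OF f w(2,1)] c(1) by (simp add: BnR_face ext0_def)
  also have "\<dots> = f n (restrict_to W n r (map (codegen i) \<sigma>) (face W (Suc (n + r)) i w)) (vertex_list n)"
    by (rule Suc.IH[OF face_lev[OF W w(2,1)] c])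
  also have "\<dots> = f n (restrict_to W n (Suc r) \<sigma> w) (vertex_list n)"
    using restrict_to_Suc[OF W Suc.prems(2,3) i Suc.prems(1)] by simp
  finally show ?case .
qed

lemma hom_BnR_eqI:
  assumes W: "simplicial_vs W" and f: "f \<in> svec_hom W (BnR n)" and g: "g \<in> svec_hom W (BnR n)"
    and eq: "\<And>w. w \<in> lev W n \<Longrightarrow> f n w (vertex_list n) = g n w (vertex_list n)"
  shows "f = g"
proof (rule ext, rule lin_hom_eqI[OF svec_hom_lin_hom[OF f] svec_hom_lin_hom[OF g]], rule ext)
  fix l w \<sigma> assume w: "w \<in> lev W l"
  have fw: "f l w \<in> lev (BnR n) l" "g l w \<in> lev (BnR n) l"
    using w svec_hom_lin[OF f] svec_hom_lin[OF g] by (auto dest: lin_on_mem)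
  show "f l w \<sigma> = g l w \<sigma>"
  proof (cases "\<sigma> \<in> simplices l n \<and> distinct \<sigma>")
    case True
    then obtain r where r: "l = n + r" using distinct_simplices_le le_Suc_ex by metis
    have "restrict_to W n r \<sigma> w \<in> lev W n"
      using lin_on_mem[OF restrict_to_lin[OF W]] True w r by blast
    then show ?thesis using eq True w r hom_determined[OF W f] hom_determined[OF W g] by simp
  next
    case False
    with fw have "f l w \<sigma> = 0" "g l w \<sigma> = 0" unfolding BnR_lev by blast+
    then show ?thesis by simp
  qed
qed

text \<open>The extension of a cocycle to all levels, as dictated by \<open>hom_determined\<close>.\<close>

definition cocycle_hom :: "nat \<Rightarrow> 'b::real_vector simp_vs \<Rightarrow> ('b \<Rightarrow> real) \<Rightarrow> nat \<Rightarrow> 'b \<Rightarrow> nat list \<Rightarrow> real" where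
  "cocycle_hom n W \<alpha> l w \<sigma> = (if w \<in> lev W l \<and> \<sigma> \<in> simplices l n \<and> distinct \<sigma>
     then \<alpha> (restrict_to W n (l - n) \<sigma> w) else 0)"

lemma cocycle_hom_nondegenerate:
  "w \<in> lev W (n + r) \<Longrightarrow> \<sigma> \<in> simplices (n + r) n \<Longrightarrow> distinct \<sigma> \<Longrightarrow>
    cocycle_hom n W \<alpha> (n + r) w \<sigma> = \<alpha> (restrict_to W n r \<sigma> w)"
  by (simp add: cocycle_hom_def)

lemma sface_equal_neighbours:
  assumes "length \<sigma> = Suc (Suc n)" "j \<le> n" "\<sigma> ! j = \<sigma> ! Suc j"
  shows "sface j \<sigma> = sface (Suc j) \<sigma>"
proof (rule nth_equalityI)
  fix k assume "k < length (sface j \<sigma>)"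
  with assms show "sface j \<sigma> ! k = sface (Suc j) \<sigma> ! k"
    by (cases "k = j") (auto simp: length_sface nth_sface coface_def)
qed (use assms in \<open>simp add: length_sface\<close>)

text \<open>On a nondegenerate simplex the sum condition is the cocycle identity for a restriction of \<open>w\<close>. If
  \<open>\<sigma>\<close> repeats a vertex, two neighbouring faces agree and cancel, and all others are degenerate.\<close>

lemma cocycle_hom_lev:
  assumes W: "simplicial_vs W" and \<alpha>: "cocycle n W \<alpha>" and w: "w \<in> lev W l"
  shows "cocycle_hom n W \<alpha> l w \<in> lev (BnR n) l"
  unfolding BnR_lev
proof (intro conjI allI impI ballI)
  fix \<sigma> assume \<sigma>: "\<sigma> \<in> simplices l (Suc n)"
  let ?c = "cocycle_hom n W \<alpha> l w"
  show "(\<Sum>i\<le>Suc n. (-1) ^ i * ?c (sface i \<sigma>)) = 0"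
  proof (cases "distinct \<sigma>")
    case True
    obtain r where r: "l = Suc n + r" using distinct_simplices_le[OF \<sigma> True] le_Suc_ex by blast
    let ?x = "restrict_to W (Suc n) r \<sigma> w"
    have x: "?x \<in> lev W (Suc n)"
      using lin_on_mem[OF restrict_to_lin[OF W]] \<sigma> True w r by blast
    have "?c (sface i \<sigma>) = \<alpha> (face W (Suc n) i ?x)" if "i \<le> Suc n" for i
    proof -
      have "distinct (sface i \<sigma>)"
        using True by (simp add: sface_def set_take_disj_set_drop_if_distinct)
      moreover have "sface i \<sigma> \<in> simplices l n" using \<sigma> that by (rule sface_simplices)
      ultimately have "?c (sface i \<sigma>) = \<alpha> (restrict_to W n (Suc r) (sface i \<sigma>) w)"
        using w r by (simp add: cocycle_hom_def del: restrict_to.simps)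
      then show ?thesis using restrict_to_sface[OF W _ True that] \<sigma> w r by simp
    qed
    then have "(\<Sum>i\<le>Suc n. (-1) ^ i * ?c (sface i \<sigma>))
        = (\<Sum>i\<le>Suc n. (-1) ^ i * \<alpha> (face W (Suc n) i ?x))"
      by (intro sum.cong) auto
    with \<alpha> x show ?thesis by (simp add: cocycle_def)
  next
    case False
    have len: "length \<sigma> = Suc (Suc n)" using \<sigma> by (simp add: simplices_def)
    obtain k j v where kj: "Suc n = Suc k" "j \<le> k" "v \<in> simplices l k" "\<sigma> = sdegen j v"
      using False degenerate_iff_not_distinct[OF \<sigma>] by (auto simp: degenerate_def)
    have j: "j \<le> n" "\<sigma> ! j = \<sigma> ! Suc j"
      using kj by (auto simp: simplices_iff_nth nth_sdegen codegen_def)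
    have "?c (sface i \<sigma>) = 0" if i: "i \<le> Suc n" "i \<noteq> j" "i \<noteq> Suc j" for i
    proof -
      have "\<exists>a b. a < b \<and> b \<le> n \<and> sface i \<sigma> ! a = sface i \<sigma> ! b"
      proof (cases "i < j")
        case True
        then show ?thesis using j len
          by (intro exI[of _ "j - 1"] exI[of _ j]) (auto simp: nth_sface coface_def)
      next
        case False
        then show ?thesis using j len i
          by (intro exI[of _ j] exI[of _ "Suc j"]) (auto simp: nth_sface coface_def)
      qed
      then obtain a b where "a < b" "b \<le> n" "sface i \<sigma> ! a = sface i \<sigma> ! b" by blast
      moreover have "length (sface i \<sigma>) = Suc n" using len i(1) by (simp add: length_sface)
      ultimately have "\<not> distinct (sface i \<sigma>)"
        by (metis le_imp_less_Suc less_imp_neq less_trans nth_eq_iff_index_eq)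
      then show ?thesis by (simp add: cocycle_hom_def)
    qed
    then have "(\<Sum>i\<le>Suc n. (-1) ^ i * ?c (sface i \<sigma>)) = (\<Sum>i\<in>{j, Suc j}. (-1) ^ i * ?c (sface i \<sigma>))"
      using j by (intro sum.mono_neutral_right) auto
    also have "\<dots> = 0" using sface_equal_neighbours[OF len j] by simp
    finally show ?thesis .
  qed
qed (auto simp: cocycle_hom_def)

lemma cocycle_hom_lin:
  assumes W: "simplicial_vs W" and \<alpha>: "cocycle n W \<alpha>"
  shows "lin_on (lev W l) (lev (BnR n) l) (cocycle_hom n W \<alpha> l)"
proof -
  have lin: "lin_on (lev W l) UNIV (\<lambda>w. \<alpha> (restrict_to W n (l - n) \<sigma> w))"
    if \<sigma>: "\<sigma> \<in> simplices l n" "distinct \<sigma>" for \<sigma>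
  proof -
    obtain r where r: "l = n + r" using distinct_simplices_le[OF \<sigma>] le_Suc_ex by blast
    have "lin_on (lev W l) (lev W n) (restrict_to W n (l - n) \<sigma>)"
      using restrict_to_lin[OF W, of \<sigma> n r] \<sigma> r by simp
    moreover have "lin_on (lev W n) UNIV \<alpha>" using \<alpha> by (simp add: cocycle_def)
    ultimately show ?thesis by (rule lin_on_comp)
  qed
  have sub: "subspace (lev W l)" using W by (rule lev_subspace)
  show ?thesis
    using cocycle_hom_lev[OF W \<alpha>] lin sub
    unfolding lin_on_def
    by (auto simp: fun_eq_iff cocycle_hom_def scaleR_fun_def subspace_add subspace_scale)
qed

text \<open>Compatibility with the degeneracy \<open>s\<^sub>j\<close> splits in two: if \<open>\<sigma>\<close> contains both \<open>j\<close> and \<open>j + 1\<close>, both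
  sides vanish; otherwise one of these vertices may be deleted first, and the corresponding face undoes
  the degeneracy.\<close>

lemma cocycle_hom_svec_hom:
  assumes W: "simplicial_vs W" and \<alpha>: "cocycle n W \<alpha>"
  shows "cocycle_hom n W \<alpha> \<in> svec_hom W (BnR n)"
  unfolding svec_hom_def
proof (intro CollectI conjI allI impI ballI)
  let ?f = "cocycle_hom n W \<alpha>"
  fix l
  show "?f l \<in> lin_hom (lev W l) (lev (BnR n) l)"
    using cocycle_hom_lin[OF W \<alpha>] by (auto simp: lin_hom_def cocycle_hom_def fun_eq_iff)
  show "?f l (face W (Suc l) i x) = face (BnR n) (Suc l) i (?f (Suc l) x)"
    if i: "i \<le> Suc l" and x: "x \<in> lev W (Suc l)" for i x
  proof
    fix \<sigma>
    let ?\<sigma> = "map (coface i) \<sigma>"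
    show "?f l (face W (Suc l) i x) \<sigma> = face (BnR n) (Suc l) i (?f (Suc l) x) \<sigma>"
    proof (cases "\<sigma> \<in> simplices l n \<and> distinct \<sigma>")
      case True
      then obtain r where r: "l = n + r" using distinct_simplices_le le_Suc_ex by metis
      have s: "?\<sigma> \<in> simplices (n + Suc r) n" "distinct ?\<sigma>" "i \<notin> set ?\<sigma>"
        using True r map_simplices[OF monotone_coface[of l i]]
        by (auto simp: distinct_map_coface simp del: distinct_map) (auto simp: coface_def split: if_splits)
      have "restrict_to W n (Suc r) ?\<sigma> x = restrict_to W n r \<sigma> (face W (n + Suc r) i x)"
        using restrict_to_Suc[OF W s, of x] i x r
        by (simp only: map_codegen_coface add_Suc_right)
      moreover have "?f (n + Suc r) x ?\<sigma> = \<alpha> (restrict_to W n (Suc r) ?\<sigma> x)"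
        by (rule cocycle_hom_nondegenerate[OF _ s(1,2)]) (use x r in simp)
      moreover have "?f (n + r) (face W (n + Suc r) i x) \<sigma>
          = \<alpha> (restrict_to W n r \<sigma> (face W (n + Suc r) i x))"
        by (rule cocycle_hom_nondegenerate) (use True r face_lev[OF W i x] in auto)
      ultimately have "?f (n + Suc r) x ?\<sigma> = ?f (n + r) (face W (n + Suc r) i x) \<sigma>"
        by simp
      then show ?thesis using True r by (simp add: BnR_face ext0_def)
    next
      case False
      then show ?thesis
        by (auto simp: BnR_face ext0_def cocycle_hom_def distinct_map_coface simp del: distinct_map)
    qed
  qed
  show "?f (Suc l) (degen W l j x) = degen (BnR n) l j (?f l x)"
    if j: "j \<le> l" and x: "x \<in> lev W l" for j x
  proof
    fix \<sigma>
    let ?\<sigma> = "map (codegen j) \<sigma>"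
    note dx = degen_lev[OF W j x]
    show "?f (Suc l) (degen W l j x) \<sigma> = degen (BnR n) l j (?f l x) \<sigma>"
    proof (cases "\<sigma> \<in> simplices (Suc l) n \<and> distinct \<sigma>")
      case True
      then obtain r where r: "Suc l = n + r" using distinct_simplices_le le_Suc_ex by metis
      have m: "?\<sigma> \<in> simplices l n" by (rule map_simplices[OF monotone_codegen[OF j]]) (use True in simp)
      show ?thesis
      proof (cases "j \<in> set \<sigma> \<and> Suc j \<in> set \<sigma>")
        case both: True
        have "\<alpha> (restrict_to W n r \<sigma> (degen W l j x)) = 0"
          by (rule restrict_to_degen[OF W \<alpha> _ _ _ _ r[symmetric] x]) (use True both r in auto)
        then have "?f (Suc l) (degen W l j x) \<sigma> = 0"
          unfolding cocycle_hom_def r by simp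
        moreover have "\<not> distinct ?\<sigma>"
        proof
          assume "distinct ?\<sigma>"
          then have "inj_on (codegen j) (set \<sigma>)" by (simp add: distinct_map)
          from inj_onD[OF this, of j "Suc j"] both show False by (simp add: codegen_def)
        qed
        ultimately show ?thesis using True m by (simp add: BnR_degen ext0_def cocycle_hom_def)
      next
        case False
        then obtain i where i: "i = j \<or> i = Suc j" "i \<notin> set \<sigma>" by auto
        then have eq: "map (codegen i) \<sigma> = ?\<sigma>" by (auto simp: codegen_def le_Suc_eq)
        have c: "distinct ?\<sigma>"
          unfolding eq[symmetric] by (rule codegen_missing(2)[of \<sigma> l n i]) (use True i j in auto)
        obtain r' where r': "r = Suc r'" "l = n + r'"
          using distinct_simplices_le[OF m c] r by (cases r) simp_all
        have "restrict_to W n r \<sigma> (degen W l j x)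
            = restrict_to W n r' ?\<sigma> (face W (Suc l) i (degen W l j x))"
          using restrict_to_Suc[OF W, of \<sigma> n r' i "degen W l j x"] True i j dx eq
          unfolding r' by auto
        also have "face W (Suc l) i (degen W l j x) = x"
          using face_degen_same[OF W j x] i by auto
        finally have "\<alpha> (restrict_to W n (Suc l - n) \<sigma> (degen W l j x)) = \<alpha> (restrict_to W n (l - n) ?\<sigma> x)"
          using r r' by simp
        then have "?f (Suc l) (degen W l j x) \<sigma> = ?f l x ?\<sigma>"
          using True m c x dx unfolding cocycle_hom_def by simp
        then show ?thesis using True by (simp add: BnR_degen ext0_def)
      qed
    next
      case False
      then show ?thesis
        by (auto simp: BnR_degen ext0_def cocycle_hom_def distinct_map)
    qed
  qed
qed

lemma cocycle_hom_value: "w \<in> lev W n \<Longrightarrow> cocycle_hom n W \<alpha> n w (vertex_list n) = \<alpha> w"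
  using cocycle_hom_nondegenerate[of w W n 0 "vertex_list n"]
  by (simp add: vertex_list_simplices distinct_vertex_list)

section \<open>The n-dual and its components\<close>

lemma tensor_map_lin:
  assumes V: "simplicial_vs V" and \<theta>: "monotone_upto m m' \<theta>"
  shows "lin_on (lev (tensor V m) l) (lev (tensor V m') l) (tensor_map \<theta> m l)"
  unfolding tensor_lev tensor_map_push
  by (rule push_lin_on[OF finite_simplices map_simplices[OF \<theta>] lin_on_id lev_subspace[OF V]])

lemma tensor_map_lev:
  "simplicial_vs V \<Longrightarrow> monotone_upto m m' \<theta> \<Longrightarrow> x \<in> lev (tensor V m) l \<Longrightarrow>
    tensor_map \<theta> m l x \<in> lev (tensor V m') l"
  using lin_on_mem[OF tensor_map_lin] .

lemma tensor_map_face: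
  assumes V: "simplicial_vs V" and \<theta>: "monotone_upto m m' \<theta>" and i: "i \<le> Suc l"
    and x: "x \<in> lev (tensor V m) (Suc l)"
  shows "tensor_map \<theta> m l (face (tensor V m) (Suc l) i x)
      = face (tensor V m') (Suc l) i (tensor_map \<theta> m (Suc l) x)"
  unfolding tensor_map_push tensor_face
  by (rule push_push_eq[OF x[unfolded tensor_lev] finite_simplices finite_simplices finite_simplices
        _ _ face_lin[OF V i] lin_on_id lev_subspace[OF V] lev_subspace[OF V] lin_on_id face_lin[OF V i]])
    (use \<theta> i in \<open>auto intro: sface_simplices map_simplices simp: map_sface\<close>)

lemma tensor_map_degen:
  assumes V: "simplicial_vs V" and \<theta>: "monotone_upto m m' \<theta>" and i: "i \<le> l"
    and x: "x \<in> lev (tensor V m) l"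
  shows "tensor_map \<theta> m (Suc l) (degen (tensor V m) l i x)
      = degen (tensor V m') l i (tensor_map \<theta> m l x)"
  unfolding tensor_map_push tensor_degen
  by (rule push_push_eq[OF x[unfolded tensor_lev] finite_simplices finite_simplices finite_simplices
        _ _ degen_lin[OF V i] lin_on_id lev_subspace[OF V] lev_subspace[OF V] lin_on_id degen_lin[OF V i]])
    (use \<theta> i in \<open>auto intro: sdegen_simplices map_simplices simp: map_sdegen\<close>)

lemma tensor_map_comp:
  assumes V: "simplicial_vs V" and \<theta>: "monotone_upto m m' \<theta>" and x: "x \<in> lev (tensor V m) l"
  shows "tensor_map \<theta>' m' l (tensor_map \<theta> m l x) = tensor_map (\<theta>' \<circ> \<theta>) m l x"
  unfolding tensor_map_push
  using push_push[OF finite_simplices finite_simplices map_simplices[OF \<theta>] _ lev_subspace[OF V]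
      lin_on_id x[unfolded tensor_lev], where h = "\<lambda>v. v" and g' = "map \<theta>'"]
  by simp

lemma map_simplex_cong: "(\<And>a. a \<le> m \<Longrightarrow> \<theta> a = \<theta>' a) \<Longrightarrow> u \<in> simplices m l \<Longrightarrow> map \<theta> u = map \<theta>' u"
  by (auto simp: simplices_def)

lemma tensor_map_cong: "(\<And>a. a \<le> m \<Longrightarrow> \<theta> a = \<theta>' a) \<Longrightarrow>
    tensor_map \<theta> m l = (tensor_map \<theta>' m l :: (nat list \<Rightarrow> 'a::real_vector) \<Rightarrow> _)"
proof
  fix x :: "nat list \<Rightarrow> 'a"
  assume "\<And>a. a \<le> m \<Longrightarrow> \<theta> a = \<theta>' a"
  then have "map \<theta> u = map \<theta>' u" if "u \<in> simplices m l" for u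
    using that by (rule map_simplex_cong)
  then show "tensor_map \<theta> m l x = tensor_map \<theta>' m l x"
    unfolding tensor_map_def by (intro sum.cong) (simp_all only:)
qed

lemma tensor_map_id: "x \<in> lev (tensor V m) l \<Longrightarrow> tensor_map (\<lambda>a. a) m l x = x"
  unfolding tensor_map_push tensor_lev by (rule push_id[OF finite_simplices]) auto

lemma tensor_map_copy: "u \<in> simplices m l \<Longrightarrow> tensor_map \<theta> m l (copy u v) = copy (map \<theta> u) v"
  unfolding tensor_map_push by (rule push_copy[OF finite_simplices]) auto

lemma copy_tensor_lev:
  "simplicial_vs V \<Longrightarrow> u \<in> simplices m l \<Longrightarrow> v \<in> lev V l \<Longrightarrow> copy u v \<in> lev (tensor V m) l"
  unfolding tensor_lev by (rule copy_in_copies[OF lev_subspace])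

text \<open>Precomposition with the map of tensor products induced by \<open>\<theta>\<close>. All faces and degeneracies of the
  \<open>n\<close>-dual are of this form, so its simplicial identities are cosimplicial identities for \<open>\<theta>\<close>.\<close>

definition pull :: "'a::real_vector simp_vs \<Rightarrow> (nat \<Rightarrow> nat) \<Rightarrow> nat \<Rightarrow>
    (nat \<Rightarrow> (nat list \<Rightarrow> 'a) \<Rightarrow> nat list \<Rightarrow> real) \<Rightarrow> nat \<Rightarrow> (nat list \<Rightarrow> 'a) \<Rightarrow> nat list \<Rightarrow> real" where
  "pull V \<theta> m f = (\<lambda>l. ext0 (lev (tensor V m) l) (\<lambda>x. f l (tensor_map \<theta> m l x)))"

lemma ndual_lev: "lev (ndual n V) m = svec_hom (tensor V m) (BnR n)"
  by (simp add: ndual_def)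

lemma ndual_face: "face (ndual n V) m i = pull V (coface i) (m - 1)"
  by (simp add: ndual_def pull_def fun_eq_iff)

lemma ndual_degen: "degen (ndual n V) m j = pull V (codegen j) (m + 1)"
  by (simp add: ndual_def pull_def fun_eq_iff)

lemma pull_apply: "x \<in> lev (tensor V m) l \<Longrightarrow> pull V \<theta> m f l x = f l (tensor_map \<theta> m l x)"
  by (simp add: pull_def ext0_def)

lemma pull_svec_hom:
  assumes V: "simplicial_vs V" and \<theta>: "monotone_upto m m' \<theta>" and f: "f \<in> svec_hom (tensor V m') W"
  shows "pull V \<theta> m f \<in> svec_hom (tensor V m) W"
  unfolding svec_hom_def
proof (intro CollectI conjI allI impI ballI)
  note T = simplicial_vs_tensor[OF V, of m]
  fix l
  have "lin_on (lev (tensor V m) l) (lev W l) (\<lambda>x. f l (tensor_map \<theta> m l x))"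
    by (rule lin_on_comp[OF tensor_map_lin[OF V \<theta>] svec_hom_lin[OF f]])
  then show "pull V \<theta> m f l \<in> lin_hom (lev (tensor V m) l) (lev W l)"
    unfolding pull_def by (rule ext0_lin_hom[OF lev_subspace[OF T]])
  show "pull V \<theta> m f l (face (tensor V m) (Suc l) i x) = face W (Suc l) i (pull V \<theta> m f (Suc l) x)"
    if "i \<le> Suc l" "x \<in> lev (tensor V m) (Suc l)" for i x
    unfolding pull_apply[OF face_lev[OF T that]] pull_apply[OF that(2)] tensor_map_face[OF V \<theta> that]
    by (rule svec_hom_face[OF f that(1) tensor_map_lev[OF V \<theta> that(2)]])
  show "pull V \<theta> m f (Suc l) (degen (tensor V m) l j x) = degen W l j (pull V \<theta> m f l x)"
    if "j \<le> l" "x \<in> lev (tensor V m) l" for j x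
    unfolding pull_apply[OF degen_lev[OF T that]] pull_apply[OF that(2)] tensor_map_degen[OF V \<theta> that]
    by (rule svec_hom_degen[OF f that(1) tensor_map_lev[OF V \<theta> that(2)]])
qed

lemma pull_pull:
  assumes V: "simplicial_vs V" and \<theta>: "monotone_upto m m' \<theta>"
  shows "pull V \<theta> m (pull V \<theta>' m' f) = pull V (\<theta>' \<circ> \<theta>) m f"
proof (intro ext)
  fix l x \<sigma>
  show "pull V \<theta> m (pull V \<theta>' m' f) l x \<sigma> = pull V (\<theta>' \<circ> \<theta>) m f l x \<sigma>"
  proof (cases "x \<in> lev (tensor V m) l")
    case True
    then show ?thesis
      by (simp only: pull_apply[OF True] pull_apply[OF tensor_map_lev[OF V \<theta> True]]
          tensor_map_comp[OF V \<theta> True])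
  next
    case False
    then show ?thesis by (simp add: pull_def ext0_def)
  qed
qed

lemma pull_cong: "(\<And>a. a \<le> m \<Longrightarrow> \<theta> a = \<theta>' a) \<Longrightarrow> pull V \<theta> m f = pull V \<theta>' m f"
  unfolding pull_def by (subst tensor_map_cong[of m \<theta> \<theta>']) simp_all

lemma pull_id:
  assumes f: "f \<in> svec_hom (tensor V m) W" and \<theta>: "\<And>a. a \<le> m \<Longrightarrow> \<theta> a = a"
  shows "pull V \<theta> m f = f"
proof -
  have "pull V \<theta> m f = pull V (\<lambda>a. a) m f" using \<theta> by (rule pull_cong)
  also have "\<dots> = f"
    by (intro ext) (simp add: pull_def ext0_def tensor_map_id svec_hom_outside[OF f])
  finally show ?thesis .
qed

lemma subspace_lin_hom: "subspace T \<Longrightarrow> subspace (lin_hom S T)"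
  unfolding subspace_def lin_hom_def lin_on_def
  by (auto simp: scaleR_fun_def scaleR_add_right scaleR_left_commute)

lemma BnR_face_linear:
  shows "face (BnR n) m i (c + c') = face (BnR n) m i c + face (BnR n) m i c'"
    and "face (BnR n) m i (r *\<^sub>R c) = r *\<^sub>R face (BnR n) m i c"
    and "face (BnR n) m i 0 = 0"
  by (auto simp: BnR_face ext0_def fun_eq_iff scaleR_fun_def)

lemma BnR_degen_linear:
  shows "degen (BnR n) m i (c + c') = degen (BnR n) m i c + degen (BnR n) m i c'"
    and "degen (BnR n) m i (r *\<^sub>R c) = r *\<^sub>R degen (BnR n) m i c"
    and "degen (BnR n) m i 0 = 0"
  by (auto simp: BnR_degen ext0_def fun_eq_iff scaleR_fun_def)

lemma subspace_svec_hom: "subspace (svec_hom V (BnR n))"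
  unfolding subspace_def
proof (intro conjI ballI allI)
  have L: "subspace (lin_hom (lev V l) (lev (BnR n) l))" for l
    by (rule subspace_lin_hom[OF subspace_BnR])
  show "0 \<in> svec_hom V (BnR n)"
    using subspace_0[OF L] by (simp add: svec_hom_def BnR_face_linear BnR_degen_linear)
  fix f r assume f: "f \<in> svec_hom V (BnR n)"
  have sc: "(r *\<^sub>R f) l = r *\<^sub>R f l" "(r *\<^sub>R f l) x = r *\<^sub>R f l x" for l x
    by (simp_all add: scaleR_fun_def)
  show "r *\<^sub>R f \<in> svec_hom V (BnR n)"
    unfolding svec_hom_def
    using svec_hom_face[OF f] svec_hom_degen[OF f] subspace_scale[OF L svec_hom_lin_hom[OF f]]
    by (auto simp: sc BnR_face_linear BnR_degen_linear)
  fix g assume g: "g \<in> svec_hom V (BnR n)"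
  show "f + g \<in> svec_hom V (BnR n)"
    unfolding svec_hom_def
    using svec_hom_face[OF f] svec_hom_degen[OF f] svec_hom_face[OF g] svec_hom_degen[OF g]
      subspace_add[OF L svec_hom_lin_hom[OF f] svec_hom_lin_hom[OF g]]
    by (auto simp: BnR_face_linear BnR_degen_linear)
qed

text \<open>The cocycle conditions on the tensor product with \<open>\<Delta>[m]\<close>, written out copy by copy.\<close>

definition component_family :: "nat \<Rightarrow> 'a::real_vector simp_vs \<Rightarrow> nat \<Rightarrow> (nat list \<Rightarrow> 'a \<Rightarrow> real) \<Rightarrow> bool" where
  "component_family n V m \<beta> \<longleftrightarrow> (\<forall>u\<in>simplices m n. \<beta> u \<in> dual_space (lev V n)) \<and>
     (\<forall>k j. n = Suc k \<longrightarrow> j \<le> k \<longrightarrow> (\<forall>u\<in>simplices m k. \<forall>v\<in>lev V k. \<beta> (sdegen j u) (degen V k j v) = 0)) \<and>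
     (\<forall>u\<in>simplices m (Suc n). \<forall>v\<in>lev V (Suc n).
        (\<Sum>i\<le>Suc n. (-1) ^ i * \<beta> (sface i u) (face V (Suc n) i v)) = 0)"

lemma component_eq: "component n V f u = ext0 (lev V n) (\<lambda>v. f n (copy u v) (vertex_list n))"
  by (simp add: component_def vertex_list_def)

lemma component_apply: "v \<in> lev V n \<Longrightarrow> component n V f u v = f n (copy u v) (vertex_list n)"
  by (simp add: component_eq ext0_def)

lemma tensor_expand: "x \<in> lev (tensor V m) l \<Longrightarrow> x = (\<Sum>u\<in>simplices m l. copy u (x u))"
  unfolding tensor_lev by (rule copies_expand[OF finite_simplices])

lemma lin_on_tensor_expand:
  assumes V: "simplicial_vs V" and \<alpha>: "lin_on (lev (tensor V m) l) T \<alpha>" and x: "x \<in> lev (tensor V m) l"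
  shows "\<alpha> x = (\<Sum>u\<in>simplices m l. \<alpha> (copy u (x u)))"
proof -
  have "\<alpha> (\<Sum>u\<in>simplices m l. copy u (x u)) = (\<Sum>u\<in>simplices m l. \<alpha> (copy u (x u)))"
    by (rule lin_on_sum[OF \<alpha> lev_subspace[OF simplicial_vs_tensor[OF V]]])
      (rule copy_tensor_lev[OF V], use x in \<open>auto simp: tensor_lev copies_def\<close>)
  with tensor_expand[OF x] show ?thesis by simp
qed

lemma copy_scaleR: "copy u (r *\<^sub>R v) = r *\<^sub>R copy u v" and copy_add: "copy u (v + w) = copy u v + copy u w"
  for v :: "'a::real_vector"
  by (auto simp: copy_def fun_eq_iff scaleR_fun_def)

lemma component_family_component:
  assumes V: "simplicial_vs V" and f: "f \<in> lev (ndual n V) m"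
  shows "component_family n V m (component n V f)"
  unfolding component_family_def
proof (intro conjI ballI allI impI)
  note T = simplicial_vs_tensor[OF V, of m]
  have c: "cocycle n (tensor V m) (\<lambda>w. f n w (vertex_list n))"
    using cocycle_of_hom[OF _ T] f by (simp add: ndual_lev)
  fix u
  show "component n V f u \<in> dual_space (lev V n)" if u: "u \<in> simplices m n"
  proof -
    have lin: "lin_on (lev (tensor V m) n) UNIV (\<lambda>w. f n w (vertex_list n))"
      using c by (simp add: cocycle_def)
    have "lin_on (lev V n) UNIV (\<lambda>v. f n (copy u v) (vertex_list n))"
      unfolding lin_on_def copy_add copy_scaleR
      using lin_on_add[OF lin] lin_on_scaleR[OF lin] copy_tensor_lev[OF V u] by auto
    then show ?thesis
      unfolding component_eq dual_space_def by (rule ext0_lin_hom[OF lev_subspace[OF V]])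
  qed
  show "component n V f (sdegen j u) (degen V k j v) = 0"
    if "n = Suc k" "j \<le> k" "u \<in> simplices m k" "v \<in> lev V k" for k j v
  proof -
    have "degen (tensor V m) k j (copy u v) = copy (sdegen j u) (degen V k j v)"
      unfolding tensor_degen
      by (rule push_copy[OF finite_simplices that(3)])
        (rule lin_on_zero[OF degen_lin[OF V that(2)] lev_subspace[OF V]])
    moreover have "degen V k j v \<in> lev V n" using degen_lev[OF V that(2,4)] that(1) by simp
    moreover have "f n (degen (tensor V m) k j (copy u v)) (vertex_list n) = 0"
      using c[unfolded cocycle_def] that(1,2) copy_tensor_lev[OF V that(3,4)] by blast
    ultimately show ?thesis by (simp add: component_apply)
  qed
  show "(\<Sum>i\<le>Suc n. (-1) ^ i * component n V f (sface i u) (face V (Suc n) i v)) = 0"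
    if u: "u \<in> simplices m (Suc n)" and v: "v \<in> lev V (Suc n)" for v
  proof -
    have "component n V f (sface i u) (face V (Suc n) i v)
        = f n (face (tensor V m) (Suc n) i (copy u v)) (vertex_list n)" if i: "i \<le> Suc n" for i
    proof -
      have "face (tensor V m) (Suc n) i (copy u v) = copy (sface i u) (face V (Suc n) i v)"
        unfolding tensor_face
        by (rule push_copy[OF finite_simplices u])
          (rule lin_on_zero[OF face_lin[OF V i] lev_subspace[OF V]])
      then show ?thesis using face_lev[OF V i v] by (simp add: component_apply)
    qed
    moreover have "copy u v \<in> lev (tensor V m) (Suc n)" using copy_tensor_lev[OF V u v] .
    ultimately show ?thesis using c by (simp add: cocycle_def del: sum.atMost_Suc)
  qed
qed

lemma ndual_eqI:
  assumes V: "simplicial_vs V" and f: "f \<in> lev (ndual n V) m" and g: "g \<in> lev (ndual n V) m"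
    and eq: "\<And>u v. u \<in> simplices m n \<Longrightarrow> v \<in> lev V n \<Longrightarrow> component n V f u v = component n V g u v"
  shows "f = g"
proof -
  note T = simplicial_vs_tensor[OF V, of m]
  note F = f[unfolded ndual_lev] and G = g[unfolded ndual_lev]
  show ?thesis
  proof (rule hom_BnR_eqI[OF T F G])
    fix w assume w: "w \<in> lev (tensor V m) n"
    have lin: "lin_on (lev (tensor V m) n) UNIV (\<lambda>w. f n w (vertex_list n))"
      "lin_on (lev (tensor V m) n) UNIV (\<lambda>w. g n w (vertex_list n))"
      using cocycle_of_hom[OF F T] cocycle_of_hom[OF G T] by (simp_all add: cocycle_def)
    have "f n (copy u (w u)) (vertex_list n) = g n (copy u (w u)) (vertex_list n)"
      if "u \<in> simplices m n" for u
    proof -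
      have "w u \<in> lev V n" using w that by (simp add: tensor_lev copies_def)
      with eq[OF that this] show ?thesis by (simp add: component_apply)
    qed
    then show "f n w (vertex_list n) = g n w (vertex_list n)"
      unfolding lin_on_tensor_expand[OF V lin(1) w] lin_on_tensor_expand[OF V lin(2) w]
      by (rule sum.cong[OF refl])
  qed
qed

text \<open>The functional \<open>x \<mapsto> \<Sum>\<^sub>u \<beta> u (x u)\<close> is a cocycle on the tensor product: its alternating sum over faces
  regroups into one cocycle identity for each simplex \<open>u\<close> of dimension \<open>n + 1\<close>.\<close>

lemma ndual_exists:
  assumes V: "simplicial_vs V" and \<beta>: "component_family n V m \<beta>"
  shows "\<exists>f\<in>lev (ndual n V) m. \<forall>u\<in>simplices m n. component n V f u = \<beta> u"
proof -
  note T = simplicial_vs_tensor[OF V, of m]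
  define \<alpha> where "\<alpha> x = (\<Sum>u\<in>simplices m n. \<beta> u (x u))" for x :: "nat list \<Rightarrow> 'a"
  have \<beta>lin: "lin_on (lev V n) UNIV (\<beta> u)" if "u \<in> simplices m n" for u
    using \<beta> that by (auto simp: component_family_def dual_space_def lin_hom_def)
  have \<alpha>push: "\<alpha> (push (simplices m k) g h x) = (\<Sum>u\<in>simplices m k. \<beta> (g u) (h (x u)))"
    if "\<And>u. u \<in> simplices m k \<Longrightarrow> g u \<in> simplices m n" "lin_on (lev V k) (lev V n) h"
      "x \<in> lev (tensor V m) k" for g h x k
    unfolding \<alpha>_def
  proof (rule sum_push[OF finite_simplices finite_simplices that(1) _ lev_subspace[OF V] \<beta>lin])
    show "h (x u) \<in> lev V n" if "u \<in> simplices m k" for u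
      using lin_on_mem[OF \<open>lin_on (lev V k) (lev V n) h\<close>] \<open>x \<in> lev (tensor V m) k\<close> that
      by (simp add: tensor_lev copies_def)
  qed
  have "cocycle n (tensor V m) \<alpha>"
    unfolding cocycle_def
  proof (intro conjI allI impI ballI)
    show "lin_on (lev (tensor V m) n) UNIV \<alpha>"
      unfolding lin_on_def
    proof (intro conjI ballI allI)
      fix x y r assume x: "x \<in> lev (tensor V m) n"
      show "\<alpha> (r *\<^sub>R x) = r *\<^sub>R \<alpha> x"
        using x lin_on_scaleR[OF \<beta>lin]
        by (auto simp: \<alpha>_def tensor_lev copies_def scaleR_fun_def sum_distrib_left intro!: sum.cong)
      assume y: "y \<in> lev (tensor V m) n"
      show "\<alpha> (x + y) = \<alpha> x + \<alpha> y"
        using x y lin_on_add[OF \<beta>lin]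
        by (auto simp: \<alpha>_def tensor_lev copies_def sum.distrib[symmetric] intro!: sum.cong)
    qed auto
    show "\<alpha> (degen (tensor V m) k j x) = 0"
      if k: "n = Suc k" "j \<le> k" and x: "x \<in> lev (tensor V m) k" for k j x
    proof -
      have "\<alpha> (degen (tensor V m) k j x) = (\<Sum>u\<in>simplices m k. \<beta> (sdegen j u) (degen V k j (x u)))"
        unfolding tensor_degen
        by (rule \<alpha>push[OF _ _ x]) (use k in \<open>auto intro: sdegen_simplices degen_lin[OF V]\<close>)
      also have "\<dots> = 0"
        using \<beta> k x by (intro sum.neutral) (auto simp: component_family_def tensor_lev copies_def)
      finally show ?thesis .
    qed
    show "(\<Sum>i\<le>Suc n. (-1) ^ i * \<alpha> (face (tensor V m) (Suc n) i x)) = 0"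
      if x: "x \<in> lev (tensor V m) (Suc n)" for x
    proof -
      have "\<alpha> (face (tensor V m) (Suc n) i x)
          = (\<Sum>u\<in>simplices m (Suc n). \<beta> (sface i u) (face V (Suc n) i (x u)))" if "i \<le> Suc n" for i
        unfolding tensor_face
        by (rule \<alpha>push[OF _ _ x]) (use that in \<open>auto intro: sface_simplices face_lin[OF V]\<close>)
      then have "(\<Sum>i\<le>Suc n. (-1) ^ i * \<alpha> (face (tensor V m) (Suc n) i x))
          = (\<Sum>i\<le>Suc n. \<Sum>u\<in>simplices m (Suc n). (-1) ^ i * \<beta> (sface i u) (face V (Suc n) i (x u)))"
        by (simp add: sum_distrib_left del: sum.atMost_Suc)
      also have "\<dots> = (\<Sum>u\<in>simplices m (Suc n). \<Sum>i\<le>Suc n. (-1) ^ i * \<beta> (sface i u) (face V (Suc n) i (x u)))"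
        by (rule sum.swap)
      also have "\<dots> = 0"
      proof (rule sum.neutral, rule ballI)
        fix u assume u: "u \<in> simplices m (Suc n)"
        then have "x u \<in> lev V (Suc n)" using x by (simp add: tensor_lev copies_def)
        with \<beta> u show "(\<Sum>i\<le>Suc n. (-1) ^ i * \<beta> (sface i u) (face V (Suc n) i (x u))) = 0"
          unfolding component_family_def by blast
      qed
      finally show ?thesis .
    qed
  qed
  note c = this
  show ?thesis
  proof (intro bexI ballI)
    show "cocycle_hom n (tensor V m) \<alpha> \<in> lev (ndual n V) m"
      unfolding ndual_lev by (rule cocycle_hom_svec_hom[OF T c])
    fix u assume u: "u \<in> simplices m n"
    show "component n V (cocycle_hom n (tensor V m) \<alpha>) u = \<beta> u"
    proof
      fix v
      show "component n V (cocycle_hom n (tensor V m) \<alpha>) u v = \<beta> u v"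
      proof (cases "v \<in> lev V n")
        case True
        have "\<alpha> (copy u v) = \<beta> u v"
        proof -
          have "\<alpha> (copy u v) = (\<Sum>w\<in>simplices m n. if w = u then \<beta> u v else 0)"
            unfolding \<alpha>_def copy_def
            by (rule sum.cong) (auto simp: lin_on_zero[OF \<beta>lin lev_subspace[OF V]])
          with u show ?thesis by (simp add: finite_simplices)
        qed
        with True show ?thesis
          by (simp add: component_apply cocycle_hom_value copy_tensor_lev[OF V u])
      next
        case False
        then show ?thesis using \<beta> u
          by (simp add: component_eq ext0_def component_family_def dual_space_def lin_hom_def)
      qed
    qed
  qed
qed

lemma component_pull:
  assumes V: "simplicial_vs V" and \<theta>: "monotone_upto m m' \<theta>" and u: "u \<in> simplices m n"
  shows "component n V (pull V \<theta> m f) u = component n V f (map \<theta> u)"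
  by (intro ext) (simp add: component_eq ext0_def pull_def copy_tensor_lev[OF V u] tensor_map_copy[OF u])

lemma component_face:
  "simplicial_vs V \<Longrightarrow> u \<in> simplices m n \<Longrightarrow>
    component n V (face (ndual n V) (Suc m) i f) u = component n V f (map (coface i) u)"
  unfolding ndual_face by (simp add: component_pull[OF _ monotone_coface])

lemma component_degen:
  "simplicial_vs V \<Longrightarrow> j \<le> m \<Longrightarrow> u \<in> simplices (Suc m) n \<Longrightarrow>
    component n V (degen (ndual n V) m j f) u = component n V f (map (codegen j) u)"
  unfolding ndual_degen by (simp add: component_pull[OF _ monotone_codegen])

lemma finite_span_ndual:
  assumes V: "simplicial_vs V"
  shows "\<exists>B. finite B \<and> span B = lev (ndual n V) m"
proof -
  note T = simplicial_vs_tensor[OF V, of m]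
  have sub: "subspace (lev (ndual n V) m)" unfolding ndual_lev by (rule subspace_svec_hom)
  obtain B where B: "finite B" "span B = lev V n" using lev_finite[OF V] by blast
  define F :: "nat list \<times> 'a \<Rightarrow> (nat \<Rightarrow> (nat list \<Rightarrow> 'a) \<Rightarrow> nat list \<Rightarrow> real) \<Rightarrow> real"
    where "F = (\<lambda>(u, b) f. f n (copy u b) (vertex_list n))"
  show ?thesis
  proof (rule finite_span_if_separated[OF sub, of "simplices m n \<times> B" F])
    show "finite (simplices m n \<times> B)" using B finite_simplices by blast
    show "linear (F i)" for i
      by (rule linearI) (auto simp: F_def scaleR_fun_def split: prod.split)
    fix f assume f: "f \<in> lev (ndual n V) m" and z: "\<And>i. i \<in> simplices m n \<times> B \<Longrightarrow> F i f = 0"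
    have z0: "0 \<in> lev (ndual n V) m" using sub by (rule subspace_0)
    show "f = 0"
    proof (rule ndual_eqI[OF V f z0])
      fix u v assume u: "u \<in> simplices m n" and v: "v \<in> lev V n"
      have lin: "lin_on (lev V n) UNIV (component n V f u)"
        using component_family_component[OF V f] u by (auto simp: component_family_def dual_space_def lin_hom_def)
      have "subspace {v \<in> lev V n. component n V f u v = 0}"
        using lev_subspace[OF V, of n] lin_on_add[OF lin] lin_on_scaleR[OF lin]
          lin_on_zero[OF lin lev_subspace[OF V]]
        by (auto simp: subspace_def)
      moreover have "B \<subseteq> {v \<in> lev V n. component n V f u v = 0}"
      proof
        fix b assume b: "b \<in> B"
        then have "b \<in> lev V n" using B(2) span_base by blast
        moreover have "F (u, b) f = 0" using z u b by blast
        ultimately show "b \<in> {v \<in> lev V n. component n V f u v = 0}"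
          by (simp add: F_def component_apply)
      qed
      ultimately have "span B \<subseteq> {v \<in> lev V n. component n V f u v = 0}" by (rule span_minimal[rotated])
      then have "component n V f u v = 0" using v unfolding B(2) by blast
      then show "component n V f u v = component n V 0 u v" by (simp add: component_eq ext0_def)
    qed
  qed
qed

lemma pull_lin:
  assumes V: "simplicial_vs V" and \<theta>: "monotone_upto m m' \<theta>"
  shows "lin_on (svec_hom (tensor V m') W) (svec_hom (tensor V m) W) (pull V \<theta> m)"
  unfolding lin_on_def
proof (intro conjI ballI allI)
  show "pull V \<theta> m f \<in> svec_hom (tensor V m) W" if "f \<in> svec_hom (tensor V m') W" for f
    by (rule pull_svec_hom[OF V \<theta> that])
  show "pull V \<theta> m (f + g) = pull V \<theta> m f + pull V \<theta> m g" for f g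
    by (intro ext) (simp add: pull_def ext0_def)
  show "pull V \<theta> m (r *\<^sub>R f) = r *\<^sub>R pull V \<theta> m f" for r f
    by (intro ext) (simp add: pull_def ext0_def scaleR_fun_def)
qed

lemma simplicial_vs_ndual:
  assumes V: "simplicial_vs V"
  shows "simplicial_vs (ndual n V)"
  unfolding simplicial_vs_def
proof (intro conjI allI impI ballI)
  note cf = monotone_coface and cd = monotone_codegen
  fix m i j f
  show "\<exists>B. finite B \<and> span B = lev (ndual n V) m" by (rule finite_span_ndual[OF V])
  show "lin_on (lev (ndual n V) (Suc m)) (lev (ndual n V) m) (face (ndual n V) (Suc m) i)"
    using pull_lin[OF V cf] by (simp add: ndual_lev ndual_face)
  show "lin_on (lev (ndual n V) m) (lev (ndual n V) (Suc m)) (degen (ndual n V) m j)" if "j \<le> m"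
    using pull_lin[OF V cd[OF that]] by (simp add: ndual_lev ndual_degen)
  show "face (ndual n V) (Suc m) i (face (ndual n V) (Suc (Suc m)) j f)
      = face (ndual n V) (Suc m) (j - 1) (face (ndual n V) (Suc (Suc m)) i f)" if "i < j"
    unfolding ndual_face diff_Suc_1 pull_pull[OF V cf]
    by (rule pull_cong) (use that in \<open>auto simp: coface_def\<close>)
  show "degen (ndual n V) (Suc m) i (degen (ndual n V) m j f)
      = degen (ndual n V) (Suc m) (Suc j) (degen (ndual n V) m i f)" if "i \<le> j" "j \<le> m"
    using that unfolding ndual_degen
    by (simp only: Suc_eq_plus1[symmetric], subst (1 2) pull_pull[OF V cd])
      (auto intro!: pull_cong simp: codegen_def)
  show "face (ndual n V) (Suc (Suc m)) i (degen (ndual n V) (Suc m) j f)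
      = degen (ndual n V) m (j - 1) (face (ndual n V) (Suc m) i f)" if "i < j" "j \<le> Suc m"
    using that unfolding ndual_degen ndual_face diff_Suc_1
    by (simp only: Suc_eq_plus1[symmetric], subst pull_pull[OF V cf], subst pull_pull[OF V cd])
      (auto intro!: pull_cong simp: codegen_def coface_def)
  show "face (ndual n V) (Suc (Suc m)) i (degen (ndual n V) (Suc m) j f)
      = degen (ndual n V) m j (face (ndual n V) (Suc m) (i - 1) f)"
    if "Suc j < i" "i \<le> Suc (Suc m)"
    using that unfolding ndual_degen ndual_face diff_Suc_1
    by (simp only: Suc_eq_plus1[symmetric], subst pull_pull[OF V cf], subst pull_pull[OF V cd])
      (auto intro!: pull_cong simp: codegen_def coface_def)
  have same: "face (ndual n V) (Suc m) i (degen (ndual n V) m j f) = f"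
    if "j \<le> m" "f \<in> lev (ndual n V) m" "i = j \<or> i = Suc j" for i
  proof -
    have "face (ndual n V) (Suc m) i (degen (ndual n V) m j f) = pull V (codegen j \<circ> coface i) m f"
      by (simp add: ndual_degen ndual_face pull_pull[OF V cf])
    also have "\<dots> = f"
      by (rule pull_id[OF that(2)[unfolded ndual_lev]]) (use that in \<open>auto simp: codegen_def coface_def\<close>)
    finally show ?thesis .
  qed
  show "face (ndual n V) (Suc m) j (degen (ndual n V) m j f) = f"
    "face (ndual n V) (Suc m) (Suc j) (degen (ndual n V) m j f) = f"
    if "j \<le> m" "f \<in> lev (ndual n V) m"
    using same[OF that] by simp_all
qed

section \<open>Horns and the groupoid property\<close>

lemma face_diff: "simplicial_vs W \<Longrightarrow> i \<le> Suc m \<Longrightarrow> x \<in> lev W (Suc m) \<Longrightarrow> y \<in> lev W (Suc m) \<Longrightarrow>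
    face W (Suc m) i (x - y) = face W (Suc m) i x - face W (Suc m) i y"
  using lin_on_diff[OF face_lin lev_subspace] .

lemma face_add: "simplicial_vs W \<Longrightarrow> i \<le> Suc m \<Longrightarrow> x \<in> lev W (Suc m) \<Longrightarrow> y \<in> lev W (Suc m) \<Longrightarrow>
    face W (Suc m) i (x + y) = face W (Suc m) i x + face W (Suc m) i y"
  using lin_on_add[OF face_lin] .

text \<open>The correction step in the filling of horns: adding \<open>s\<^sub>j c\<close> changes the faces \<open>j\<close> and \<open>j + 1\<close> by \<open>c\<close>
  and leaves the \<open>i\<close>-th face alone as soon as the relevant face of \<open>c\<close> is zero.\<close>

lemma face_degen_vanishes:
  assumes W: "simplicial_vs W" and j: "j \<le> M" and c: "c \<in> lev W M"
    and i: "i \<le> Suc M" "i \<noteq> j" "i \<noteq> Suc j"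
    and less: "i < j \<Longrightarrow> face W M i c = 0" and greater: "Suc j < i \<Longrightarrow> face W M (i - 1) c = 0"
  shows "face W (Suc M) i (degen W M j c) = 0"
proof -
  obtain M' where M: "M = Suc M'" using i j by (cases M) auto
  show ?thesis
  proof (cases "i < j")
    case True
    then have "face W (Suc M) i (degen W M j c) = degen W M' (j - 1) (face W M i c)"
      using face_degen_less[OF W True] j c unfolding M by blast
    also have "\<dots> = degen W M' (j - 1) 0" using less True by simp
    also have "\<dots> = 0"
      by (rule lin_on_zero[OF degen_lin[OF W] lev_subspace[OF W]]) (use j M in auto)
    finally show ?thesis .
  next
    case False
    then have g: "Suc j < i" using i by simp
    then have "face W (Suc M) i (degen W M j c) = degen W M' j (face W M (i - 1) c)"
      using face_degen_greater[OF W g] i c unfolding M by blast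
    also have "\<dots> = degen W M' j 0" using greater g by simp
    also have "\<dots> = 0"
      by (rule lin_on_zero[OF degen_lin[OF W] lev_subspace[OF W]]) (use g i M in auto)
    finally show ?thesis .
  qed
qed

lemma hornD:
  assumes "x \<in> horn V (Suc M) k"
  shows horn_lev: "i \<le> Suc M \<Longrightarrow> i \<noteq> k \<Longrightarrow> x i \<in> lev V M"
    and horn_compat: "i < j \<Longrightarrow> j \<le> Suc M \<Longrightarrow> i \<noteq> k \<Longrightarrow> j \<noteq> k \<Longrightarrow>
      face V M i (x j) = face V M (j - 1) (x i)"
    and horn_undefined: "i > Suc M \<or> i = k \<Longrightarrow> x i = undefined"
  using assms by (auto simp: horn_def PiE_iff extensional_def)

text \<open>Moore's argument. The faces below \<open>k\<close> are prescribed in ascending order, correcting the \<open>r\<close>-th one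
  with \<open>s\<^sub>r\<close>; then the faces above \<open>k\<close> in descending order, correcting the \<open>(j + 1)\<close>-st one with \<open>s\<^sub>j\<close>. The
  horn conditions say that the correction term has vanishing faces where it must not disturb faces
  that are already right.\<close>

lemma horn_filler:
  assumes W: "simplicial_vs W" and k: "k \<le> Suc M" and x: "x \<in> horn W (Suc M) k"
  shows "\<exists>y\<in>lev W (Suc M). \<forall>i\<le>Suc M. i \<noteq> k \<longrightarrow> face W (Suc M) i y = x i"
proof -
  note sub = lev_subspace[OF W]
  have two: "face W M i (face W (Suc M) j y) = face W M (j - 1) (face W (Suc M) i y)"
    if "i < j" "j \<le> Suc M" "M \<noteq> 0" "y \<in> lev W (Suc M)" for i j y
    using face_face[OF W that(1), of "M - 1" y] that by (cases M) auto
  have flev: "face W (Suc M) i y \<in> lev W M" if "i \<le> Suc M" "y \<in> lev W (Suc M)" for i y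
    using face_lev[OF W that] .
  have below: "\<exists>y\<in>lev W (Suc M). \<forall>i<r. face W (Suc M) i y = x i" if "r \<le> k" for r
    using that
  proof (induction r)
    case 0
    then show ?case using subspace_0[OF sub] by auto
  next
    case (Suc r)
    then obtain y where y: "y \<in> lev W (Suc M)" "\<And>i. i < r \<Longrightarrow> face W (Suc M) i y = x i" by auto
    have r: "r \<le> M" "r \<le> Suc M" "r \<noteq> k" using Suc.prems k by auto
    define c where "c = x r - face W (Suc M) r y"
    have c: "c \<in> lev W M" unfolding c_def
      by (rule subspace_diff[OF sub horn_lev[OF x r(2,3)] flev[OF r(2) y(1)]])
    note dc = degen_lev[OF W r(1) c]
    have "face W (Suc M) i (y + degen W M r c) = x i" if i: "i < Suc r" for i
    proof (cases "i = r")
      case True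
      then show ?thesis
        using face_add[OF W r(2) y(1) dc] face_degen_same[OF W r(1) c] by (simp add: c_def)
    next
      case False
      then have ir: "i < r" using i by simp
      obtain M' where M': "M = Suc M'" using ir r by (cases M) auto
      have "face W M i c = face W M i (x r) - face W M i (face W (Suc M) r y)"
        unfolding c_def M'
        by (rule face_diff[OF W])
          (use ir r horn_lev[OF x r(2,3)] flev[OF r(2) y(1)] M' in auto)
      also have "\<dots> = 0"
        using horn_compat[OF x ir r(2)] two[OF ir r(2) _ y(1)] y(2)[OF ir] ir r Suc.prems M' by simp
      finally have "face W (Suc M) i (degen W M r c) = 0"
        by (intro face_degen_vanishes[OF W r(1) c]) (use ir r in auto)
      then show ?thesis using face_add[OF W _ y(1) dc, of i] y(2)[OF ir] ir r by simp
    qed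
    moreover have "y + degen W M r c \<in> lev W (Suc M)" by (rule subspace_add[OF sub y(1) dc])
    ultimately show ?case by blast
  qed
  have above: "\<exists>y\<in>lev W (Suc M). \<forall>i\<le>Suc M. i < k \<or> Suc M < i + r \<longrightarrow> face W (Suc M) i y = x i"
    if "k + r \<le> Suc M" for r
    using that
  proof (induction r)
    case 0
    then show ?case using below[OF order_refl] by auto
  next
    case (Suc r)
    then obtain y where y: "y \<in> lev W (Suc M)"
      "\<And>i. i \<le> Suc M \<Longrightarrow> i < k \<or> Suc M < i + r \<Longrightarrow> face W (Suc M) i y = x i" by auto
    define j where "j = M - r"
    have j: "j \<le> M" "Suc j \<le> Suc M" "Suc j \<noteq> k" "k \<le> j" "Suc j + r = Suc M"
      using Suc.prems by (auto simp: j_def)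
    define c where "c = x (Suc j) - face W (Suc M) (Suc j) y"
    have c: "c \<in> lev W M" unfolding c_def
      by (rule subspace_diff[OF sub horn_lev[OF x j(2,3)] flev[OF j(2) y(1)]])
    note dc = degen_lev[OF W j(1) c]
    have "face W (Suc M) i (y + degen W M j c) = x i"
      if i: "i \<le> Suc M" "i < k \<or> Suc M < i + Suc r" for i
    proof (cases "i = Suc j")
      case True
      then show ?thesis
        using face_add[OF W j(2) y(1) dc] face_degen_same[OF W j(1) c] by (simp add: c_def)
    next
      case False
      have i': "i < k \<or> Suc j < i" "i \<noteq> k" "i < k \<or> Suc M < i + r" using i False j by auto
      obtain M' where M': "M = Suc M'" using i i' j by (cases M) auto
      have yi: "face W (Suc M) i y = x i" using y(2)[OF i(1) i'(3)] .
      have fc: "face W M a c = face W M a (x (Suc j)) - face W M a (face W (Suc M) (Suc j) y)"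
        if "a \<le> M" for a
        unfolding c_def M'
        by (rule face_diff[OF W]) (use that horn_lev[OF x j(2,3)] flev[OF j(2) y(1)] M' in auto)
      have "face W M i c = 0" if "i < j"
        using fc[of i] horn_compat[OF x, of i "Suc j"] two[of i "Suc j" y] yi that j i' y(1) M' by simp
      moreover have "face W M (i - 1) c = 0" if "Suc j < i"
        using fc[of "i - 1"] horn_compat[OF x, of "Suc j" i] two[of "Suc j" i y] yi that i i' j y(1) M'
        by simp
      ultimately have "face W (Suc M) i (degen W M j c) = 0"
        by (intro face_degen_vanishes[OF W j(1) c]) (use i i' j in auto)
      then show ?thesis using face_add[OF W i(1) y(1) dc] yi by simp
    qed
    moreover have "y + degen W M j c \<in> lev W (Suc M)" by (rule subspace_add[OF sub y(1) dc])
    ultimately show ?case by blast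
  qed
  from above[of "Suc M - k"] k show ?thesis by (auto simp: nat_neq_iff)
qed

lemma horn_proj_image:
  assumes W: "simplicial_vs W" and k: "k \<le> Suc M"
  shows "horn_proj W (Suc M) k ` lev W (Suc M) = horn W (Suc M) k"
proof (intro equalityI subsetI)
  fix x assume "x \<in> horn_proj W (Suc M) k ` lev W (Suc M)"
  then obtain y where y: "y \<in> lev W (Suc M)" and x: "x = horn_proj W (Suc M) k y" by blast
  have "face W M i (face W (Suc M) j y) = face W M (j - 1) (face W (Suc M) i y)"
    if ij: "i < j" "j \<le> Suc M" "i \<noteq> k" "j \<noteq> k" for i j
  proof -
    obtain M' where M': "M = Suc M'" using ij k by (cases M) auto
    show ?thesis
      unfolding M' by (rule face_face[OF W ij(1) ij(2)[unfolded M'] y[unfolded M']])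
  qed
  then show "x \<in> horn W (Suc M) k"
    using face_lev[OF W _ y] by (auto simp: x horn_def horn_proj_def PiE_iff extensional_def)
next
  fix x assume x: "x \<in> horn W (Suc M) k"
  then obtain y where y: "y \<in> lev W (Suc M)" "\<And>i. i \<le> Suc M \<Longrightarrow> i \<noteq> k \<Longrightarrow> face W (Suc M) i y = x i"
    using horn_filler[OF W k x] by blast
  have "horn_proj W (Suc M) k y i = x i" for i
    using y(2)[of i] horn_undefined[OF x, of i] by (auto simp: horn_proj_def)
  then have "x = horn_proj W (Suc M) k y" by (simp add: fun_eq_iff)
  then show "x \<in> horn_proj W (Suc M) k ` lev W (Suc M)" using y(1) by blast
qed

text \<open>Since horns can always be filled, being an \<open>n\<close>-groupoid is a matter of uniqueness only.\<close>

lemma vs_groupoidI: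
  assumes W: "simplicial_vs W"
    and eq: "\<And>m k x y. n \<le> m \<Longrightarrow> k \<le> Suc m \<Longrightarrow> x \<in> lev W (Suc m) \<Longrightarrow> y \<in> lev W (Suc m) \<Longrightarrow>
      (\<And>i. i \<le> Suc m \<Longrightarrow> i \<noteq> k \<Longrightarrow> face W (Suc m) i x = face W (Suc m) i y) \<Longrightarrow> x = y"
  shows "vs_groupoid n W"
  unfolding vs_groupoid_def
proof (intro conjI allI impI)
  show img: "horn_proj W m k ` lev W m = horn W m k" if "1 \<le> m" "k \<le> m" for m k
    using horn_proj_image[OF W, of k "m - 1"] that by (cases m) auto
  show "bij_betw (horn_proj W m k) (lev W m) (horn W m k)" if nm: "n + 1 \<le> m" and km: "k \<le> m" for m k
    unfolding bij_betw_def
  proof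
    obtain m' where m: "m = Suc m'" "n \<le> m'" using nm by (cases m) auto
    show "inj_on (horn_proj W m k) (lev W m)"
    proof (rule inj_onI)
      fix x y assume xy: "x \<in> lev W m" "y \<in> lev W m" and e: "horn_proj W m k x = horn_proj W m k y"
      have fe: "face W m i x = face W m i y" if "i \<le> m" "i \<noteq> k" for i
        using fun_cong[OF e, of i] that by (simp add: horn_proj_def)
      show "x = y"
        by (rule eq[OF m(2) km[unfolded m(1)] xy[unfolded m(1)] fe[unfolded m(1)]])
    qed
    show "horn_proj W m k ` lev W m = horn W m k" using img nm km by simp
  qed
qed (fact W)

text \<open>A simplex \<open>u\<close> of dimension \<open>n\<close> has at most \<open>n + 1\<close> vertices. If it misses a vertex other than \<open>k\<close>, its
  component is a component of a known face. Otherwise \<open>m = n\<close> and \<open>u\<close> is the \<open>k\<close>-th face of the top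
  simplex; in the cocycle identity at the top simplex all other terms are known, and evaluating it at a
  preimage of \<open>v\<close> under \<open>d\<^sub>k\<close> isolates the component at \<open>u\<close>.\<close>

lemma vs_groupoid_ndual:
  assumes V: "simplicial_vs V"
  shows "vs_groupoid n (ndual n V)"
proof (rule vs_groupoidI[OF simplicial_vs_ndual[OF V]])
  fix m k f g
  assume m: "n \<le> m" and k: "k \<le> Suc m"
    and f: "f \<in> lev (ndual n V) (Suc m)" and g: "g \<in> lev (ndual n V) (Suc m)"
    and eq: "\<And>i. i \<le> Suc m \<Longrightarrow> i \<noteq> k \<Longrightarrow> face (ndual n V) (Suc m) i f = face (ndual n V) (Suc m) i g"
  have miss: "component n V f u = component n V g u"
    if u: "u \<in> simplices (Suc m) n" and i: "i \<le> Suc m" "i \<noteq> k" "i \<notin> set u" for u i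
  proof -
    have "map (codegen i) u \<in> simplices m n" by (rule map_codegen_simplices[OF u i(3,1)])
    then show ?thesis
      using component_face[OF V, of "map (codegen i) u" m n i f]
        component_face[OF V, of "map (codegen i) u" m n i g] eq[OF i(1,2)]
      by (simp only: map_coface_codegen[OF i(3)])
  qed
  show "f = g"
  proof (rule ndual_eqI[OF V f g])
    fix u v assume u: "u \<in> simplices (Suc m) n" and v: "v \<in> lev V n"
    show "component n V f u v = component n V g u v"
    proof (cases "{..Suc m} - {k} \<subseteq> set u")
      case False
      then obtain i where "i \<le> Suc m" "i \<noteq> k" "i \<notin> set u" by auto
      then show ?thesis using miss[OF u, of i] by simp
    next
      case True
      show ?thesis
      proof (cases "k \<in> set u")
        case True
        with \<open>{..Suc m} - {k} \<subseteq> set u\<close> have "{..Suc m} \<subseteq> set u" by auto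
        then have "Suc (Suc m) \<le> card (set u)" using card_mono[of "set u" "{..Suc m}"] by simp
        also have "\<dots> \<le> Suc n" using card_length[of u] u by (simp add: simplices_def)
        finally show ?thesis using m by simp
      next
        case k': False
        have "card ({..Suc m} - {k}) = Suc m" using k by (simp add: card_Diff_singleton)
        then have "Suc m \<le> card (set u)" using True card_mono[of "set u" "{..Suc m} - {k}"] by simp
        moreover have "card (set u) \<le> length u" by (rule card_length)
        ultimately have mn: "m = n" "card (set u) = length u"
          using u m by (auto simp: simplices_def)
        have d: "distinct u" using mn(2) by (rule card_distinct)
        have "map (codegen k) u \<in> simplices n n" "distinct (map (codegen k) u)"
          by (rule codegen_missing[OF u[unfolded mn(1)] d k' k[unfolded mn(1)]])+
        then have "map (codegen k) u = vertex_list n" by (rule vertex_list_unique)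
        then have "u = map (coface k) (vertex_list n)" using map_coface_codegen[OF k'] by simp
        then have uk: "sface k (vertex_list (Suc n)) = u"
          using sface_vertex_list[of k n] k mn(1) by simp
        have vl: "vertex_list (Suc n) \<in> simplices (Suc m) (Suc n)"
          using vertex_list_simplices mn(1) by simp
        \<comment> \<open>The face \<open>d\<^sub>k\<close> is split by \<open>s\<^sub>k\<^sub>-\<^sub>1\<close>, or by \<open>s\<^sub>0\<close> if \<open>k = 0\<close>.\<close>
        let ?w = "degen V n (if k = 0 then 0 else k - 1) v"
        have w: "?w \<in> lev V (Suc n)" by (rule degen_lev[OF V _ v]) (use k mn in auto)
        have kw: "face V (Suc n) k ?w = v" by (rule face_degen_same[OF V _ v]) (use k mn in auto)
        let ?t = "\<lambda>h i. (-1) ^ i * component n V h (sface i (vertex_list (Suc n))) (face V (Suc n) i ?w)"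
        have t_eq: "?t f i = ?t g i" if i: "i \<le> Suc n" "i \<noteq> k" for i
        proof -
          have "i \<notin> set (sface i (vertex_list (Suc n)))"
            unfolding sface_vertex_list[OF i(1)] by (auto simp: coface_def)
          moreover have "sface i (vertex_list (Suc n)) \<in> simplices (Suc m) n"
            by (rule sface_simplices[OF vl i(1)])
          ultimately show ?thesis using miss i mn(1) by simp
        qed
        have rest: "sum (?t f) ({..Suc n} - {k}) = sum (?t g) ({..Suc n} - {k})"
          by (rule sum.cong[OF refl], rule t_eq) auto
        have last: "?t h k = - sum (?t h) ({..Suc n} - {k})" if h: "h \<in> lev (ndual n V) (Suc m)" for h
        proof -
          have "sum (?t h) {..Suc n} = 0"
            using component_family_component[OF V h, unfolded component_family_def,
                THEN conjunct2, THEN conjunct2, THEN bspec, OF vl, THEN bspec, OF w] .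
          moreover have "sum (?t h) {..Suc n} = ?t h k + sum (?t h) ({..Suc n} - {k})"
            by (rule sum.remove) (use k mn(1) in auto)
          ultimately show ?thesis by linarith
        qed
        have "?t f k = ?t g k" unfolding last[OF f] last[OF g] rest ..
        then show ?thesis unfolding uk kw by simp
      qed
    qed
  qed
qed

section \<open>Relations between functionals on level two\<close>

text \<open>Levels 0 to 2 of a simplicial vector space, with a separate name for each structure map: \<open>e\<close> and
  \<open>t\<close> are the faces and the degeneracy between levels 0 and 1, \<open>d\<close> and \<open>s\<close> those between levels 1 and
  2. The identities are oriented as terminating rewrite rules, so that an identity between functionals
  reduces to linear arithmetic in their values on normal forms.\<close>

locale two_truncation =
  fixes V0 V1 V2 :: "'a::real_vector set"
    and e0 e1 d0 d1 d2 t s0 s1 :: "'a \<Rightarrow> 'a"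
  assumes sub: "subspace V0" "subspace V1" "subspace V2"
    and elin: "lin_on V1 V0 e0" "lin_on V1 V0 e1"
    and dlin: "lin_on V2 V1 d0" "lin_on V2 V1 d1" "lin_on V2 V1 d2"
    and slin: "lin_on V1 V2 s0" "lin_on V1 V2 s1"
    and tlin: "lin_on V0 V1 t"
    and ed: "X \<in> V2 \<Longrightarrow> e0 (d1 X) = e0 (d0 X)" "X \<in> V2 \<Longrightarrow> e0 (d2 X) = e1 (d0 X)"
      "X \<in> V2 \<Longrightarrow> e1 (d2 X) = e1 (d1 X)"
    and st: "z \<in> V0 \<Longrightarrow> s1 (t z) = s0 (t z)"
    and et: "z \<in> V0 \<Longrightarrow> e0 (t z) = z" "z \<in> V0 \<Longrightarrow> e1 (t z) = z"
    and ds0: "y \<in> V1 \<Longrightarrow> d0 (s0 y) = y" "y \<in> V1 \<Longrightarrow> d1 (s0 y) = y" "y \<in> V1 \<Longrightarrow> d2 (s0 y) = t (e1 y)"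
    and ds1: "y \<in> V1 \<Longrightarrow> d0 (s1 y) = t (e0 y)" "y \<in> V1 \<Longrightarrow> d1 (s1 y) = y" "y \<in> V1 \<Longrightarrow> d2 (s1 y) = y"
begin

text \<open>The core projections.\<close>

abbreviation g0 where "g0 X \<equiv> X - s0 (d1 X) - s1 (d2 X) + s0 (d2 X)"
abbreviation g1 where "g1 X \<equiv> X - s0 (d0 X) - s1 (d2 X) + s0 (t (e1 (d0 X)))"
abbreviation g2 where "g2 X \<equiv> X - s0 (d0 X) - s1 (d1 X) + s1 (d0 X)"

abbreviation (input) lin where "lin p \<equiv> lin_on V2 (UNIV :: real set) p"
abbreviation (input) kills0 where "kills0 p \<equiv> lin p \<and> (\<forall>y\<in>V1. p (s0 y) = 0)"
abbreviation (input) kills1 where "kills1 p \<equiv> lin p \<and> (\<forall>y\<in>V1. p (s1 y) = 0)"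

text \<open>The cocycle identity \<open>p d\<^sub>0 - q d\<^sub>1 + r d\<^sub>2 - s d\<^sub>3 = 0\<close> evaluated at the degenerate elements \<open>s\<^sub>0 X\<close>,
  \<open>s\<^sub>1 X\<close>, \<open>s\<^sub>2 X\<close> of level 3.\<close>

definition degenerate_relations :: "('a \<Rightarrow> real) \<Rightarrow> ('a \<Rightarrow> real) \<Rightarrow> ('a \<Rightarrow> real) \<Rightarrow> ('a \<Rightarrow> real) \<Rightarrow> bool" where
  "degenerate_relations p q r s \<longleftrightarrow> (\<forall>X\<in>V2.
     p X - q X + r (s0 (d1 X)) - s (s0 (d2 X)) = 0 \<and>
     p (s0 (d0 X)) - q X + r X - s (s1 (d2 X)) = 0 \<and>
     p (s1 (d0 X)) - q (s1 (d1 X)) + r X - s X = 0)"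

lemmas mems = lin_on_mem[OF elin(1)] lin_on_mem[OF elin(2)] lin_on_mem[OF dlin(1)]
  lin_on_mem[OF dlin(2)] lin_on_mem[OF dlin(3)] lin_on_mem[OF slin(1)] lin_on_mem[OF slin(2)]
  lin_on_mem[OF tlin] subspace_add[OF sub(1)] subspace_add[OF sub(2)] subspace_add[OF sub(3)]
  subspace_diff[OF sub(1)] subspace_diff[OF sub(2)] subspace_diff[OF sub(3)]

lemmas additive = lin_on_add[OF elin(1)] lin_on_add[OF elin(2)] lin_on_add[OF dlin(1)]
  lin_on_add[OF dlin(2)] lin_on_add[OF dlin(3)] lin_on_add[OF slin(1)] lin_on_add[OF slin(2)]
  lin_on_add[OF tlin]
  lin_on_diff[OF elin(1) sub(2)] lin_on_diff[OF elin(2) sub(2)] lin_on_diff[OF dlin(1) sub(3)]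
  lin_on_diff[OF dlin(2) sub(3)] lin_on_diff[OF dlin(3) sub(3)] lin_on_diff[OF slin(1) sub(2)]
  lin_on_diff[OF slin(2) sub(2)] lin_on_diff[OF tlin sub(1)]

lemmas zeros = lin_on_zero[OF elin(1) sub(2)] lin_on_zero[OF elin(2) sub(2)] lin_on_zero[OF dlin(1) sub(3)]
  lin_on_zero[OF dlin(2) sub(3)] lin_on_zero[OF dlin(3) sub(3)] lin_on_zero[OF slin(1) sub(2)]
  lin_on_zero[OF slin(2) sub(2)] lin_on_zero[OF tlin sub(1)]

lemmas calculus = mems additive zeros ed st et ds0 ds1

lemma functional:
  assumes "lin p" "X \<in> V2" "Y \<in> V2"
  shows "p (X + Y) = p X + p Y" "p (X - Y) = p X - p Y"
  using assms lin_on_add lin_on_diff[OF _ sub(3)] by blast+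

lemma kills1_t: "kills1 p \<Longrightarrow> z \<in> V0 \<Longrightarrow> p (s0 (t z)) = 0"
  using st lin_on_mem[OF tlin] by metis

lemma core_degenerate:
  assumes "y \<in> V1"
  shows "g0 (s0 y) = 0" "g0 (s1 y) = 0" "g1 (s0 y) = 0" "g1 (s1 y) = 0" "g2 (s0 y) = 0" "g2 (s1 y) = 0"
  using assms by (simp_all add: calculus)

text \<open>\<open>A\<close>, \<open>B\<close>, \<open>C\<close>, \<open>D\<close> are the components \<open>000\<close>, \<open>001\<close>, \<open>011\<close>, \<open>111\<close> over an edge, and the relations are
  those at \<open>0001\<close>, \<open>0011\<close>, \<open>0111\<close>. In each of them two of the three identities are trivial, because
  terms cancel or the functionals vanish on the degenerate elements involved.\<close>

lemma edge_iff:
  assumes A: "kills0 A" "kills1 A" and B: "kills0 B" and C: "kills1 C" and D: "kills0 D" "kills1 D"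
  shows "degenerate_relations B B B A \<and> degenerate_relations C C B B \<and> degenerate_relations D C C C \<longleftrightarrow>
    (\<forall>X\<in>V2. B (g1 X) = C (g1 X) \<and> A X = B (g2 X) \<and> D X = C (g0 X))"
proof -
  have "B (g1 X) = B X - B (s1 (d2 X))" "C (g1 X) = C X - C (s0 (d0 X))"
    "B (g2 X) = B X - B (s1 (d1 X)) + B (s1 (d0 X))"
    "C (g0 X) = C X - C (s0 (d1 X)) + C (s0 (d2 X))" if "X \<in> V2" for X
    using that B C kills1_t[OF C] by (simp_all add: calculus functional)
  with A B C D show ?thesis
    unfolding degenerate_relations_def by (force simp: mems)
qed

lemma vertex_relations:
  assumes A: "kills0 A" "kills1 A"
  shows "degenerate_relations A A A A"
  using assms unfolding degenerate_relations_def by (simp add: mems)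

lemma functional_core_degenerate:
  assumes "lin p" "y \<in> V1"
  shows "p (g0 (s0 y)) = 0" "p (g0 (s1 y)) = 0" "p (g2 (s0 y)) = 0" "p (g2 (s1 y)) = 0"
  unfolding core_degenerate[OF assms(2)] using lin_on_zero[OF assms(1) sub(3)] by simp_all

text \<open>The relations are those at \<open>0012\<close>, \<open>0112\<close>, \<open>0122\<close>. In each of them one identity is trivial, one gives
  the component of a face that is not part of the model, and one gives a constraint.\<close>

lemma triangle_iff:
  assumes \<phi>012: "lin \<phi>012" and \<phi>112: "kills0 \<phi>112" and \<phi>122: "kills1 \<phi>122" and \<phi>001: "kills0 \<phi>001"
    and \<phi>002: "kills0 \<phi>002" and \<phi>022: "kills1 \<phi>022" and \<phi>011: "kills1 \<phi>011"
  shows "degenerate_relations \<phi>012 \<phi>012 \<phi>002 \<phi>001 \<and> degenerate_relations \<phi>112 \<phi>012 \<phi>012 \<phi>011 \<and> degenerate_relations \<phi>122 \<phi>022 \<phi>012 \<phi>012 \<longleftrightarrow>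
    (\<forall>X\<in>V2. \<phi>012 (g0 X) = \<phi>112 (g1 X) \<and> \<phi>012 (g0 X) = \<phi>122 (g1 X) \<and> \<phi>012 (g2 X) = \<phi>001 (g1 X) \<and>
       \<phi>002 X = \<phi>012 X - \<phi>012 (s0 (d0 X)) + \<phi>001 (s1 (d2 X)) \<and>
       \<phi>022 X = \<phi>012 X - \<phi>012 (s1 (d2 X)) + \<phi>122 (s0 (d0 X)) \<and>
       \<phi>011 X = \<phi>012 X - \<phi>012 (s1 (d1 X)) + \<phi>112 (s1 (d0 X)))"
    (is "?L \<longleftrightarrow> ?R")
proof -
  have g: "\<phi>012 (g0 X) = \<phi>012 X - \<phi>012 (s0 (d1 X)) - \<phi>012 (s1 (d2 X)) + \<phi>012 (s0 (d2 X))"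
    "\<phi>012 (g2 X) = \<phi>012 X - \<phi>012 (s0 (d0 X)) - \<phi>012 (s1 (d1 X)) + \<phi>012 (s1 (d0 X))"
    "\<phi>112 (g1 X) = \<phi>112 X - \<phi>112 (s1 (d2 X))" "\<phi>122 (g1 X) = \<phi>122 X - \<phi>122 (s0 (d0 X))"
    "\<phi>001 (g1 X) = \<phi>001 X - \<phi>001 (s1 (d2 X))" if "X \<in> V2" for X
    using that \<phi>012 \<phi>112 \<phi>122 \<phi>001 kills1_t[OF \<phi>122] by (simp_all add: calculus functional)
  have z: "\<phi>112 (s0 y) = 0" "\<phi>122 (s1 y) = 0" "\<phi>001 (s0 y) = 0" "\<phi>002 (s0 y) = 0"
    "\<phi>022 (s1 y) = 0" "\<phi>011 (s1 y) = 0" if "y \<in> V1" for y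
    using that \<phi>112 \<phi>122 \<phi>001 \<phi>002 \<phi>022 \<phi>011 by simp_all
  have s: "s0 (d2 X) \<in> V2" "d1 (s0 (d2 X)) = d2 X" "d0 (s0 (d2 X)) = d2 X" if "X \<in> V2" for X
    using that by (simp_all add: calculus)
  show ?thesis
  proof
    assume L: ?L
    show ?R
    proof
      fix X assume X: "X \<in> V2"
      note inst = L[unfolded degenerate_relations_def]
      have "\<phi>011 Y = \<phi>012 Y - \<phi>012 (s1 (d1 Y)) + \<phi>112 (s1 (d0 Y))" if "Y \<in> V2" for Y
        using inst that by force
      \<comment> \<open>The identity for \<open>0112\<close> at \<open>s\<^sub>0 X\<close> contains \<open>\<phi>011\<close> at \<open>s\<^sub>0 d\<^sub>2 X\<close>, which has to be eliminated as well.\<close>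
      from this[OF X] this[OF s(1)[OF X]]
      have "\<phi>011 X = \<phi>012 X - \<phi>012 (s1 (d1 X)) + \<phi>112 (s1 (d0 X))"
        "\<phi>011 (s0 (d2 X)) = \<phi>012 (s0 (d2 X)) - \<phi>012 (s1 (d2 X)) + \<phi>112 (s1 (d2 X))"
        by (simp_all only: s[OF X])
      with inst X show "\<phi>012 (g0 X) = \<phi>112 (g1 X) \<and> \<phi>012 (g0 X) = \<phi>122 (g1 X) \<and> \<phi>012 (g2 X) = \<phi>001 (g1 X) \<and>
       \<phi>002 X = \<phi>012 X - \<phi>012 (s0 (d0 X)) + \<phi>001 (s1 (d2 X)) \<and>
       \<phi>022 X = \<phi>012 X - \<phi>012 (s1 (d2 X)) + \<phi>122 (s0 (d0 X)) \<and>
       \<phi>011 X = \<phi>012 X - \<phi>012 (s1 (d1 X)) + \<phi>112 (s1 (d0 X))"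
        unfolding g[OF X] by (force simp: z mems)
    qed
  next
    assume R: ?R
    show ?L
      unfolding degenerate_relations_def
    proof (intro conjI ballI)
      fix X assume X: "X \<in> V2"
      note r = R[rule_format, OF X, unfolded g[OF X]]
      note rs = R[rule_format, OF s(1)[OF X], unfolded s(2,3)[OF X]]
      note zs = z[OF lin_on_mem[OF dlin(1) X]] z[OF lin_on_mem[OF dlin(2) X]] z[OF lin_on_mem[OF dlin(3) X]]
      show "\<phi>012 X - \<phi>012 X + \<phi>002 (s0 (d1 X)) - \<phi>001 (s0 (d2 X)) = 0"
        "\<phi>012 (s0 (d0 X)) - \<phi>012 X + \<phi>002 X - \<phi>001 (s1 (d2 X)) = 0"
        "\<phi>012 (s1 (d0 X)) - \<phi>012 (s1 (d1 X)) + \<phi>002 X - \<phi>001 X = 0"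
        "\<phi>112 X - \<phi>012 X + \<phi>012 (s0 (d1 X)) - \<phi>011 (s0 (d2 X)) = 0"
        "\<phi>112 (s0 (d0 X)) - \<phi>012 X + \<phi>012 X - \<phi>011 (s1 (d2 X)) = 0"
        "\<phi>112 (s1 (d0 X)) - \<phi>012 (s1 (d1 X)) + \<phi>012 X - \<phi>011 X = 0"
        "\<phi>122 X - \<phi>022 X + \<phi>012 (s0 (d1 X)) - \<phi>012 (s0 (d2 X)) = 0"
        "\<phi>122 (s0 (d0 X)) - \<phi>022 X + \<phi>012 X - \<phi>012 (s1 (d2 X)) = 0"
        "\<phi>122 (s1 (d0 X)) - \<phi>022 (s1 (d1 X)) + \<phi>012 X - \<phi>012 X = 0"
        using r rs zs by linarith+
    qed
  qed
qed

text \<open>The faces of a point of the model are again in the model, and the vertex components obtained from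
  two edges that share a vertex agree. The formulas for \<open>002\<close>, \<open>022\<close>, \<open>011\<close>, composed with a core
  projection, turn into consequences of the constraints at the same \<open>X\<close>, because a core projection annihilates two of the faces.\<close>

lemma triangle_faces:
  assumes \<phi>012: "lin \<phi>012" and \<phi>112: "kills0 \<phi>112" and \<phi>122: "kills1 \<phi>122" and \<phi>001: "kills0 \<phi>001"
    and \<phi>: "\<And>X. X \<in> V2 \<Longrightarrow> \<phi>012 (g0 X) = \<phi>112 (g1 X) \<and> \<phi>012 (g0 X) = \<phi>122 (g1 X) \<and> \<phi>012 (g2 X) = \<phi>001 (g1 X)"
    and \<phi>002: "\<And>X. X \<in> V2 \<Longrightarrow> \<phi>002 X = \<phi>012 X - \<phi>012 (s0 (d0 X)) + \<phi>001 (s1 (d2 X))"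
    and \<phi>022: "\<And>X. X \<in> V2 \<Longrightarrow> \<phi>022 X = \<phi>012 X - \<phi>012 (s1 (d2 X)) + \<phi>122 (s0 (d0 X))"
    and \<phi>011: "\<And>X. X \<in> V2 \<Longrightarrow> \<phi>011 X = \<phi>012 X - \<phi>012 (s1 (d1 X)) + \<phi>112 (s1 (d0 X))"
  shows "kills0 \<phi>002" "kills1 \<phi>022" "kills1 \<phi>011"
    and "X \<in> V2 \<Longrightarrow> \<phi>001 (g1 X) = \<phi>011 (g1 X)"
    and "X \<in> V2 \<Longrightarrow> \<phi>002 (g1 X) = \<phi>022 (g1 X)"
    and "X \<in> V2 \<Longrightarrow> \<phi>001 (g2 X) = \<phi>002 (g2 X)"
    and "X \<in> V2 \<Longrightarrow> \<phi>011 (g0 X) = \<phi>112 (g2 X)"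
    and "X \<in> V2 \<Longrightarrow> \<phi>122 (g0 X) = \<phi>022 (g0 X)"
proof -
  have scal: "d0 (r *\<^sub>R X) = r *\<^sub>R d0 X" "d1 (r *\<^sub>R X) = r *\<^sub>R d1 X" "d2 (r *\<^sub>R X) = r *\<^sub>R d2 X"
    "s0 (r *\<^sub>R Y) = r *\<^sub>R s0 Y" "s1 (r *\<^sub>R Y) = r *\<^sub>R s1 Y" if "X \<in> V2" "Y \<in> V1" for r X Y
    using that dlin slin lin_on_scaleR by blast+
  have l: "p (r *\<^sub>R X) = r * p X" if "lin p" "X \<in> V2" for p r X
    using lin_on_scaleR[OF that] by simp
  note lins = \<phi>012 conjunct1[OF \<phi>112] conjunct1[OF \<phi>122] conjunct1[OF \<phi>001]
  have z: "\<phi>112 (s0 y) = 0" "\<phi>122 (s1 y) = 0" "\<phi>001 (s0 y) = 0" if "y \<in> V1" for y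
    using that \<phi>112 \<phi>122 \<phi>001 by simp_all
  have zt: "\<phi>122 (s0 (t x)) = 0" if "x \<in> V0" for x using kills1_t[OF \<phi>122 that] .
  note fn = functional[OF lins(1)] functional[OF lins(2)] functional[OF lins(3)] functional[OF lins(4)]
  note ls = l[OF lins(1)] l[OF lins(2)] l[OF lins(3)] l[OF lins(4)]
  note L = subspace_scale[OF sub(3)] subspace_add[OF sub(3)]
  have "lin \<phi>002" "lin \<phi>022" "lin \<phi>011"
    using mems by (auto simp: lin_on_def \<phi>002 \<phi>022 \<phi>011 L additive fn ls scal[OF _ subspace_0[OF sub(2)]] scal[OF subspace_0[OF sub(3)]] algebra_simps)
  then show "kills0 \<phi>002" "kills1 \<phi>022" "kills1 \<phi>011"
    by (auto simp: \<phi>002 \<phi>022 \<phi>011 calculus z zt)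
  assume X: "X \<in> V2"
  note c = \<phi>[OF X]
  note expand = \<phi>002 \<phi>022 \<phi>011 calculus fn z zt X lins[THEN lin_on_zero, OF sub(3)]
  show "\<phi>001 (g1 X) = \<phi>011 (g1 X)" "\<phi>002 (g1 X) = \<phi>022 (g1 X)" "\<phi>001 (g2 X) = \<phi>002 (g2 X)"
    "\<phi>011 (g0 X) = \<phi>112 (g2 X)" "\<phi>122 (g0 X) = \<phi>022 (g0 X)"
    using c by (simp_all add: expand)
qed

end

section \<open>Cocycle identities in a 2-groupoid\<close>

lemma two_truncation_simplicial:
  assumes V: "simplicial_vs V"
  shows "two_truncation (lev V 0) (lev V 1) (lev V 2) (face V 1 0) (face V 1 1)
    (face V 2 0) (face V 2 1) (face V 2 2) (degen V 0 0) (degen V 1 0) (degen V 1 1)"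
proof
  show "subspace (lev V 0)" "subspace (lev V 1)" "subspace (lev V 2)"
    using V by (simp_all add: lev_subspace)
  show "lin_on (lev V 1) (lev V 0) (face V 1 0)" "lin_on (lev V 1) (lev V 0) (face V 1 1)"
    using face_lin[OF V, of _ 0] by simp_all
  show "lin_on (lev V 2) (lev V 1) (face V 2 0)" "lin_on (lev V 2) (lev V 1) (face V 2 1)"
    "lin_on (lev V 2) (lev V 1) (face V 2 2)"
    using face_lin[OF V, of _ 1] by (simp_all add: numeral_2_eq_2)
  show "lin_on (lev V 1) (lev V 2) (degen V 1 0)" "lin_on (lev V 1) (lev V 2) (degen V 1 1)"
    "lin_on (lev V 0) (lev V 1) (degen V 0 0)"
    using degen_lin[OF V, of _ 1] degen_lin[OF V, of _ 0] by (simp_all add: numeral_2_eq_2)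
  show "face V 1 0 (face V 2 1 X) = face V 1 0 (face V 2 0 X)"
    "face V 1 0 (face V 2 2 X) = face V 1 1 (face V 2 0 X)"
    "face V 1 1 (face V 2 2 X) = face V 1 1 (face V 2 1 X)" if "X \<in> lev V 2" for X
    using that face_face[OF V, of 0 1 0 X] face_face[OF V, of 0 2 0 X] face_face[OF V, of 1 2 0 X]
    by (simp_all add: numeral_2_eq_2)
  show "degen V 1 1 (degen V 0 0 z) = degen V 1 0 (degen V 0 0 z)"
    "face V 1 0 (degen V 0 0 z) = z" "face V 1 1 (degen V 0 0 z) = z" if "z \<in> lev V 0" for z
    using that degen_degen[OF V, of 0 0 0 z] face_degen_same[OF V, of 0 0 z] by simp_all
  show "face V 2 0 (degen V 1 0 y) = y" "face V 2 1 (degen V 1 0 y) = y"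
    "face V 2 2 (degen V 1 0 y) = degen V 0 0 (face V 1 1 y)"
    "face V 2 0 (degen V 1 1 y) = degen V 0 0 (face V 1 0 y)"
    "face V 2 1 (degen V 1 1 y) = y" "face V 2 2 (degen V 1 1 y) = y" if "y \<in> lev V 1" for y
    using that face_degen_same[OF V, of 0 1 y] face_degen_same[OF V, of 1 1 y]
      face_degen_less[OF V, of 0 1 0 y] face_degen_greater[OF V, of 0 2 0 y]
    by (simp_all add: numeral_2_eq_2)
qed

lemma horn_faces_eqI:
  assumes "vs_groupoid n V" "n \<le> m" "k \<le> Suc m" "x \<in> lev V (Suc m)" "y \<in> lev V (Suc m)"
    and eq: "\<And>i. i \<le> Suc m \<Longrightarrow> i \<noteq> k \<Longrightarrow> face V (Suc m) i x = face V (Suc m) i y"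
  shows "x = y"
proof -
  have "bij_betw (horn_proj V (Suc m) k) (lev V (Suc m)) (horn V (Suc m) k)"
    using assms(1-3) by (simp add: vs_groupoid_def)
  then have "inj_on (horn_proj V (Suc m) k) (lev V (Suc m))" by (rule bij_betw_imp_inj_on)
  moreover have "horn_proj V (Suc m) k x = horn_proj V (Suc m) k y"
    unfolding horn_proj_def by (rule restrict_ext) (use eq in auto)
  ultimately show ?thesis using assms(4,5) by (rule inj_onD)
qed

text \<open>Subtracting \<open>s\<^sub>2 d\<^sub>3\<close>, then \<open>s\<^sub>1 d\<^sub>2\<close>, then \<open>s\<^sub>0 d\<^sub>1\<close> makes the faces 3, 2, 1 vanish one after the other; in a
  2-groupoid the remainder is zero because it fills the same horn as 0.\<close>

lemma level3_degenerate:
  assumes G: "vs_groupoid 2 V" and x: "x \<in> lev V 3"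
  obtains a b c where "a \<in> lev V 2" "b \<in> lev V 2" "c \<in> lev V 2"
    "x = degen V 2 2 a + degen V 2 1 b + degen V 2 0 c"
proof -
  have V: "simplicial_vs V" using G by (simp add: vs_groupoid_def)
  have sub: "subspace (lev V 3)" by (rule lev_subspace[OF V])
  have fl: "face V 3 i y \<in> lev V 2" if "i \<le> 3" "y \<in> lev V 3" for i y
    using face_lev[OF V, of i 2 y] that by (simp add: eval_nat_numeral)
  have dl: "degen V 2 i y \<in> lev V 3" if "i \<le> 2" "y \<in> lev V 2" for i y
    using degen_lev[OF V, of i 2 y] that by (simp add: eval_nat_numeral)
  have fd: "face V 3 i (y - z) = face V 3 i y - face V 3 i z"
    if "i \<le> 3" "y \<in> lev V 3" "z \<in> lev V 3" for i y z
    using face_diff[OF V, of i 2 y z] that by (simp add: eval_nat_numeral)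
  have same: "face V 3 i (degen V 2 i y) = y" "face V 3 (Suc i) (degen V 2 i y) = y"
    if "i \<le> 2" "y \<in> lev V 2" for i y
    using face_degen_same[OF V, of i 2 y] that by (simp_all add: eval_nat_numeral)
  have vanish: "face V 3 i (degen V 2 j y) = 0"
    if "y \<in> lev V 2" "Suc j < i" "i \<le> 3" "face V 2 (i - 1) y = 0" for i j y
    using face_degen_vanishes[OF V, of j 2 y i] that by (simp add: eval_nat_numeral)
  have ff: "face V 2 i (face V 3 j y) = face V 2 (j - 1) (face V 3 i y)"
    if "i < j" "j \<le> 3" "y \<in> lev V 3" for i j y
    using face_face[OF V, of i j 1 y] that by (simp add: eval_nat_numeral)
  have z: "face V 2 i 0 = 0" if "i \<le> 2" for i
    using lin_on_zero[OF face_lin[OF V, of i 1] lev_subspace[OF V]] that by (simp add: eval_nat_numeral)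
  define a where "a = face V 3 3 x"
  define y where "y = x - degen V 2 2 a"
  define b where "b = face V 3 2 y"
  define y' where "y' = y - degen V 2 1 b"
  define c where "c = face V 3 1 y'"
  define y'' where "y'' = y' - degen V 2 0 c"
  have a: "a \<in> lev V 2" "degen V 2 2 a \<in> lev V 3" using fl dl x by (simp_all add: a_def)
  have y: "y \<in> lev V 3" using a x sub by (simp add: y_def subspace_diff)
  have y3: "face V 3 3 y = 0"
    using fd[OF _ x a(2), of 3] same(2)[OF _ a(1), of 2] by (simp add: y_def a_def eval_nat_numeral)
  have b: "b \<in> lev V 2" "degen V 2 1 b \<in> lev V 3" using fl dl y by (simp_all add: b_def)
  have y': "y' \<in> lev V 3" using b y sub by (simp add: y'_def subspace_diff)
  have "face V 2 2 b = 0" using ff[of 2 3 y] y y3 z[of 2] by (simp add: b_def)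
  then have y'3: "face V 3 3 y' = 0" "face V 3 2 y' = 0"
    using fd[OF _ y b(2)] y3 vanish[OF b(1), of 1 3] same(2)[OF _ b(1), of 1]
    by (simp_all add: y'_def b_def eval_nat_numeral)
  have c: "c \<in> lev V 2" "degen V 2 0 c \<in> lev V 3" using fl dl y' by (simp_all add: c_def)
  have y'': "y'' \<in> lev V 3" using c y' sub by (simp add: y''_def subspace_diff)
  have "face V 2 1 c = 0" "face V 2 2 c = 0"
    using ff[of 1 2 y'] ff[of 1 3 y'] y' y'3 z[of 1] by (simp_all add: c_def)
  then have "face V 3 3 y'' = 0" "face V 3 2 y'' = 0" "face V 3 1 y'' = 0"
    using fd[OF _ y' c(2)] y'3 vanish[OF c(1), of 0 3] vanish[OF c(1), of 0 2] same(2)[OF _ c(1), of 0]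
    by (simp_all add: y''_def c_def eval_nat_numeral)
  moreover have "face V 3 i 0 = 0" if "i \<le> 3" for i
    using lin_on_zero[OF face_lin[OF V, of i 2] lev_subspace[OF V]] that by (simp add: eval_nat_numeral)
  ultimately have "face V 3 i y'' = face V 3 i 0" if "i \<le> 3" "i \<noteq> 0" for i
  proof -
    have "i = 1 \<or> i = 2 \<or> i = 3" using that by auto
    then show ?thesis using \<open>face V 3 3 y'' = 0\<close> \<open>face V 3 2 y'' = 0\<close> \<open>face V 3 1 y'' = 0\<close>
        \<open>\<And>i. i \<le> 3 \<Longrightarrow> face V 3 i 0 = 0\<close> by (elim disjE) simp_all
  qed
  then have "y'' = 0"
    using horn_faces_eqI[OF G, of 2 0 y'' 0] y'' subspace_0[OF sub] by (simp add: eval_nat_numeral)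
  then have "x = degen V 2 2 a + degen V 2 1 b + degen V 2 0 c"
    by (simp add: y''_def y'_def y_def algebra_simps)
  with a b c show thesis using that by blast
qed

definition face_relation :: "'a::real_vector simp_vs \<Rightarrow> ('a \<Rightarrow> real) \<Rightarrow> ('a \<Rightarrow> real) \<Rightarrow> ('a \<Rightarrow> real) \<Rightarrow> ('a \<Rightarrow> real) \<Rightarrow> bool" where
  "face_relation V p q r s \<longleftrightarrow> (\<forall>v\<in>lev V 3.
     p (face V 3 0 v) - q (face V 3 1 v) + r (face V 3 2 v) - s (face V 3 3 v) = 0)"

lemma face_relation_iff:
  assumes G: "vs_groupoid 2 V" and p: "lin_on (lev V 2) UNIV p" and q: "lin_on (lev V 2) UNIV q"
    and r: "lin_on (lev V 2) UNIV r" and s: "lin_on (lev V 2) (UNIV :: real set) s"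
  shows "face_relation V p q r s \<longleftrightarrow> two_truncation.degenerate_relations (lev V 2)
    (face V 2 0) (face V 2 1) (face V 2 2) (degen V 1 0) (degen V 1 1) p q r s"
proof -
  have V: "simplicial_vs V" using G by (simp add: vs_groupoid_def)
  interpret T: two_truncation "lev V 0" "lev V 1" "lev V 2" "face V 1 0" "face V 1 1"
    "face V 2 0" "face V 2 1" "face V 2 2" "degen V 0 0" "degen V 1 0" "degen V 1 1"
    by (rule two_truncation_simplicial[OF V])
  define F where "F v = p (face V 3 0 v) - q (face V 3 1 v) + r (face V 3 2 v) - s (face V 3 3 v)" for v
  have fl: "lin_on (lev V 3) (lev V 2) (face V 3 i)" if "i \<le> 3" for i
    using face_lin[OF V, of i 2] that by (simp add: eval_nat_numeral)
  have dl: "degen V 2 i y \<in> lev V 3" if "i \<le> 2" "y \<in> lev V 2" for i y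
    using degen_lev[OF V, of i 2 y] that by (simp add: eval_nat_numeral)
  have sub: "subspace (lev V 3)" by (rule lev_subspace[OF V])
  have Fadd: "F (x + y) = F x + F y" if "x \<in> lev V 3" "y \<in> lev V 3" for x y
    using that lin_on_add[OF lin_on_comp[OF fl p]] lin_on_add[OF lin_on_comp[OF fl q]]
      lin_on_add[OF lin_on_comp[OF fl r]] lin_on_add[OF lin_on_comp[OF fl s]]
    by (simp add: F_def)
  have same: "face V 3 i (degen V 2 j y) = y" if "j \<le> 2" "i = j \<or> i = Suc j" "y \<in> lev V 2" for i j y
    using face_degen_same[OF V, of j 2 y i] that by (simp add: eval_nat_numeral)
  have less: "face V 3 i (degen V 2 j y) = degen V 1 (j - 1) (face V 2 i y)"
    if "i < j" "j \<le> 2" "y \<in> lev V 2" for i j y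
    using face_degen_less[OF V, of i j 1 y] that by (simp add: eval_nat_numeral)
  have greater: "face V 3 i (degen V 2 j y) = degen V 1 j (face V 2 (i - 1) y)"
    if "Suc j < i" "i \<le> 3" "y \<in> lev V 2" for i j y
    using face_degen_greater[OF V, of j i 1 y] that by (simp add: eval_nat_numeral)
  have F: "F (degen V 2 0 X) = p X - q X + r (degen V 1 0 (face V 2 1 X)) - s (degen V 1 0 (face V 2 2 X))"
    "F (degen V 2 1 X) = p (degen V 1 0 (face V 2 0 X)) - q X + r X - s (degen V 1 1 (face V 2 2 X))"
    "F (degen V 2 2 X) = p (degen V 1 1 (face V 2 0 X)) - q (degen V 1 1 (face V 2 1 X)) + r X - s X"
    if X: "X \<in> lev V 2" for X
    using same[of 0 0 X] same[of 0 1 X] same[of 1 1 X] same[of 1 2 X] same[of 2 2 X] same[of 2 3 X]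
      less[of 0 1 X] less[of 0 2 X] less[of 1 2 X] greater[of 0 2 X] greater[of 0 3 X] greater[of 1 3 X] X
    by (simp_all add: F_def)
  have "(\<forall>v\<in>lev V 3. F v = 0) \<longleftrightarrow> (\<forall>X\<in>lev V 2. F (degen V 2 0 X) = 0 \<and> F (degen V 2 1 X) = 0 \<and> F (degen V 2 2 X) = 0)"
  proof (intro iffI ballI)
    fix v assume all: "\<forall>X\<in>lev V 2. F (degen V 2 0 X) = 0 \<and> F (degen V 2 1 X) = 0 \<and> F (degen V 2 2 X) = 0"
      and v: "v \<in> lev V 3"
    obtain a b c where abc: "a \<in> lev V 2" "b \<in> lev V 2" "c \<in> lev V 2"
      "v = degen V 2 2 a + degen V 2 1 b + degen V 2 0 c"
      using level3_degenerate[OF G v] .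
    have "F v = F (degen V 2 2 a) + F (degen V 2 1 b) + F (degen V 2 0 c)"
      unfolding abc(4) using dl abc(1-3) sub by (simp add: Fadd subspace_add)
    then show "F v = 0" using all abc(1-3) by simp
  qed (use dl in auto)
  then show ?thesis
    unfolding face_relation_def T.degenerate_relations_def F_def[symmetric] by (simp add: F del: One_nat_def cong: ball_cong)
qed

lemma simplices_1_iff: "u \<in> simplices m 1 \<longleftrightarrow> (\<exists>a b. u = [a, b] \<and> a \<le> b \<and> b \<le> m)"
  by (auto simp: simplices_def length_Suc_conv)

lemma simplices_2_iff: "u \<in> simplices m 2 \<longleftrightarrow> (\<exists>a b c. u = [a, b, c] \<and> a \<le> b \<and> b \<le> c \<and> c \<le> m)"
  by (auto simp: simplices_def length_Suc_conv eval_nat_numeral)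

lemma simplices_3_iff:
  "u \<in> simplices m 3 \<longleftrightarrow> (\<exists>a b c d. u = [a, b, c, d] \<and> a \<le> b \<and> b \<le> c \<and> c \<le> d \<and> d \<le> m)"
  by (auto simp: simplices_def length_Suc_conv eval_nat_numeral)

lemma Ball_simplices_1:
  "(\<forall>u\<in>simplices m 1. P u) \<longleftrightarrow> (\<forall>a b. a \<le> b \<longrightarrow> b \<le> m \<longrightarrow> P [a, b])"
  unfolding Ball_def simplices_1_iff by blast

lemma Ball_simplices_3:
  "(\<forall>u\<in>simplices m 3. P u) \<longleftrightarrow>
    (\<forall>a b c d. a \<le> b \<longrightarrow> b \<le> c \<longrightarrow> c \<le> d \<longrightarrow> d \<le> m \<longrightarrow> P [a, b, c, d])"
  unfolding Ball_def simplices_3_iff by blast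

text \<open>The sums and quantifiers in the cocycle conditions for \<open>n = 2\<close>, expanded. The functionals in
  \<^const>\<open>face_relation\<close> belong to the faces \<open>d\<^sub>0\<close>, \<open>d\<^sub>1\<close>, \<open>d\<^sub>2\<close>, \<open>d\<^sub>3\<close> of \<open>abcd\<close>, in this order.\<close>

lemma component_family_2_iff:
  "component_family 2 V m \<beta> \<longleftrightarrow>
    (\<forall>a b c. a \<le> b \<longrightarrow> b \<le> c \<longrightarrow> c \<le> m \<longrightarrow> \<beta> [a, b, c] \<in> dual_space (lev V 2)) \<and>
    (\<forall>a b. a \<le> b \<longrightarrow> b \<le> m \<longrightarrow> (\<forall>y\<in>lev V 1. \<beta> [a, a, b] (degen V 1 0 y) = 0 \<and> \<beta> [a, b, b] (degen V 1 1 y) = 0)) \<and>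
    (\<forall>a b c d. a \<le> b \<longrightarrow> b \<le> c \<longrightarrow> c \<le> d \<longrightarrow> d \<le> m \<longrightarrow>
      face_relation V (\<beta> [b, c, d]) (\<beta> [a, c, d]) (\<beta> [a, b, d]) (\<beta> [a, b, c]))"
proof -
  have "(\<forall>u\<in>simplices m 2. \<beta> u \<in> dual_space (lev V 2)) \<longleftrightarrow>
    (\<forall>a b c. a \<le> b \<longrightarrow> b \<le> c \<longrightarrow> c \<le> m \<longrightarrow> \<beta> [a, b, c] \<in> dual_space (lev V 2))"
    by (auto simp: simplices_2_iff)
  moreover have "(\<forall>k j. 2 = Suc k \<longrightarrow> j \<le> k \<longrightarrow> (\<forall>u\<in>simplices m k. \<forall>v\<in>lev V k. \<beta> (sdegen j u) (degen V k j v) = 0)) \<longleftrightarrow>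
    (\<forall>u\<in>simplices m 1. \<forall>y\<in>lev V 1. \<beta> (sdegen 0 u) (degen V 1 0 y) = 0 \<and> \<beta> (sdegen 1 u) (degen V 1 1 y) = 0)"
    (is "?L \<longleftrightarrow> ?R")
  proof
    assume L: ?L
    show ?R using L[rule_format, of 1 0] L[rule_format, of 1 1] by simp
  next
    assume R: ?R
    show ?L
    proof (intro allI impI ballI)
      fix k j u v assume "2 = Suc k" "j \<le> k" and u: "u \<in> simplices m k" and v: "v \<in> lev V k"
      then have "k = 1" "j = 0 \<or> j = 1" by auto
      with R u v show "\<beta> (sdegen j u) (degen V k j v) = 0" by auto
    qed
  qed
  moreover have "\<dots> \<longleftrightarrow> (\<forall>a b. a \<le> b \<longrightarrow> b \<le> m \<longrightarrow>
      (\<forall>y\<in>lev V 1. \<beta> [a, a, b] (degen V 1 0 y) = 0 \<and> \<beta> [a, b, b] (degen V 1 1 y) = 0))"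
    unfolding Ball_simplices_1 by (simp add: sdegen_def)
  moreover have "(\<forall>u\<in>simplices m (Suc 2). \<forall>v\<in>lev V (Suc 2).
        (\<Sum>i\<le>Suc 2. (-1) ^ i * \<beta> (sface i u) (face V (Suc 2) i v)) = 0) \<longleftrightarrow>
    (\<forall>a b c d. a \<le> b \<longrightarrow> b \<le> c \<longrightarrow> c \<le> d \<longrightarrow> d \<le> m \<longrightarrow>
      face_relation V (\<beta> [b, c, d]) (\<beta> [a, c, d]) (\<beta> [a, b, d]) (\<beta> [a, b, c]))"
  proof -
    have "Suc 2 = 3" by simp
    moreover have "(\<Sum>i\<le>3::nat. (-1) ^ i * \<beta> (sface i [a, b, c, d]) (face V 3 i v))
      = \<beta> [b, c, d] (face V 3 0 v) - \<beta> [a, c, d] (face V 3 1 v) + \<beta> [a, b, d] (face V 3 2 v) - \<beta> [a, b, c] (face V 3 3 v)"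
      for a b c d v by (simp add: eval_nat_numeral sface_def)
    ultimately show ?thesis
      unfolding face_relation_def by (simp only: Ball_simplices_3)
  qed
  ultimately show ?thesis unfolding component_family_def by (simp only:)
qed

section \<open>The explicit model\<close>

lemma dual_space_lin: "p \<in> dual_space S \<Longrightarrow> lin_on S UNIV p"
  by (simp add: dual_space_def lin_hom_def)

lemma dual_space_eqI: "p \<in> dual_space S \<Longrightarrow> q \<in> dual_space S \<Longrightarrow> (\<And>X. X \<in> S \<Longrightarrow> p X = q X) \<Longrightarrow> p = q"
  unfolding dual_space_def by (rule lin_hom_eqI)

lemma ext0_dual_space: "subspace S \<Longrightarrow> lin_on S UNIV p \<Longrightarrow> ext0 S p \<in> dual_space S"
  unfolding dual_space_def by (rule ext0_lin_hom)

lemma eq_ext0_iff: "p \<in> dual_space S \<Longrightarrow> p = ext0 S q \<longleftrightarrow> (\<forall>X\<in>S. p X = q X)"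
  by (auto simp: fun_eq_iff ext0_def dual_space_def lin_hom_def)

lemma O0_iff: "p \<in> O0 V \<longleftrightarrow> p \<in> dual_space (lev V 2) \<and> (\<forall>y\<in>lev V 1. p (degen V 1 0 y) = 0)"
  by (auto simp: O0_def Ann2_def)

lemma O1_iff: "p \<in> O1 V \<longleftrightarrow> p \<in> dual_space (lev V 2) \<and> (\<forall>y\<in>lev V 1. p (degen V 1 1 y) = 0)"
  by (auto simp: O1_def Ann2_def)

lemma O01_iff: "p \<in> O01 V \<longleftrightarrow> p \<in> O0 V \<and> p \<in> O1 V"
  by (simp add: O01_def)

lemma O0_kills: "p \<in> O0 V \<Longrightarrow> lin_on (lev V 2) UNIV p \<and> (\<forall>y\<in>lev V 1. p (degen V 1 0 y) = 0)"
  by (simp add: O0_iff dual_space_lin)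

lemma O1_kills: "p \<in> O1 V \<Longrightarrow> lin_on (lev V 2) UNIV p \<and> (\<forall>y\<in>lev V 1. p (degen V 1 1 y) = 0)"
  by (simp add: O1_iff dual_space_lin)

locale two_groupoid =
  fixes V :: "'a::real_vector simp_vs"
  assumes groupoid: "vs_groupoid 2 V"
begin

lemma simplicial: "simplicial_vs V"
  using groupoid by (simp add: vs_groupoid_def)

sublocale two_truncation "lev V 0" "lev V 1" "lev V 2" "face V 1 0" "face V 1 1"
    "face V 2 0" "face V 2 1" "face V 2 2" "degen V 0 0" "degen V 1 0" "degen V 1 1"
  by (rule two_truncation_simplicial[OF simplicial])

lemma gammas: "gamma0 V = g0" "gamma1 V = g1" "gamma2 V = g2"
  by (simp_all add: fun_eq_iff gamma0_def gamma1_def gamma2_def)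

lemma rel_iff:
  "p \<in> dual_space (lev V 2) \<Longrightarrow> q \<in> dual_space (lev V 2) \<Longrightarrow> r \<in> dual_space (lev V 2) \<Longrightarrow>
    s \<in> dual_space (lev V 2) \<Longrightarrow> face_relation V p q r s \<longleftrightarrow> degenerate_relations p q r s"
  by (rule face_relation_iff[OF groupoid]; rule dual_space_lin)

lemma vertex_model: "A \<in> O01 V \<Longrightarrow> face_relation V A A A A"
  using vertex_relations[OF O0_kills O1_kills, of A] by (simp add: rel_iff O01_iff O0_iff)

lemma edge_model:
  assumes A: "A \<in> O01 V" and B: "B \<in> O0 V" and C: "C \<in> O1 V" and D: "D \<in> O01 V"
  shows "face_relation V B B B A \<and> face_relation V C C B B \<and> face_relation V D C C C \<longleftrightarrow>
    (B, C) \<in> dual1_lev V \<and> A = dual1_face1 V (B, C) \<and> D = dual1_face0 V (B, C)"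
proof -
  have ds: "A \<in> dual_space (lev V 2)" "B \<in> dual_space (lev V 2)" "C \<in> dual_space (lev V 2)"
    "D \<in> dual_space (lev V 2)"
    using assms by (simp_all add: O01_iff O0_iff O1_iff)
  have A': "A \<in> O0 V" "A \<in> O1 V" "D \<in> O0 V" "D \<in> O1 V" using A D by (simp_all add: O01_iff)
  show ?thesis
    using edge_iff[OF O0_kills[OF A'(1)] O1_kills[OF A'(2)] O0_kills[OF B] O1_kills[OF C]
        O0_kills[OF A'(3)] O1_kills[OF A'(4)]] B C
    by (auto simp: rel_iff ds dual1_lev_def dual1_face0_def dual1_face1_def eq_ext0_iff gammas)
qed

lemma triangle_model:
  assumes "\<phi>012 \<in> dual_space (lev V 2)" "\<phi>112 \<in> O0 V" "\<phi>122 \<in> O1 V" "\<phi>001 \<in> O0 V"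
    "\<phi>002 \<in> O0 V" "\<phi>022 \<in> O1 V" "\<phi>011 \<in> O1 V"
  defines "\<phi> \<equiv> (\<phi>012, (\<phi>112, \<phi>122), \<phi>001)"
  shows "face_relation V \<phi>012 \<phi>012 \<phi>002 \<phi>001 \<and> face_relation V \<phi>112 \<phi>012 \<phi>012 \<phi>011 \<and> face_relation V \<phi>122 \<phi>022 \<phi>012 \<phi>012
    \<longleftrightarrow> \<phi> \<in> dual2_lev V \<and> (\<phi>002, \<phi>022) = dual2_face1 V \<phi> \<and> (\<phi>001, \<phi>011) = dual2_face2 V \<phi>"
proof -
  have ds: "\<phi>112 \<in> dual_space (lev V 2)" "\<phi>122 \<in> dual_space (lev V 2)" "\<phi>001 \<in> dual_space (lev V 2)"
    "\<phi>002 \<in> dual_space (lev V 2)" "\<phi>022 \<in> dual_space (lev V 2)" "\<phi>011 \<in> dual_space (lev V 2)"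
    using assms by (simp_all add: O0_iff O1_iff)
  have "\<phi> \<in> dual2_lev V \<longleftrightarrow> (\<forall>X\<in>lev V 2. \<phi>012 (g0 X) = \<phi>112 (g1 X) \<and> \<phi>012 (g0 X) = \<phi>122 (g1 X) \<and>
      \<phi>012 (g2 X) = \<phi>001 (g1 X))"
    using assms(1-4) unfolding dual2_lev_def \<phi>_def gammas by auto
  then show ?thesis
    using triangle_iff[OF dual_space_lin[OF assms(1)] O0_kills[OF assms(2)] O1_kills[OF assms(3)]
        O0_kills[OF assms(4)] O0_kills[OF assms(5)] O1_kills[OF assms(6)] O1_kills[OF assms(7)]]
    unfolding \<phi>_def
    by (simp add: rel_iff ds assms(1) dual2_face1_def dual2_face2_def eq_ext0_iff ball_conj_distrib)
qed

lemma core_lin: "lin_on (lev V 2) (lev V 2) g0" "lin_on (lev V 2) (lev V 2) g1" "lin_on (lev V 2) (lev V 2) g2"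
proof -
  have comb: "lin_on S T (\<lambda>X. a X + b X)" "lin_on S T (\<lambda>X. a X - b X)"
    if "subspace T" "lin_on S T a" "lin_on S T b" for S T and a b :: "'a \<Rightarrow> 'a"
    using that by (auto simp: lin_on_def subspace_add subspace_diff algebra_simps)
  note c = lin_on_comp[OF dlin(1) slin(1)] lin_on_comp[OF dlin(1) slin(2)] lin_on_comp[OF dlin(2) slin(1)]
    lin_on_comp[OF dlin(2) slin(2)] lin_on_comp[OF dlin(3) slin(1)] lin_on_comp[OF dlin(3) slin(2)]
    lin_on_comp[OF lin_on_comp[OF lin_on_comp[OF dlin(1) elin(2)] tlin] slin(1)]
  show "lin_on (lev V 2) (lev V 2) g0" "lin_on (lev V 2) (lev V 2) g1" "lin_on (lev V 2) (lev V 2) g2"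
    by (rule comb[OF sub(3)] lin_on_id c)+
qed

lemma ext0_O01:
  assumes p: "lin_on (lev V 2) UNIV p"
  shows "ext0 (lev V 2) (\<lambda>X. p (g0 X)) \<in> O01 V" "ext0 (lev V 2) (\<lambda>X. p (g2 X)) \<in> O01 V"
  using ext0_dual_space[OF sub(3) lin_on_comp[OF core_lin(1) p]]
    ext0_dual_space[OF sub(3) lin_on_comp[OF core_lin(3) p]] functional_core_degenerate[OF p]
  by (simp_all add: O01_iff O0_iff O1_iff ext0_def mems)

lemma dual1_faces_mem:
  assumes "\<eta> \<in> dual1_lev V"
  shows "dual1_face0 V \<eta> \<in> O01 V" "dual1_face1 V \<eta> \<in> O01 V"
proof -
  obtain B C where \<eta>: "\<eta> = (B, C)" by fastforce
  with assms have "lin_on (lev V 2) UNIV B" "lin_on (lev V 2) UNIV C"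
    by (auto simp: dual1_lev_def dest: O0_kills O1_kills)
  then show "dual1_face0 V \<eta> \<in> O01 V" "dual1_face1 V \<eta> \<in> O01 V"
    unfolding \<eta> dual1_face0_def dual1_face1_def gammas prod.case
    using ext0_O01(1)[of C] ext0_O01(2)[of B] by simp_all
qed

text \<open>The last three equations are the simplicial identities between the explicit face maps. They make
  the three vertex components of a point of the model well defined.\<close>

lemma dual2_faces:
  assumes \<phi>: "\<phi> \<in> dual2_lev V"
  shows "dual2_face0 \<phi> \<in> dual1_lev V" "dual2_face1 V \<phi> \<in> dual1_lev V" "dual2_face2 V \<phi> \<in> dual1_lev V"
    and "dual1_face1 V (dual2_face2 V \<phi>) = dual1_face1 V (dual2_face1 V \<phi>)"
    and "dual1_face0 V (dual2_face2 V \<phi>) = dual1_face1 V (dual2_face0 \<phi>)"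
    and "dual1_face0 V (dual2_face0 \<phi>) = dual1_face0 V (dual2_face1 V \<phi>)"
proof -
  obtain \<phi>012 \<phi>112 \<phi>122 \<phi>001 where \<phi>_eq: "\<phi> = (\<phi>012, (\<phi>112, \<phi>122), \<phi>001)" by (metis prod.collapse)
  define \<phi>002 \<phi>022 \<phi>011 where "\<phi>002 = fst (dual2_face1 V \<phi>)" and "\<phi>022 = snd (dual2_face1 V \<phi>)"
    and "\<phi>011 = snd (dual2_face2 V \<phi>)"
  have mem: "\<phi>012 \<in> dual_space (lev V 2)" "\<phi>112 \<in> O0 V" "\<phi>122 \<in> O1 V" "\<phi>001 \<in> O0 V"
    using \<phi> by (simp_all add: \<phi>_eq dual2_lev_def)
  have faces: "dual2_face0 \<phi> = (\<phi>112, \<phi>122)" "dual2_face1 V \<phi> = (\<phi>002, \<phi>022)" "dual2_face2 V \<phi> = (\<phi>001, \<phi>011)"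
    by (simp_all add: \<phi>002_def \<phi>022_def \<phi>011_def dual2_face0_def dual2_face2_def \<phi>_eq)
  have c: "\<phi>012 (g0 X) = \<phi>112 (g1 X) \<and> \<phi>012 (g0 X) = \<phi>122 (g1 X) \<and> \<phi>012 (g2 X) = \<phi>001 (g1 X)"
    if "X \<in> lev V 2" for X
    using \<phi> that by (simp add: \<phi>_eq dual2_lev_def gammas)
  have e: "\<phi>002 X = \<phi>012 X - \<phi>012 (degen V 1 0 (face V 2 0 X)) + \<phi>001 (degen V 1 1 (face V 2 2 X))"
    "\<phi>022 X = \<phi>012 X - \<phi>012 (degen V 1 1 (face V 2 2 X)) + \<phi>122 (degen V 1 0 (face V 2 0 X))"
    "\<phi>011 X = \<phi>012 X - \<phi>012 (degen V 1 1 (face V 2 1 X)) + \<phi>112 (degen V 1 1 (face V 2 0 X))"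
    if "X \<in> lev V 2" for X
    using that by (simp_all add: \<phi>002_def \<phi>022_def \<phi>011_def \<phi>_eq dual2_face1_def dual2_face2_def ext0_def)
  have out: "\<phi>002 X = 0" "\<phi>022 X = 0" "\<phi>011 X = 0" if "X \<notin> lev V 2" for X
    using that by (simp_all add: \<phi>002_def \<phi>022_def \<phi>011_def \<phi>_eq dual2_face1_def dual2_face2_def ext0_def)
  have c': "\<phi>112 (g1 X) = \<phi>122 (g1 X)" if "X \<in> lev V 2" for X
    using c[OF that] by simp
  note T = triangle_faces[OF dual_space_lin[OF mem(1)] O0_kills[OF mem(2)] O1_kills[OF mem(3)]
      O0_kills[OF mem(4)] c e]
  have O: "\<phi>002 \<in> O0 V" "\<phi>022 \<in> O1 V" "\<phi>011 \<in> O1 V"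
    using T(1-3) out by (simp_all add: O0_iff O1_iff dual_space_def lin_hom_def)
  show "dual2_face0 \<phi> \<in> dual1_lev V" "dual2_face1 V \<phi> \<in> dual1_lev V" "dual2_face2 V \<phi> \<in> dual1_lev V"
    using c' T(4,5) O mem unfolding faces by (simp_all add: dual1_lev_def gammas del: One_nat_def)
  show "dual1_face1 V (dual2_face2 V \<phi>) = dual1_face1 V (dual2_face1 V \<phi>)"
    "dual1_face0 V (dual2_face2 V \<phi>) = dual1_face1 V (dual2_face0 \<phi>)"
    "dual1_face0 V (dual2_face0 \<phi>) = dual1_face0 V (dual2_face1 V \<phi>)"
    using T(6-8) unfolding faces by (auto simp: dual1_face0_def dual1_face1_def ext0_def gammas fun_eq_iff)
qed

section \<open>The 2-dual in terms of the model\<close>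

context
  fixes f m
  assumes f: "f \<in> lev (ndual 2 V) m"
begin

abbreviation c where "c \<equiv> component 2 V f"

lemma components:
  "a \<le> b \<Longrightarrow> b \<le> d \<Longrightarrow> d \<le> m \<Longrightarrow> c [a, b, d] \<in> dual_space (lev V 2)"
  "a \<le> b \<Longrightarrow> b \<le> m \<Longrightarrow> c [a, a, b] \<in> O0 V"
  "a \<le> b \<Longrightarrow> b \<le> m \<Longrightarrow> c [a, b, b] \<in> O1 V"
  "a \<le> m \<Longrightarrow> c [a, a, a] \<in> O01 V"
  "a \<le> b \<Longrightarrow> b \<le> d \<Longrightarrow> d \<le> e \<Longrightarrow> e \<le> m \<Longrightarrow> face_relation V (c [b, d, e]) (c [a, d, e]) (c [a, b, e]) (c [a, b, d])"
  using component_family_component[OF simplicial f] unfolding component_family_2_iff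
  by (simp_all add: O01_iff O0_iff O1_iff)

text \<open>The relations at \<open>iiij\<close>, \<open>iijj\<close> and \<open>ijjj\<close>.\<close>

lemma edge_components:
  assumes "i \<le> j" "j \<le> m"
  shows "(c [i, i, j], c [i, j, j]) \<in> dual1_lev V"
    and "c [i, i, i] = dual1_face1 V (c [i, i, j], c [i, j, j])"
    and "c [j, j, j] = dual1_face0 V (c [i, i, j], c [i, j, j])"
  using edge_model[OF components(4)[of i] components(2,3)[OF assms] components(4)[of j]] assms
    components(5)[of i i i j] components(5)[of i i j j] components(5)[of i j j j]
  by simp_all

text \<open>The relations at \<open>iijk\<close>, \<open>ijjk\<close> and \<open>ijkk\<close>.\<close>

lemma triangle_components:
  assumes "i \<le> j" "j \<le> k" "k \<le> m"
  defines "\<phi> \<equiv> (c [i, j, k], (c [j, j, k], c [j, k, k]), c [i, i, j])"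
  shows "\<phi> \<in> dual2_lev V"
    and "(c [i, i, k], c [i, k, k]) = dual2_face1 V \<phi>"
    and "(c [i, i, j], c [i, j, j]) = dual2_face2 V \<phi>"
proof -
  have le: "i \<le> k" "j \<le> m" using assms by auto
  note M = triangle_model[OF components(1)[OF assms(1-3)] components(2,3)[OF assms(2,3)]
      components(2)[OF assms(1) le(2)] components(2)[OF le(1) assms(3)] components(3)[OF le(1) assms(3)]
      components(3)[OF assms(1) le(2)], folded \<phi>_def]
  have "face_relation V (c [i, j, k]) (c [i, j, k]) (c [i, i, k]) (c [i, i, j]) \<and>
      face_relation V (c [j, j, k]) (c [i, j, k]) (c [i, j, k]) (c [i, j, j]) \<and>
      face_relation V (c [j, k, k]) (c [i, k, k]) (c [i, j, k]) (c [i, j, k])"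
    using components(5)[of i i j k] components(5)[of i j j k] components(5)[of i j k k] assms(1-3) le by simp
  from iffD1[OF M this] show "\<phi> \<in> dual2_lev V" "(c [i, i, k], c [i, k, k]) = dual2_face1 V \<phi>"
    "(c [i, i, j], c [i, j, j]) = dual2_face2 V \<phi>" by blast+
qed

end

lemma ndual2_eqI:
  assumes "f \<in> lev (ndual 2 V) m" "g \<in> lev (ndual 2 V) m"
    and "\<And>a b d. a \<le> b \<Longrightarrow> b \<le> d \<Longrightarrow> d \<le> m \<Longrightarrow> component 2 V f [a, b, d] = component 2 V g [a, b, d]"
  shows "f = g"
  by (rule ndual_eqI[OF simplicial assms(1,2)]) (auto simp: simplices_2_iff assms(3))

lemma ident0_inj: "inj_on (ident0 V) (lev (ndual 2 V) 0)"
  by (rule inj_onI, rule ndual2_eqI) (auto simp: ident0_def)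

lemma ident1_inj: "inj_on (ident1 V) (lev (ndual 2 V) 1)"
proof (rule inj_onI)
  fix f g assume f: "f \<in> lev (ndual 2 V) 1" and g: "g \<in> lev (ndual 2 V) 1" and eq: "ident1 V f = ident1 V g"
  then have "component 2 V f [0, 0, 1] = component 2 V g [0, 0, 1]"
    "component 2 V f [0, 1, 1] = component 2 V g [0, 1, 1]" by (simp_all add: ident1_def)
  moreover from this have "component 2 V f [0, 0, 0] = component 2 V g [0, 0, 0]"
    "component 2 V f [1, 1, 1] = component 2 V g [1, 1, 1]"
    using edge_components(2,3)[OF f, of 0 1] edge_components(2,3)[OF g, of 0 1] by simp_all
  ultimately show "f = g"
    by (intro ndual2_eqI[OF f g]) (auto simp: le_Suc_eq)
qed

lemma ident2_inj: "inj_on (ident2 V) (lev (ndual 2 V) 2)"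
proof (rule inj_onI)
  fix f g assume f: "f \<in> lev (ndual 2 V) 2" and g: "g \<in> lev (ndual 2 V) 2" and eq: "ident2 V f = ident2 V g"
  then have 1: "component 2 V f [0, 1, 2] = component 2 V g [0, 1, 2]"
    "component 2 V f [1, 1, 2] = component 2 V g [1, 1, 2]"
    "component 2 V f [1, 2, 2] = component 2 V g [1, 2, 2]"
    "component 2 V f [0, 0, 1] = component 2 V g [0, 0, 1]"
    by (simp_all add: ident2_def)
  then have 2: "component 2 V f [0, 0, 2] = component 2 V g [0, 0, 2]"
    "component 2 V f [0, 2, 2] = component 2 V g [0, 2, 2]"
    "component 2 V f [0, 1, 1] = component 2 V g [0, 1, 1]"
    using triangle_components(2,3)[OF f, of 0 1 2] triangle_components(2,3)[OF g, of 0 1 2]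
    by (simp_all del: One_nat_def) (metis prod.inject)+
  have 3: "component 2 V f [0, 0, 0] = component 2 V g [0, 0, 0]"
    "component 2 V f [1, 1, 1] = component 2 V g [1, 1, 1]"
    "component 2 V f [2, 2, 2] = component 2 V g [2, 2, 2]"
    using edge_components(2,3)[OF f, of 0 1] edge_components(2,3)[OF g, of 0 1]
      edge_components(3)[OF f, of 1 2] edge_components(3)[OF g, of 1 2] 1 2
    by (simp_all del: One_nat_def)
  show "f = g"
  proof (rule ndual2_eqI[OF f g])
    fix a b d :: nat assume "a \<le> b" "b \<le> d" "d \<le> 2"
    moreover from this have "a = 0 \<or> a = 1 \<or> a = 2" "b = 0 \<or> b = 1 \<or> b = 2" "d = 0 \<or> d = 1 \<or> d = 2"
      by auto
    ultimately show "component 2 V f [a, b, d] = component 2 V g [a, b, d]"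
      using 1 2 3 by (elim disjE) (simp_all del: One_nat_def)
  qed
qed

lemma ident0_surj:
  assumes "\<epsilon> \<in> O01 V"
  shows "\<exists>f\<in>lev (ndual 2 V) 0. ident0 V f = \<epsilon>"
proof -
  have "component_family 2 V 0 (\<lambda>_. \<epsilon>)"
    using assms vertex_model[OF assms] by (simp add: component_family_2_iff O01_iff O0_iff O1_iff)
  then obtain f where f: "f \<in> lev (ndual 2 V) 0" "\<And>u. u \<in> simplices 0 2 \<Longrightarrow> component 2 V f u = \<epsilon>"
    using ndual_exists[OF simplicial] by blast
  then have "ident0 V f = \<epsilon>" by (simp add: ident0_def simplices_2_iff)
  with f show ?thesis by blast
qed

lemma ident1_surj:
  assumes \<eta>: "\<eta> \<in> dual1_lev V"
  shows "\<exists>f\<in>lev (ndual 2 V) 1. ident1 V f = \<eta>"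
proof -
  obtain B C where BC: "\<eta> = (B, C)" by fastforce
  define A D where "A = dual1_face1 V \<eta>" and "D = dual1_face0 V \<eta>"
  have mem: "A \<in> O01 V" "B \<in> O0 V" "C \<in> O1 V" "D \<in> O01 V"
    using dual1_faces_mem[OF \<eta>] \<eta> by (simp_all add: A_def D_def BC dual1_lev_def)
  have rel: "face_relation V B B B A" "face_relation V C C B B" "face_relation V D C C C"
    using edge_model[OF mem] \<eta> by (simp_all add: A_def D_def BC)
  define \<beta> where "\<beta> = (\<lambda>u. the (map_of [([0, 0, 0], A), ([0, 0, 1], B), ([0, 1, 1], C), ([1, 1, 1 :: nat], D)] u))"
  have "component_family 2 V 1 \<beta>"
    unfolding component_family_2_iff using mem rel vertex_model[OF mem(1)] vertex_model[OF mem(4)]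
    by (auto simp: \<beta>_def le_Suc_eq O01_iff O0_iff O1_iff)
  then obtain f where f: "f \<in> lev (ndual 2 V) 1" "\<And>u. u \<in> simplices 1 2 \<Longrightarrow> component 2 V f u = \<beta> u"
    using ndual_exists[OF simplicial] by blast
  then have "ident1 V f = \<eta>" by (simp add: ident1_def simplices_2_iff BC \<beta>_def)
  with f show ?thesis by blast
qed

text \<open>All ten components over a triangle are reconstructed from the four given ones. Of the fifteen
  relations, three belong to the triangle, three to each edge and one to each vertex.\<close>

lemma ident2_surj:
  assumes \<phi>: "\<phi> \<in> dual2_lev V"
  shows "\<exists>f\<in>lev (ndual 2 V) 2. ident2 V f = \<phi>"
proof -
  obtain \<phi>012 \<phi>112 \<phi>122 \<phi>001 where \<phi>_eq: "\<phi> = (\<phi>012, (\<phi>112, \<phi>122), \<phi>001)" by (metis prod.collapse)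
  obtain \<phi>002 \<phi>022 where face1: "dual2_face1 V \<phi> = (\<phi>002, \<phi>022)" by fastforce
  obtain \<phi>011 where face2: "dual2_face2 V \<phi> = (\<phi>001, \<phi>011)" by (simp add: dual2_face2_def \<phi>_eq)
  have face0: "dual2_face0 \<phi> = (\<phi>112, \<phi>122)" by (simp add: dual2_face0_def \<phi>_eq)
  note F = dual2_faces[OF \<phi>, unfolded face0 face1 face2]
  define \<phi>000 \<phi>111 \<phi>222 where "\<phi>000 = dual1_face1 V (\<phi>001, \<phi>011)"
    and "\<phi>111 = dual1_face0 V (\<phi>001, \<phi>011)" and "\<phi>222 = dual1_face0 V (\<phi>112, \<phi>122)"
  have mem: "\<phi>012 \<in> dual_space (lev V 2)" "\<phi>112 \<in> O0 V" "\<phi>122 \<in> O1 V" "\<phi>001 \<in> O0 V"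
    "\<phi>002 \<in> O0 V" "\<phi>022 \<in> O1 V" "\<phi>011 \<in> O1 V" "\<phi>000 \<in> O01 V" "\<phi>111 \<in> O01 V" "\<phi>222 \<in> O01 V"
    using \<phi> F(1-3) dual1_faces_mem[OF F(3)] dual1_faces_mem[OF F(1)]
    by (simp_all add: \<phi>_eq dual2_lev_def dual1_lev_def \<phi>000_def \<phi>111_def \<phi>222_def)
  have tri: "face_relation V \<phi>012 \<phi>012 \<phi>002 \<phi>001" "face_relation V \<phi>112 \<phi>012 \<phi>012 \<phi>011"
    "face_relation V \<phi>122 \<phi>022 \<phi>012 \<phi>012"
    using triangle_model[OF mem(1-7)] \<phi> face1 face2 by (simp_all add: \<phi>_eq)
  have e01: "face_relation V \<phi>001 \<phi>001 \<phi>001 \<phi>000" "face_relation V \<phi>011 \<phi>011 \<phi>001 \<phi>001"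
    "face_relation V \<phi>111 \<phi>011 \<phi>011 \<phi>011"
    using edge_model[OF mem(8,4,7,9)] F(3) by (simp_all add: \<phi>000_def \<phi>111_def)
  have e02: "face_relation V \<phi>002 \<phi>002 \<phi>002 \<phi>000" "face_relation V \<phi>022 \<phi>022 \<phi>002 \<phi>002"
    "face_relation V \<phi>222 \<phi>022 \<phi>022 \<phi>022"
    using edge_model[OF mem(8,5,6,10)] F(2,4,6) by (simp_all add: \<phi>000_def \<phi>222_def)
  have e12: "face_relation V \<phi>112 \<phi>112 \<phi>112 \<phi>111" "face_relation V \<phi>122 \<phi>122 \<phi>112 \<phi>112"
    "face_relation V \<phi>222 \<phi>122 \<phi>122 \<phi>122"
    using edge_model[OF mem(9,2,3,10)] F(1,5) by (simp_all add: \<phi>111_def \<phi>222_def)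
  note v = vertex_model[OF mem(8)] vertex_model[OF mem(9)] vertex_model[OF mem(10)]
  define \<beta> where "\<beta> = (\<lambda>u. the (map_of [([0, 0, 0], \<phi>000), ([0, 0, 1], \<phi>001), ([0, 0, 2], \<phi>002),
    ([0, 1, 1], \<phi>011), ([0, 1, 2], \<phi>012), ([0, 2, 2], \<phi>022), ([1, 1, 1], \<phi>111), ([1, 1, 2], \<phi>112),
    ([1, 2, 2], \<phi>122), ([2, 2, 2 :: nat], \<phi>222)] u))"
  have \<beta>: "\<beta> [0, 0, 0] = \<phi>000" "\<beta> [0, 0, 1] = \<phi>001" "\<beta> [0, 0, 2] = \<phi>002" "\<beta> [0, 1, 1] = \<phi>011"
    "\<beta> [0, 1, 2] = \<phi>012" "\<beta> [0, 2, 2] = \<phi>022" "\<beta> [1, 1, 1] = \<phi>111" "\<beta> [1, 1, 2] = \<phi>112"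
    "\<beta> [1, 2, 2] = \<phi>122" "\<beta> [2, 2, 2] = \<phi>222"
    by (simp_all add: \<beta>_def)
  have cases: "a = 0 \<or> a = 1 \<or> a = 2" if "a \<le> 2" for a :: nat using that by auto
  have "component_family 2 V 2 \<beta>"
    unfolding component_family_2_iff
  proof (intro conjI allI impI)
    fix a b d :: nat assume "a \<le> b" "b \<le> d" "d \<le> 2"
    moreover from this have "a \<le> 2" "b \<le> 2" by simp_all
    ultimately show "\<beta> [a, b, d] \<in> dual_space (lev V 2)"
      using cases[OF \<open>a \<le> 2\<close>] cases[OF \<open>b \<le> 2\<close>] cases[OF \<open>d \<le> 2\<close>] mem
      by (elim disjE) (simp_all add: \<beta> O01_iff O0_iff O1_iff del: One_nat_def)
  next
    fix a b :: nat assume "a \<le> b" "b \<le> 2"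
    moreover from this have "a \<le> 2" by simp
    ultimately show "\<forall>y\<in>lev V 1. \<beta> [a, a, b] (degen V 1 0 y) = 0 \<and> \<beta> [a, b, b] (degen V 1 1 y) = 0"
      using cases[OF \<open>a \<le> 2\<close>] cases[OF \<open>b \<le> 2\<close>] mem
      by (elim disjE) (simp_all add: \<beta> O01_iff O0_iff O1_iff del: One_nat_def)
  next
    fix a b d e :: nat assume "a \<le> b" "b \<le> d" "d \<le> e" "e \<le> 2"
    moreover from this have "a \<le> 2" "b \<le> 2" "d \<le> 2" by simp_all
    ultimately show "face_relation V (\<beta> [b, d, e]) (\<beta> [a, d, e]) (\<beta> [a, b, e]) (\<beta> [a, b, d])"
      using cases[OF \<open>a \<le> 2\<close>] cases[OF \<open>b \<le> 2\<close>] cases[OF \<open>d \<le> 2\<close>] cases[OF \<open>e \<le> 2\<close>]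
        tri e01 e02 e12 v
      by (elim disjE) (simp_all add: \<beta> del: One_nat_def)
  qed
  then obtain f where f: "f \<in> lev (ndual 2 V) 2" "\<And>u. u \<in> simplices 2 2 \<Longrightarrow> component 2 V f u = \<beta> u"
    using ndual_exists[OF simplicial] by blast
  then have "ident2 V f = \<phi>" by (simp add: ident2_def simplices_2_iff \<phi>_eq \<beta> del: One_nat_def)
  with f show ?thesis by blast
qed

lemma component_linear:
  "component 2 V (f + g) u = component 2 V f u + component 2 V g u"
  "component 2 V (r *\<^sub>R f) u = r *\<^sub>R component 2 V f u"
  by (auto simp: component_def ext0_def fun_eq_iff scaleR_fun_def)

lemma lin_isoI:
  assumes "lin_on S T f" "inj_on f S" "\<And>y. y \<in> T \<Longrightarrow> \<exists>x\<in>S. f x = y"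
  shows "lin_iso S T f"
  unfolding lin_iso_def bij_betw_def using assms lin_on_mem[OF assms(1)] by blast

lemma ident_iso:
  "lin_iso (lev (ndual 2 V) 0) (O01 V) (ident0 V)"
  "lin_iso (lev (ndual 2 V) 1) (dual1_lev V) (ident1 V)"
  "lin_iso (lev (ndual 2 V) 2) (dual2_lev V) (ident2 V)"
proof -
  have m0: "ident0 V f \<in> O01 V" if "f \<in> lev (ndual 2 V) 0" for f
    using components(4)[OF that, of 0] by (simp add: ident0_def)
  have m1: "ident1 V f \<in> dual1_lev V" if "f \<in> lev (ndual 2 V) 1" for f
    using edge_components(1)[OF that, of 0 1] by (simp add: ident1_def)
  have m2: "ident2 V f \<in> dual2_lev V" if "f \<in> lev (ndual 2 V) 2" for f
    using triangle_components(1)[OF that, of 0 1 2] by (simp add: ident2_def)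
  show "lin_iso (lev (ndual 2 V) 0) (O01 V) (ident0 V)"
    by (rule lin_isoI[OF _ ident0_inj ident0_surj])
      (simp_all add: lin_on_def m0, simp_all add: ident0_def component_linear)
  show "lin_iso (lev (ndual 2 V) 1) (dual1_lev V) (ident1 V)"
    by (rule lin_isoI[OF _ ident1_inj ident1_surj])
      (simp_all add: lin_on_def m1, simp_all add: ident1_def component_linear)
  show "lin_iso (lev (ndual 2 V) 2) (dual2_lev V) (ident2 V)"
    by (rule lin_isoI[OF _ ident2_inj ident2_surj])
      (simp_all add: lin_on_def m2, simp_all add: ident2_def component_linear)
qed

end

section \<open>Multiplications and the pairing\<close>

lemma gmult_filler:
  assumes W: "vs_groupoid n W" and k: "k \<le> Suc n" and x: "x \<in> horn W (Suc n) k"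
  obtains v where "v \<in> lev W (Suc n)" "\<And>i. i \<le> Suc n \<Longrightarrow> i \<noteq> k \<Longrightarrow> face W (Suc n) i v = x i"
    "gmult W n k x = face W (Suc n) k v"
proof -
  define v where "v = inv_into (lev W (Suc n)) (horn_proj W (Suc n) k) x"
  have "x \<in> horn_proj W (Suc n) k ` lev W (Suc n)"
    using W k x by (auto simp: vs_groupoid_def)
  then have v: "v \<in> lev W (Suc n)" "horn_proj W (Suc n) k v = x"
    unfolding v_def by (rule inv_into_into, rule f_inv_into_f)
  have "face W (Suc n) i v = x i" if "i \<le> Suc n" "i \<noteq> k" for i
    using fun_cong[OF v(2), of i] that by (simp add: horn_proj_def)
  moreover have "gmult W n k x = face W (Suc n) k v"
    unfolding gmult_def v_def Suc_eq_plus1 ..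
  ultimately show thesis by (rule that[OF v(1)])
qed

text \<open>In a groupoid the filler of a horn is unique. So the product of the horn of \<open>w\<close> is
  \<open>d\<^sub>k w\<close>, and every \<open>X\<close> is \<open>d\<^sub>k\<close> of a degenerate element \<open>w\<close>.\<close>

lemma gmult_surj:
  assumes W: "vs_groupoid n W" and k: "k \<le> Suc n" and X: "X \<in> lev W n"
  obtains x where "x \<in> horn W (Suc n) k" "gmult W n k x = X"
proof -
  have S: "simplicial_vs W" using W by (simp add: vs_groupoid_def)
  define w where "w = degen W n (if k = 0 then 0 else k - 1) X"
  have w: "w \<in> lev W (Suc n)" unfolding w_def by (rule degen_lev[OF S _ X]) (use k in auto)
  have kw: "face W (Suc n) k w = X" unfolding w_def by (rule face_degen_same[OF S _ X]) (use k in auto)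
  let ?x = "horn_proj W (Suc n) k w"
  have x: "?x \<in> horn W (Suc n) k" using horn_proj_image[OF S k] w by blast
  then obtain v where v: "v \<in> lev W (Suc n)" "\<And>i. i \<le> Suc n \<Longrightarrow> i \<noteq> k \<Longrightarrow> face W (Suc n) i v = ?x i"
    "gmult W n k ?x = face W (Suc n) k v"
    using gmult_filler[OF W k] by blast
  have "v = w"
    by (rule horn_faces_eqI[OF W order_refl k v(1) w]) (use v(2) in \<open>simp add: horn_proj_def\<close>)
  with v(3) kw x that show thesis by simp
qed

lemma coface_lists:
  "map (coface 0) [0, 0, 0] = [1, 1, 1]" "map (coface 1) [0, 0, 0] = [0, 0, 0]"
  "map (coface 0) [0, 0, 1] = [1, 1, 2]" "map (coface 0) [0, 1, 1] = [1, 2, 2]"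
  "map (coface 1) [0, 0, 1] = [0, 0, 2]" "map (coface 1) [0, 1, 1] = [0, 2, 2]"
  "map (coface 2) [0, 0, 1] = [0, 0, 1]" "map (coface 2) [0, 1, 1] = [0, 1, 1]"
  "map (coface 0) [0, 1, 2] = [1, 2, 3]" "map (coface 1) [0, 1, 2] = [0, 2, 3]"
  "map (coface 2) [0, 1, 2] = [0, 1, 3]" "map (coface 3) [0, 1, 2] = [0, 1, 2]"
  by (simp_all add: coface_def)

lemma codegen_lists:
  "map (codegen 0) [0, 0, 1] = [0, 0, 0]" "map (codegen 0) [0, 1, 1] = [0, 0, 0]"
  "map (codegen 0) [0, 1, 2] = [0, 0, 1]" "map (codegen 0) [1, 1, 2] = [0, 0, 1]"
  "map (codegen 0) [1, 2, 2] = [0, 1, 1]" "map (codegen 1) [0, 0, 1] = [0, 0, 1]"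
  "map (codegen 1) [0, 1, 2] = [0, 1, 1]" "map (codegen 1) [1, 1, 2] = [1, 1, 1]"
  "map (codegen 1) [1, 2, 2] = [1, 1, 1]"
  by (simp_all add: codegen_def)

context two_groupoid
begin

lemma simplicial_ndual: "simplicial_vs (ndual 2 V)"
  by (rule simplicial_vs_ndual[OF simplicial])

lemma groupoid_ndual: "vs_groupoid 2 (ndual 2 V)"
  by (rule vs_groupoid_ndual[OF simplicial])

lemma component_faces:
  "u \<in> simplices 0 2 \<Longrightarrow> component 2 V (face (ndual 2 V) 1 i f) u = component 2 V f (map (coface i) u)"
  "u \<in> simplices 1 2 \<Longrightarrow> component 2 V (face (ndual 2 V) 2 i f) u = component 2 V f (map (coface i) u)"
  "u \<in> simplices 2 2 \<Longrightarrow> component 2 V (face (ndual 2 V) 3 i f) u = component 2 V f (map (coface i) u)"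
  using component_face[OF simplicial, of u 0 2 i f] component_face[OF simplicial, of u 1 2 i f]
    component_face[OF simplicial, of u 2 2 i f]
  by (simp_all only: One_nat_def[symmetric] Suc_1 eval_nat_numeral(3)[symmetric] numeral_3_eq_3[symmetric]
      Suc_numeral semiring_norm)

lemma component_degens:
  "u \<in> simplices 1 2 \<Longrightarrow> component 2 V (degen (ndual 2 V) 0 0 f) u = component 2 V f (map (codegen 0) u)"
  "j \<le> 1 \<Longrightarrow> u \<in> simplices 2 2 \<Longrightarrow>
    component 2 V (degen (ndual 2 V) 1 j f) u = component 2 V f (map (codegen j) u)"
  using component_degen[OF simplicial, of 0 0 u 2 f] component_degen[OF simplicial, of j 1 u 2 f]
  by (simp_all only: One_nat_def[symmetric] Suc_1 order_refl)

lemma ident_face1: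
  assumes "f \<in> lev (ndual 2 V) 1"
  shows "ident0 V (face (ndual 2 V) 1 0 f) = dual1_face0 V (ident1 V f)"
    and "ident0 V (face (ndual 2 V) 1 1 f) = dual1_face1 V (ident1 V f)"
  using edge_components(2,3)[OF assms, of 0 1]
  by (simp_all add: ident0_def ident1_def component_faces simplices_2_iff coface_lists
      del: One_nat_def list.map)

lemma ident_degen0:
  "ident1 V (degen (ndual 2 V) 0 0 f) = dual0_degen0 (ident0 V f)"
  by (simp add: ident0_def ident1_def dual0_degen0_def component_degens simplices_2_iff codegen_lists
      del: One_nat_def list.map)

lemma ident_face2:
  assumes "f \<in> lev (ndual 2 V) 2"
  shows "ident1 V (face (ndual 2 V) 2 0 f) = dual2_face0 (ident2 V f)"
    and "ident1 V (face (ndual 2 V) 2 1 f) = dual2_face1 V (ident2 V f)"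
    and "ident1 V (face (ndual 2 V) 2 2 f) = dual2_face2 V (ident2 V f)"
  using triangle_components(2,3)[OF assms, of 0 1 2]
  by (simp_all add: ident1_def ident2_def component_faces simplices_2_iff coface_lists dual2_face0_def
      del: One_nat_def list.map)

lemma ident_degen1:
  assumes "f \<in> lev (ndual 2 V) 1"
  shows "ident2 V (degen (ndual 2 V) 1 0 f) = dual1_degen0 V (ident1 V f)"
    and "ident2 V (degen (ndual 2 V) 1 1 f) = dual1_degen1 V (ident1 V f)"
  using edge_components(2,3)[OF assms, of 0 1]
  by (simp_all add: ident1_def ident2_def component_degens simplices_2_iff codegen_lists
      dual1_degen0_def dual1_degen1_def dual0_degen0_def del: One_nat_def list.map)

lemma dual1_face_formulas:
  assumes "(\<eta>001, \<eta>011) \<in> dual1_lev V" and X: "X \<in> lev V 2"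
  shows "dual1_face0 V (\<eta>001, \<eta>011) X = \<eta>011 (gamma0 V X)"
    and "\<eta>011 (gamma0 V X) = \<eta>011 (X - degen V 1 0 (face V 2 1 X) + degen V 1 0 (face V 2 2 X))"
    and "dual1_face1 V (\<eta>001, \<eta>011) X = \<eta>001 (gamma2 V X)"
    and "\<eta>001 (gamma2 V X) = \<eta>001 (X - degen V 1 1 (face V 2 1 X) + degen V 1 1 (face V 2 0 X))"
proof -
  have \<eta>: "\<eta>001 \<in> O0 V" "\<eta>011 \<in> O1 V" using assms(1) by (simp_all add: dual1_lev_def)
  note k = O0_kills[OF \<eta>(1)] O1_kills[OF \<eta>(2)]
  note fn = functional[OF conjunct1[OF k(1)]] functional[OF conjunct1[OF k(2)]]
  show "\<eta>011 (gamma0 V X) = \<eta>011 (X - degen V 1 0 (face V 2 1 X) + degen V 1 0 (face V 2 2 X))"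
    "\<eta>001 (gamma2 V X) = \<eta>001 (X - degen V 1 1 (face V 2 1 X) + degen V 1 1 (face V 2 0 X))"
    unfolding gammas using k X by (simp_all add: mems fn del: One_nat_def)
qed (use X in \<open>simp_all add: dual1_face0_def dual1_face1_def ext0_def\<close>)

text \<open>Evaluating the cocycle identity at \<open>0123\<close> for the filler of \<open>h\<close> at the filler of \<open>x\<close> gives the
  pairing formula, since \<open>d\<^sub>1\<close> of the fillers are the two products. The faces of the product are
  instances of the face identities.\<close>

lemma ndual_multiplication:
  assumes h: "h \<in> horn (ndual 2 V) 3 1"
  defines "\<mu> \<equiv> gmult (ndual 2 V) 2 1 h"
  shows "\<mu> \<in> lev (ndual 2 V) 2"
    and "x \<in> horn V 3 1 \<Longrightarrow> pairing2 V \<mu> (gmult V 2 1 x)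
      = pairing2 V (h 0) (x 0) + pairing2 V (h 2) (x 2) - pairing2 V (h 3) (x 3)"
    and "face (ndual 2 V) 2 0 \<mu> = face (ndual 2 V) 2 0 (h 0)"
    and "face (ndual 2 V) 2 1 \<mu> = face (ndual 2 V) 2 1 (h 2)"
    and "face (ndual 2 V) 2 2 \<mu> = face (ndual 2 V) 2 1 (h 3)"
proof -
  have s3: "Suc 2 = 3" by simp
  obtain F where F: "F \<in> lev (ndual 2 V) 3" "\<And>i. i \<le> 3 \<Longrightarrow> i \<noteq> 1 \<Longrightarrow> face (ndual 2 V) 3 i F = h i"
    "\<mu> = face (ndual 2 V) 3 1 F"
    using gmult_filler[OF groupoid_ndual, of 1 h, unfolded s3] h by (auto simp: \<mu>_def)
  have fl: "face (ndual 2 V) 3 i F \<in> lev (ndual 2 V) 2" if "i \<le> 3" for i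
    using face_lev[OF simplicial_ndual, of i 2 F, unfolded s3] that F(1) .
  show "\<mu> \<in> lev (ndual 2 V) 2" using fl F(3) by simp
  have ff: "face (ndual 2 V) 2 i (face (ndual 2 V) 3 j F) = face (ndual 2 V) 2 (j - 1) (face (ndual 2 V) 3 i F)"
    if "i < j" "j \<le> 3" for i j
    using face_face[OF simplicial_ndual that(1), of 1 F] that(2) F(1) by (simp add: eval_nat_numeral)
  show "face (ndual 2 V) 2 0 \<mu> = face (ndual 2 V) 2 0 (h 0)"
    "face (ndual 2 V) 2 1 \<mu> = face (ndual 2 V) 2 1 (h 2)"
    "face (ndual 2 V) 2 2 \<mu> = face (ndual 2 V) 2 1 (h 3)"
    using ff[of 0 1] ff[of 1 2] ff[of 1 3] F(2)[of 0] F(2)[of 2] F(2)[of 3] by (simp_all add: F(3))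
  assume x: "x \<in> horn V 3 1"
  obtain v where v: "v \<in> lev V 3" "\<And>i. i \<le> 3 \<Longrightarrow> i \<noteq> 1 \<Longrightarrow> face V 3 i v = x i"
    "gmult V 2 1 x = face V 3 1 v"
    using gmult_filler[OF groupoid, of 1 x, unfolded s3] x by auto
  have p: "pairing2 V (face (ndual 2 V) 3 i F) = component 2 V F (map (coface i) [0, 1, 2])" for i
    by (rule ext) (simp add: pairing2_def component_faces simplices_2_iff)
  have "component 2 V F [1, 2, 3] (face V 3 0 v) - component 2 V F [0, 2, 3] (face V 3 1 v)
      + component 2 V F [0, 1, 3] (face V 3 2 v) - component 2 V F [0, 1, 2] (face V 3 3 v) = 0"
    using components(5)[OF F(1), of 0 1 2 3] v(1) by (simp add: face_relation_def)
  then show "pairing2 V \<mu> (gmult V 2 1 x)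
      = pairing2 V (h 0) (x 0) + pairing2 V (h 2) (x 2) - pairing2 V (h 3) (x 3)"
    using p[of 0, unfolded coface_lists] p[of 1, unfolded coface_lists] p[of 2, unfolded coface_lists]
      p[of 3, unfolded coface_lists] v(2)[of 0] v(2)[of 2] v(2)[of 3] F(2)[of 0] F(2)[of 2] F(2)[of 3]
    by (simp add: v(3) F(3) del: One_nat_def)
qed

text \<open>Every element of \<open>V\<^sub>2\<close> is a product, so the values on products determine a functional.\<close>

lemma pairing_determines:
  assumes "f \<in> lev (ndual 2 V) 2" "\<alpha> \<in> dual_space (lev V 2)"
    and "\<And>x. x \<in> horn V 3 1 \<Longrightarrow> \<alpha> (gmult V 2 1 x) = pairing2 V f (gmult V 2 1 x)"
  shows "\<alpha> = component 2 V f [0, 1, 2]"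
proof (rule dual_space_eqI[OF assms(2)])
  show "component 2 V f [0, 1, 2] \<in> dual_space (lev V 2)"
    using components(1)[OF assms(1), of 0 1 2] by simp
  fix X assume "X \<in> lev V 2"
  then obtain x where "x \<in> horn V (Suc 2) 1" "gmult V 2 1 x = X"
    using gmult_surj[OF groupoid, of 1 X] by auto
  then show "\<alpha> X = component 2 V f [0, 1, 2] X"
    using assms(3)[of x] by (simp add: pairing2_def)
qed

lemma ndual2_eqI_faces:
  assumes f: "f \<in> lev (ndual 2 V) 2" and g: "g \<in> lev (ndual 2 V) 2"
    and "component 2 V f [0, 1, 2] = component 2 V g [0, 1, 2]"
    and "face (ndual 2 V) 2 0 f = face (ndual 2 V) 2 0 g" "face (ndual 2 V) 2 2 f = face (ndual 2 V) 2 2 g"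
  shows "f = g"
proof (rule inj_onD[OF ident2_inj _ f g])
  have "dual2_face0 (ident2 V f) = dual2_face0 (ident2 V g)"
    "dual2_face2 V (ident2 V f) = dual2_face2 V (ident2 V g)"
    using assms(4,5) by (simp_all flip: ident_face2[OF f] ident_face2[OF g])
  then show "ident2 V f = ident2 V g"
    using assms(3) by (simp add: ident2_def dual2_face0_def dual2_face2_def)
qed

end

theorem theorem5p8:
  fixes V :: "'a::real_vector simp_vs"
  assumes "vs_groupoid 2 V"
  shows
    "vs_groupoid 2 (ndual 2 V) \<and>
     lin_iso (lev (ndual 2 V) 0) (O01 V) (ident0 V) \<and>
     lin_iso (lev (ndual 2 V) 1) (dual1_lev V) (ident1 V) \<and>
     lin_iso (lev (ndual 2 V) 2) (dual2_lev V) (ident2 V) \<and>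
     (\<forall>f\<in>lev (ndual 2 V) 1.
        ident0 V (face (ndual 2 V) 1 0 f) = dual1_face0 V (ident1 V f) \<and>
        ident0 V (face (ndual 2 V) 1 1 f) = dual1_face1 V (ident1 V f)) \<and>
     (\<forall>f\<in>lev (ndual 2 V) 0.
        ident1 V (degen (ndual 2 V) 0 0 f) = dual0_degen0 (ident0 V f)) \<and>
     (\<forall>f\<in>lev (ndual 2 V) 2.
        ident1 V (face (ndual 2 V) 2 0 f) = dual2_face0 (ident2 V f) \<and>
        ident1 V (face (ndual 2 V) 2 1 f) = dual2_face1 V (ident2 V f) \<and>
        ident1 V (face (ndual 2 V) 2 2 f) = dual2_face2 V (ident2 V f)) \<and>
     (\<forall>f\<in>lev (ndual 2 V) 1.
        ident2 V (degen (ndual 2 V) 1 0 f) = dual1_degen0 V (ident1 V f) \<and>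
        ident2 V (degen (ndual 2 V) 1 1 f) = dual1_degen1 V (ident1 V f)) \<and>
     (\<forall>(\<eta>001, \<eta>011)\<in>dual1_lev V. \<forall>X\<in>lev V 2.
        dual1_face0 V (\<eta>001, \<eta>011) X = \<eta>011 (gamma0 V X) \<and>
        \<eta>011 (gamma0 V X) = \<eta>011 (X - degen V 1 0 (face V 2 1 X) + degen V 1 0 (face V 2 2 X)) \<and>
        dual1_face1 V (\<eta>001, \<eta>011) X = \<eta>001 (gamma2 V X) \<and>
        \<eta>001 (gamma2 V X) = \<eta>001 (X - degen V 1 1 (face V 2 1 X) + degen V 1 1 (face V 2 0 X))) \<and>
     (\<forall>h\<in>horn (ndual 2 V) 3 1.
        gmult (ndual 2 V) 2 1 h \<in> lev (ndual 2 V) 2 \<and>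
        (\<forall>x\<in>horn V 3 1.
           pairing2 V (gmult (ndual 2 V) 2 1 h) (gmult V 2 1 x)
             = pairing2 V (h 0) (x 0) + pairing2 V (h 2) (x 2) - pairing2 V (h 3) (x 3)) \<and>
        (\<forall>\<alpha>\<in>dual_space (lev V 2).
           (\<forall>x\<in>horn V 3 1. \<alpha> (gmult V 2 1 x)
              = pairing2 V (h 0) (x 0) + pairing2 V (h 2) (x 2) - pairing2 V (h 3) (x 3))
           \<longrightarrow> \<alpha> = component 2 V (gmult (ndual 2 V) 2 1 h) [0,1,2]) \<and>
        (\<forall>f\<in>lev (ndual 2 V) 2.
           component 2 V f [0,1,2] = component 2 V (gmult (ndual 2 V) 2 1 h) [0,1,2] \<and>
           face (ndual 2 V) 2 0 f = face (ndual 2 V) 2 0 (h 0) \<and>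
           face (ndual 2 V) 2 1 f = face (ndual 2 V) 2 1 (h 2) \<and>
           face (ndual 2 V) 2 2 f = face (ndual 2 V) 2 1 (h 3)
           \<longleftrightarrow> f = gmult (ndual 2 V) 2 1 h))"
proof -
  interpret two_groupoid V by standard (fact assms)
  have mult: "gmult (ndual 2 V) 2 1 h \<in> lev (ndual 2 V) 2 \<and>
        (\<forall>x\<in>horn V 3 1.
           pairing2 V (gmult (ndual 2 V) 2 1 h) (gmult V 2 1 x)
             = pairing2 V (h 0) (x 0) + pairing2 V (h 2) (x 2) - pairing2 V (h 3) (x 3)) \<and>
        (\<forall>\<alpha>\<in>dual_space (lev V 2).
           (\<forall>x\<in>horn V 3 1. \<alpha> (gmult V 2 1 x)
              = pairing2 V (h 0) (x 0) + pairing2 V (h 2) (x 2) - pairing2 V (h 3) (x 3))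
           \<longrightarrow> \<alpha> = component 2 V (gmult (ndual 2 V) 2 1 h) [0,1,2]) \<and>
        (\<forall>f\<in>lev (ndual 2 V) 2.
           component 2 V f [0,1,2] = component 2 V (gmult (ndual 2 V) 2 1 h) [0,1,2] \<and>
           face (ndual 2 V) 2 0 f = face (ndual 2 V) 2 0 (h 0) \<and>
           face (ndual 2 V) 2 1 f = face (ndual 2 V) 2 1 (h 2) \<and>
           face (ndual 2 V) 2 2 f = face (ndual 2 V) 2 1 (h 3)
           \<longleftrightarrow> f = gmult (ndual 2 V) 2 1 h)" (is "?M \<and> ?P \<and> ?U \<and> ?D")
    if h: "h \<in> horn (ndual 2 V) 3 1" for h
  proof (intro conjI)
    note mu = ndual_multiplication[OF h]
    show ?M by (rule mu(1))
    show ?P using mu(2) by blast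
    show ?U using pairing_determines[OF mu(1)] mu(2) by simp
    show ?D
    proof (intro ballI iffI)
      fix f assume f: "f \<in> lev (ndual 2 V) 2"
        and "component 2 V f [0,1,2] = component 2 V (gmult (ndual 2 V) 2 1 h) [0,1,2] \<and>
           face (ndual 2 V) 2 0 f = face (ndual 2 V) 2 0 (h 0) \<and>
           face (ndual 2 V) 2 1 f = face (ndual 2 V) 2 1 (h 2) \<and>
           face (ndual 2 V) 2 2 f = face (ndual 2 V) 2 1 (h 3)"
      then show "f = gmult (ndual 2 V) 2 1 h"
        by (intro ndual2_eqI_faces[OF f mu(1)]) (simp_all only: mu(3,5))
    qed (use mu(3,4,5) in simp)
  qed
  show ?thesis
    using groupoid_ndual ident_iso ident_face1 ident_degen0 ident_face2 ident_degen1
      dual1_face_formulas mult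
    by (intro conjI ballI) (auto split: prod.split)
qed

end
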